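(* Let $n\ge3$, $\alpha\in(0,1)$, $\beta\in(0,\frac12)$, let $f$ be the force described in the context, and let $$\Pi(x,t)=\int_0^t\int_{\mathbb R^n_+}P(x,y,t-s)\cdot f(y,s)\,dy\,ds$$ be the pressure associated with the weak solution $w(x,t)=\int_0^t\int_{\mathbb R^n_+}K(x,y,t-s)f(y,s)\,dy\,ds$ of the Stokes system $w_t-\Delta w+\nabla\Pi=f$, $\operatorname{div}w=0$ in $\mathbb R^n_+\times(0,1)$, $w|_{x_n=0}=0$, $w|_{t=0}=0$. (i) Let $p>\frac{2n}{n-1}$ and $q>1$, and suppose that $$\beta>\frac{n}{(n-1)p},\qquad 2\alpha+n\beta<\frac2q+\frac np+1 .$$ Then $\Pi$ is globally bounded in $L^q_tL^p_x$ and satisfies $$\|\Pi\|_{L^q(0,1;L^p(\mathbb R^n_+))}\le c=c\big(\|f\|_{L^{q_1}_tL^{p_1}_x(\mathbb R^n_+\times(0,1))}\big),$$ where $q_1\in[1,\frac1\alpha)$ and $p_1\in[1,\frac1\beta)$. (ii) If $q\in(1,\infty)$ satisfies $1+\frac2q<2\alpha+\beta$, then $\Pi$ is locally unbounded in $L^q_{x,t}$, that is, $$\|\Pi\|_{L^q(\{|x'|>2\}\times(a',b')\times(0,1))}=\infty$$ for any $a',b'$ with $0\le a'<b'<\infty$, where the domain is the set of $(x',x_n,t)$ with $x'\in\mathbb R^{n-1}$, $|x'|>2$, $x_n\in(a',b')$, $t\in(0,1)$.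
   Context: Notation: $x=(x',x_n)$ with $x'\in\mathbb R^{n-1}$; $\mathbb R_+=(0,\infty)$; $\mathbb R^n_+=\{x\in\mathbb R^n:x_n>0\}$; $y^*=(y',-y_n)$; points $z'\in\mathbb R^{n-1}$ are identified with $(z',0)$; $\delta_{ij}$ is the Kronecker delta; $L^q_tL^p_x$ denotes $L^q$ in time with values in $L^p$ in space. Force $f$: $g(x)=g^{\mathcal T}(x')g^{\mathcal N}(x_n)$ with non-negative $g^{\mathcal T}\in C_c^\infty(\mathbb R^{n-1})$, not identically zero, with support compactly contained in $\{|x'|<1\}$, and non-negative $g^{\mathcal N}\in C^\infty(\mathbb R_+)$ with support contained in $(0,2)$ and $g^{\mathcal N}(x_n)=x_n^{1-\beta}$ for $x_n\in(0,1]$. Let $a>0$ be a constant, $h(t)=(t-\frac12)^{-\alpha}\chi_{(\frac12,\infty)}(t)$, and $f(x,t)=\big(0,\ a\,\partial_{x_n}g(x)h(t),\ 0,\dots,0,\ -a\,\partial_{x_2}g(x)h(t)\big)$, i.e. $f_2=a\,\partial_{x_n}g\,h$, $f_n=-a\,\partial_{x_2}g\,h$, and all other components vanish. Kernels: with $\Gamma(x,t)=(4\pi t)^{-n/2}e^{-|x|^2/(4t)}$ and $N(x)=-c_n|x|^{2-n}$, $c_n=(n(n-2)\omega_n)^{-1}$ ($\omega_n$ the volume of the unit ball), $K=(K_{ij})$ and $P=(P_j)$ are $$K_{ij}(x,y,t)=\delta_{ij}\big(\Gamma(x-y,t)-\Gamma(x-y^*,t)\big)-4(1-\delta_{jn})D_{x_j}\int_0^{x_n}\int_{\mathbb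 R^{n-1}}\Gamma(x-y^*-z,t)D_{z_i}N(z)\,dz ,$$ $$P_j(x,y,t)=4(1-\delta_{jn})D_{x_j}(D_{x_n}+D_{y_n})\int_{\mathbb R^{n-1}}N(x-z')\Gamma(z'-y,t)\,dz' .$$ *)

theory Defs
  imports "HOL-Analysis.Analysis"
begin

text \<open>
  Points of n-dimensional space are pairs in \<^typ>\<open>(real^'m) \<times> real\<close>, the first component being the
  tangential part and the second the normal coordinate, so that n is the cardinality of \<^typ>\<open>'m\<close>
  plus one. The norm and Lebesgue measure of the product type are the Euclidean ones. Coordinate
  indices are represented by the vectors of the standard basis \<^term>\<open>Basis\<close>; the normal one is
  \<open>e_n\<close>, and \<open>e_tan k\<close> is the tangential one with index \<open>k\<close>.
\<close>

type_synonym 'm space = "(real^'m) \<times> real"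

definition e_n :: "'m::finite space" where
  "e_n = (0, 1)"

definition e_tan :: "'m \<Rightarrow> 'm::finite space" where
  "e_tan k = (axis k 1, 0)"

definition half_space :: "('m::finite space) set" where
  "half_space = {x. snd x > 0}"

definition partial :: "'a::real_normed_vector \<Rightarrow> ('a \<Rightarrow> real) \<Rightarrow> 'a \<Rightarrow> real" where
  "partial e F x = deriv (\<lambda>s. F (x + s *\<^sub>R e)) 0"


subsection \<open>Smooth functions\<close>

text \<open>Intended for open \<open>S\<close> and finite-dimensional domains, where these are the usual classes of
  \<open>k\<close> times continuously differentiable and of infinitely differentiable functions.\<close>

primrec Ck_on :: "nat \<Rightarrow> 'a::real_normed_vector set \<Rightarrow> ('a \<Rightarrow> 'b::real_normed_vector) \<Rightarrow> bool" where
  "Ck_on 0 S F \<longleftrightarrow> continuous_on S F"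
| "Ck_on (Suc k) S F \<longleftrightarrow> (\<forall>x\<in>S. F differentiable (at x)) \<and>
     (\<forall>v. Ck_on k S (\<lambda>x. frechet_derivative F (at x) v))"

definition smooth_on :: "'a::real_normed_vector set \<Rightarrow> ('a \<Rightarrow> 'b::real_normed_vector) \<Rightarrow> bool" where
  "smooth_on S F \<longleftrightarrow> (\<forall>k. Ck_on k S F)"


subsection \<open>Lebesgue norms with values in the extended non-negative reals\<close>

text \<open>Only used for positive exponents.\<close>

definition epowr :: "ennreal \<Rightarrow> real \<Rightarrow> ennreal" where
  "epowr u r = (if u = \<infinity> then \<infinity> else ennreal (enn2real u powr r))"

definition Lnorm :: "'a measure \<Rightarrow> real \<Rightarrow> ('a \<Rightarrow> ennreal) \<Rightarrow> ennreal" where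
  "Lnorm M p F = epowr (\<integral>\<^sup>+ x. epowr (F x) p \<partial>M) (1 / p)"

text \<open>The norm of \<open>F\<close> in L^q over the time interval (0,1) with values in L^p over the half space.\<close>

definition LqLp_norm ::
    "real \<Rightarrow> real \<Rightarrow> ('m::finite space \<Rightarrow> real \<Rightarrow> 'b::real_normed_vector) \<Rightarrow> ennreal" where
  "LqLp_norm q p F =
     Lnorm (restrict_space lborel {0<..<1}) q
       (\<lambda>t. Lnorm (restrict_space lborel half_space) p (\<lambda>x. ennreal (norm (F x t))))"


subsection \<open>Kernels\<close>

definition heat_kernel :: "'a::euclidean_space \<Rightarrow> real \<Rightarrow> real" where
  "heat_kernel x t =
     (4 * pi * t) powr (- (real DIM('a) / 2)) * exp (- (norm x)\<^sup>2 / (4 * t))"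

definition newton_kernel :: "'a::euclidean_space \<Rightarrow> real" where
  "newton_kernel x =
     (let n = real DIM('a); c = 1 / (n * (n - 2) * unit_ball_vol n)
      in - c * norm x powr (2 - n))"

definition boundary_potential :: "'m::finite space \<Rightarrow> 'm space \<Rightarrow> real \<Rightarrow> real" where
  "boundary_potential x y t =
     (LINT z|lborel. newton_kernel (x - (z, 0)) * heat_kernel ((z, 0) - y) t)"

definition pressure_kernel_comp ::
    "'m::finite space \<Rightarrow> 'm space \<Rightarrow> 'm space \<Rightarrow> real \<Rightarrow> real" where
  "pressure_kernel_comp e x y t =
     4 * (1 - (if e = e_n then 1 else 0)) *
     partial e (\<lambda>x. partial e_n (\<lambda>x. boundary_potential x y t) x
                  + partial e_n (\<lambda>y. boundary_potential x y t) y) x"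

definition pressure_kernel :: "'m::finite space \<Rightarrow> 'm space \<Rightarrow> real \<Rightarrow> 'm space" where
  "pressure_kernel x y t = (\<Sum>e\<in>Basis. pressure_kernel_comp e x y t *\<^sub>R e)"

definition pressure :: "('m::finite space \<Rightarrow> real \<Rightarrow> 'm space) \<Rightarrow> 'm space \<Rightarrow> real \<Rightarrow> real" where
  "pressure f x t =
     (LINT s:{0<..<t}|lborel. LINT y:half_space|lborel. pressure_kernel x y (t - s) \<bullet> f y s)"


subsection \<open>The force\<close>

definition time_profile :: "real \<Rightarrow> real \<Rightarrow> real" where
  "time_profile \<alpha> t = (if t > 1/2 then (t - 1/2) powr (- \<alpha>) else 0)"

definition space_profile :: "(real^'m \<Rightarrow> real) \<Rightarrow> (real \<Rightarrow> real) \<Rightarrow> 'm::finite space \<Rightarrow> real" where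
  "space_profile gT gN x = gT (fst x) * gN (snd x)"

definition tangential_profile :: "(real^'m::finite \<Rightarrow> real) \<Rightarrow> bool" where
  "tangential_profile gT \<longleftrightarrow>
     smooth_on UNIV gT \<and> (\<forall>z. 0 \<le> gT z) \<and> (\<exists>z. gT z \<noteq> 0) \<and>
     closure {z. gT z \<noteq> 0} \<subseteq> ball 0 1"

text \<open>The values of \<open>gN\<close> outside (0,\<open>\<infinity>\<close>) are irrelevant; its support is the closure relative to
  that interval.\<close>

definition normal_profile :: "real \<Rightarrow> (real \<Rightarrow> real) \<Rightarrow> bool" where
  "normal_profile \<beta> gN \<longleftrightarrow>
     smooth_on {0<..} gN \<and> (\<forall>r>0. 0 \<le> gN r) \<and>
     closure {r. r > 0 \<and> gN r \<noteq> 0} \<inter> {0<..} \<subseteq> {0<..<2} \<and>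
     (\<forall>r\<in>{0<..1}. gN r = r powr (1 - \<beta>))"

text \<open>The tangential index \<open>k\<close> plays the role of the second coordinate.\<close>

definition force ::
    "real \<Rightarrow> real \<Rightarrow> 'm \<Rightarrow> (real^'m \<Rightarrow> real) \<Rightarrow> (real \<Rightarrow> real) \<Rightarrow> 'm::finite space \<Rightarrow> real \<Rightarrow> 'm space"
  where
  "force \<alpha> a k gT gN x t =
     (a * partial e_n (space_profile gT gN) x * time_profile \<alpha> t) *\<^sub>R e_tan k
     + (- a * partial (e_tan k) (space_profile gT gN) x * time_profile \<alpha> t) *\<^sub>R e_n"

end

theory Submission
  imports Defs "HOL-Probability.Distributions"
begin

text \<open>
  The theorem holds because the pressure is almost a product of a function of space and a
  singular function of time. The component \<open>P_n\<close> of the pressure kernel vanishes, so of the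
  force only the component along \<open>e_tan k\<close> matters, and there the spatial part of the force is
  \<open>gT(y') gN'(y_n)\<close>. The potential \<open>boundary_potential x y t\<close> is the product of the
  one-dimensional heat kernel in \<open>y_n\<close> and of the average of the Newton kernel
  \<open>N\<close> against the tangential heat kernel at \<open>y'\<close>. Integrating out \<open>y\<close> therefore gives, for
  \<open>x\<close> in the half space,

  \<open>\<Pi>(x,t) = 4 a \<integral> (s - 1/2)^(-\<alpha>) (A(t-s) \<Psi>(x,t-s) - B(t-s) \<Phi>(x,t-s)) ds\<close>,

  the integral being over \<open>1/2 < s < t\<close> (lemma \<open>pressure_eq_time_integral\<close>). Here
  \<open>\<Phi>\<close> and \<open>\<Psi>\<close> are the layer potentials of \<open>gT\<close> with kernels \<open>\<partial>_k N\<close> and \<open>\<partial>_n \<partial>_k N\<close>, smoothed by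
  the tangential heat flow, and \<open>A(\<tau>)\<close>, \<open>B(\<tau>)\<close> are the integrals of \<open>gN'(y)\<close> against
  the one-dimensional heat kernel \<open>\<Gamma>(y,\<tau>)\<close> and against \<open>y/(2\<tau>) \<Gamma>(y,\<tau>)\<close>.

  Space: moving the tangential derivative onto \<open>gT\<close> leaves the weakly singular kernel \<open>N\<close> for
  \<open>\<Phi>\<close> and the Poisson kernel for \<open>\<Psi>\<close>, so both are bounded near the support of \<open>gT\<close>. Far away the
  kernels themselves decay like \<open>|x|^(1-n)\<close>. Peetre's inequality and the moments of the Gaussian
  carry the resulting bound \<open>C (1 + |x|)^(1-n)\<close> through the heat flow, uniformly in \<open>0 < \<tau> \<le> 1\<close>
  (lemmas \<open>layer_potential_decay\<close> and \<open>heat_smoothed_decay\<close>).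

  Time: as \<open>gN'(y) = (1-\<beta>) y^(-\<beta>)\<close> near \<open>0\<close>, scaling gives \<open>A(\<tau>) = O(\<tau>^(-\<beta>/2))\<close>, while
  \<open>B(\<tau>)\<close> is of the exact order \<open>\<tau>^(-(1+\<beta>)/2)\<close> (lemmas \<open>heat_moment_upper\<close> and
  \<open>heat_moment1_lower\<close>). The integral in \<open>s\<close> is then a Beta integral, and

  \<open>|\<Pi>(x,t)| \<le> a C (1 + |x|)^(1-n) (t - 1/2)^e\<close> with \<open>e = 1 - \<alpha> - (1+\<beta>)/2\<close>.

  This bound is in the mixed Lebesgue space as soon as \<open>p (n-1) > n\<close> and \<open>q e > -1\<close>, and the
  latter follows from the two hypotheses on \<open>\<beta>\<close> and \<open>2\<alpha> + n\<beta>\<close>. Both the pressure and the force are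
  linear in \<open>a\<close>, so finiteness is all that is needed for an estimate by the norm of the force,
  once that norm is known to be positive.

  For the unboundedness, \<open>\<Phi>\<close> is bounded below by a positive constant where \<open>x_k\<close> is large, because
  \<open>\<partial>_k N\<close> is positive there and \<open>gT \<ge> 0\<close>. For small \<open>\<tau>\<close> the term \<open>B \<Phi>\<close> then dominates \<open>A \<Psi>\<close>, whence
  \<open>|\<Pi>(x,t)| \<ge> c (t - 1/2)^e\<close> for \<open>t\<close> slightly above \<open>1/2\<close> (lemma \<open>pressure_lower\<close>). The hypothesis
  \<open>1 + 2/q < 2\<alpha> + \<beta>\<close> says that \<open>q e < -1\<close>, and the \<open>q\<close>-th power of this lower bound is not
  integrable.
\<close>


section \<open>Integrals of powers of the distance\<close>

text \<open>Bounds a radial power by a product of functions of one coordinate each, so that integrals over a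
  Euclidean space reduce to one-dimensional ones by Tonelli's theorem.\<close>

lemma powr_le_prod_Basis:
  fixes L s :: real and l :: "'a::euclidean_space \<Rightarrow> real"
  assumes "\<And>b. b \<in> Basis \<Longrightarrow> 0 < l b" "\<And>b. b \<in> Basis \<Longrightarrow> l b \<le> L" and "0 \<le> s"
  shows "L powr (- s) \<le> (\<Prod>b\<in>(Basis::'a set). l b powr (- (s / DIM('a))))"
proof -
  obtain b0 :: 'a where "b0 \<in> Basis" using nonempty_Basis by blast
  then have L: "0 < L" using assms(1,2) by (meson less_le_trans)
  have "L powr (- s) = (\<Prod>b\<in>(Basis::'a set). L powr (- (s / DIM('a))))"
    using L by (simp add: powr_powr flip: powr_realpow)
  also have "\<dots> \<le> (\<Prod>b\<in>(Basis::'a set). l b powr (- (s / DIM('a))))"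
    using assms L by (intro prod_mono) (auto intro!: powr_mono2')
  finally show ?thesis .
qed

lemma nn_integral_lborel_prod_same:
  fixes u :: "real \<Rightarrow> real"
  assumes [measurable]: "u \<in> borel_measurable borel" and nn: "\<And>x. 0 \<le> u x"
  shows "(\<integral>\<^sup>+x. ennreal (\<Prod>b\<in>Basis. u (x \<bullet> b)) \<partial>(lborel :: 'a::euclidean_space measure))
         = (\<integral>\<^sup>+x. ennreal (u x) \<partial>lborel) ^ DIM('a)"
proof -
  have "(\<integral>\<^sup>+x. ennreal (\<Prod>b\<in>Basis. u (x \<bullet> b)) \<partial>(lborel :: 'a measure))
      = (\<integral>\<^sup>+x. (\<Prod>b\<in>Basis. ennreal (u (x \<bullet> b))) \<partial>(lborel :: 'a measure))"
    by (simp add: prod_ennreal nn)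
  also have "\<dots> = (\<integral>\<^sup>+x. ennreal (u x) \<partial>lborel) ^ DIM('a)"
    using nn_integral_lborel_prod[of "\<lambda>(_::'a) x. ennreal (u x)"] by simp
  finally show ?thesis .
qed

lemma nn_integral_even_le:
  fixes u :: "real \<Rightarrow> ennreal"
  assumes [measurable]: "u \<in> borel_measurable borel"
  shows "(\<integral>\<^sup>+x. u \<bar>x\<bar> \<partial>lborel) \<le> 2 * (\<integral>\<^sup>+x. u x * indicator {0..} x \<partial>lborel)"
proof -
  have "(\<integral>\<^sup>+x. u \<bar>x\<bar> \<partial>lborel)
      \<le> (\<integral>\<^sup>+x. u x * indicator {0..} x + u (0 + (-1) * x) * indicator {0..} (0 + (-1) * x) \<partial>lborel)"
    by (intro nn_integral_mono) (auto split: split_indicator)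
  also have "\<dots> = (\<integral>\<^sup>+x. u x * indicator {0..} x \<partial>lborel)
      + (\<integral>\<^sup>+x. u (0 + (-1) * x) * indicator {0..} (0 + (-1) * x) \<partial>lborel)"
    by (intro nn_integral_add) auto
  also have "(\<integral>\<^sup>+x. u (0 + (-1) * x) * indicator {0..} (0 + (-1) * x) \<partial>lborel)
      = (\<integral>\<^sup>+x. u x * indicator {0..} x \<partial>lborel)"
    using nn_integral_real_affine[of "\<lambda>x. u x * indicator {0..} x" "-1" 0] by simp
  finally show ?thesis by (simp add: mult_2)
qed

lemma powr_interval:
  fixes c e :: real
  assumes "e > -1" "c \<ge> 0"
  shows "has_bochner_integral lborel (\<lambda>u. indicator {0<..<c} u * u powr e) (c powr (e + 1) / (e + 1))"
proof -
  have "((\<lambda>u. u powr e) has_integral (c powr (e + 1) / (e + 1))) {0<..<c}"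
    using has_integral_powr_from_0[OF assms] has_integral_Icc_iff_Ioo by blast
  then have "((\<lambda>u. indicator {0<..<c} u * u powr e) has_integral (c powr (e + 1) / (e + 1))) UNIV"
    by (subst (asm) has_integral_restrict_UNIV[symmetric])
       (auto simp: indicator_def if_distrib cong: if_cong elim!: has_integral_eq[rotated])
  then have "(\<integral>\<^sup>+u. ennreal (indicator {0<..<c} u * u powr e) \<partial>lborel) = ennreal (c powr (e + 1) / (e + 1))"
    by (intro nn_integral_has_integral_lborel) auto
  then show ?thesis using assms
    by (intro has_bochner_integral_nn_integral) auto
qed

lemma nn_integral_one_plus_abs_powr:
  fixes e :: real
  assumes "e > 1"
  shows "(\<integral>\<^sup>+u. ennreal ((1 + \<bar>u\<bar>) powr (- e)) \<partial>lborel) < \<infinity>"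
proof -
  have lim: "((\<lambda>u::real. 1 / (1 - e) * (1 + u) powr (1 - e)) \<longlongrightarrow> 1 / (1 - e) * 0) at_top"
    using assms by (intro tendsto_intros tendsto_neg_powr filterlim_tendsto_add_at_top[OF tendsto_const])
      (auto simp: filterlim_ident)
  have "(\<integral>\<^sup>+u. ennreal ((1 + u) powr (- e)) * indicator {0..} u \<partial>lborel)
      = ennreal (1 / (1 - e) * 0 - 1 / (1 - e) * (1 + 0) powr (1 - e))"
  proof (rule nn_integral_FTC_atLeast[OF _ _ _ lim])
    fix u :: real assume u: "0 \<le> u"
    have "((\<lambda>u. 1 / (1 - e) * (1 + u) powr (1 - e)) has_real_derivative
        1 / (1 - e) * ((1 - e) * (1 + u) powr (1 - e - of_nat 1) * 1)) (at u)"
      using u by (intro DERIV_cmult DERIV_fun_powr) (auto intro!: derivative_eq_intros)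
    then show "((\<lambda>u. 1 / (1 - e) * (1 + u) powr (1 - e)) has_real_derivative (1 + u) powr (- e)) (at u)"
      using assms by simp
  qed auto
  then have fin: "(\<integral>\<^sup>+u. ennreal ((1 + u) powr (- e)) * indicator {0..} u \<partial>lborel) < \<infinity>"
    by simp
  have "(\<integral>\<^sup>+u. ennreal ((1 + \<bar>u\<bar>) powr (- e)) \<partial>lborel)
      \<le> 2 * (\<integral>\<^sup>+u. ennreal ((1 + u) powr (- e)) * indicator {0..} u \<partial>lborel)"
    using nn_integral_even_le[of "\<lambda>u. ennreal ((1 + u) powr (- e))"] by simp
  also have "\<dots> < \<infinity>" using fin by (simp add: ennreal_mult_less_top)
  finally show ?thesis .
qed

lemma nn_integral_one_plus_norm_powr:
  fixes s :: real
  assumes "s > DIM('a::euclidean_space)"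
  shows "(\<integral>\<^sup>+x. ennreal ((1 + norm x) powr (- s)) \<partial>(lborel :: 'a measure)) < \<infinity>"
proof -
  have "s / DIM('a) > 1" using assms by (simp add: field_simps)
  then have fin: "(\<integral>\<^sup>+u. ennreal ((1 + \<bar>u\<bar>) powr (- (s / DIM('a)))) \<partial>lborel) < \<infinity>"
    by (rule nn_integral_one_plus_abs_powr)
  have "(\<integral>\<^sup>+x. ennreal ((1 + norm x) powr (- s)) \<partial>(lborel :: 'a measure))
     \<le> (\<integral>\<^sup>+x. ennreal (\<Prod>b\<in>Basis. (1 + \<bar>x \<bullet> b\<bar>) powr (- (s / DIM('a)))) \<partial>(lborel :: 'a measure))"
    using assms
    by (intro nn_integral_mono ennreal_leI powr_le_prod_Basis) (auto simp: Basis_le_norm add_pos_nonneg)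
  also have "\<dots> = (\<integral>\<^sup>+u. ennreal ((1 + \<bar>u\<bar>) powr (- (s / DIM('a)))) \<partial>lborel) ^ DIM('a)"
    by (intro nn_integral_lborel_prod_same) auto
  also have "\<dots> < \<infinity>" using fin by (simp add: power_less_top_ennreal)
  finally show ?thesis .
qed

text \<open>The substitution \<open>u = r v\<close> makes the dependence on \<open>r\<close> explicit.\<close>

lemma nn_integral_poisson_1:
  fixes e :: real
  assumes "e > 0"
  obtains C :: real where "0 \<le> C"
    "\<And>r. r > 0 \<Longrightarrow> (\<integral>\<^sup>+u. ennreal (sqrt (u\<^sup>2 + r\<^sup>2) powr (- (1 + e))) \<partial>lborel) \<le> ennreal (C * r powr (- e))"
proof -
  define I where "I = (\<integral>\<^sup>+u. ennreal (sqrt (u\<^sup>2 + 1) powr (- (1 + e))) \<partial>lborel)"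
  have "I \<le> (\<integral>\<^sup>+u. ennreal (2 powr (1 + e)) * ennreal ((1 + \<bar>u\<bar>) powr (- (1 + e))) \<partial>lborel)"
    unfolding I_def
  proof (intro nn_integral_mono)
    fix u :: real
    have "(1 + \<bar>u\<bar>) / 2 \<le> sqrt (u\<^sup>2 + 1)"
    proof (rule real_le_rsqrt)
      have "0 \<le> (\<bar>u\<bar> - 1)\<^sup>2" by simp
      then show "((1 + \<bar>u\<bar>) / 2)\<^sup>2 \<le> u\<^sup>2 + 1"
        by (simp add: power2_eq_square field_simps)
    qed
    then have "sqrt (u\<^sup>2 + 1) powr (- (1 + e)) \<le> ((1 + \<bar>u\<bar>) / 2) powr (- (1 + e))"
      using assms by (intro powr_mono2') auto
    also have "\<dots> = 2 powr (1 + e) * (1 + \<bar>u\<bar>) powr (- (1 + e))"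
      by (subst powr_divide) (simp_all add: powr_minus_divide del: minus_add_distrib)
    finally show "ennreal (sqrt (u\<^sup>2 + 1) powr (- (1 + e)))
        \<le> ennreal (2 powr (1 + e)) * ennreal ((1 + \<bar>u\<bar>) powr (- (1 + e)))"
      by (simp add: ennreal_leI flip: ennreal_mult)
  qed
  also have "\<dots> < \<infinity>"
    using nn_integral_one_plus_abs_powr[of "1 + e"] assms
    by (subst nn_integral_cmult) (auto simp: ennreal_mult_less_top)
  finally have fin: "I < \<infinity>" .
  show ?thesis
  proof
    show "0 \<le> enn2real I" by simp
    fix r :: real assume r: "r > 0"
    have sq: "sqrt ((0 + r * u)\<^sup>2 + r\<^sup>2) = r * sqrt (u\<^sup>2 + 1)" for u
    proof -
      have "(0 + r * u)\<^sup>2 + r\<^sup>2 = r\<^sup>2 * (u\<^sup>2 + 1)" by (simp add: algebra_simps power_mult_distrib)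
      then show ?thesis using r by (simp add: real_sqrt_mult)
    qed
    have "(\<integral>\<^sup>+u. ennreal (sqrt (u\<^sup>2 + r\<^sup>2) powr (- (1 + e))) \<partial>lborel)
       = ennreal \<bar>r\<bar> * (\<integral>\<^sup>+u. ennreal (sqrt ((0 + r * u)\<^sup>2 + r\<^sup>2) powr (- (1 + e))) \<partial>lborel)"
      using r by (intro nn_integral_real_affine) auto
    also have "\<dots> = ennreal r * (\<integral>\<^sup>+u. ennreal (r powr (- (1 + e))) * ennreal (sqrt (u\<^sup>2 + 1) powr (- (1 + e))) \<partial>lborel)"
      unfolding sq using r by (simp add: powr_mult ennreal_mult)
    also have "\<dots> = ennreal r * (ennreal (r powr (- (1 + e))) * I)"
      unfolding I_def by (subst nn_integral_cmult) auto
    also have "\<dots> = ennreal (enn2real I * r powr (- e))"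
    proof -
      have "r * r powr (- (1 + e)) = r powr (- e)"
        using r powr_add[of r 1 "- (1 + e)"] by simp
      moreover have "I = ennreal (enn2real I)" using fin by simp
      ultimately show ?thesis using r
        by (metis (no_types, lifting) ennreal_mult' less_imp_le mult.assoc mult.commute powr_ge_zero)
    qed
    finally show "(\<integral>\<^sup>+u. ennreal (sqrt (u\<^sup>2 + r\<^sup>2) powr (- (1 + e))) \<partial>lborel)
       \<le> ennreal (enn2real I * r powr (- e))" by simp
  qed
qed

text \<open>Dropping \<open>r\<close> leaves the power \<open>\<bar>u\<bar> powr (- e)\<close>, which is locally integrable because \<open>e < 1\<close>.\<close>

lemma nn_integral_riesz_1:
  fixes e R r :: real
  assumes "0 \<le> e" "e < 1" "R \<ge> 0" "r > 0"
  shows "(\<integral>\<^sup>+u. ennreal (sqrt (u\<^sup>2 + r\<^sup>2) powr (- e) * indicator {-R<..<R} u) \<partial>lborel)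
     \<le> ennreal (2 * (R powr (1 - e) / (1 - e)))"
proof -
  have "AE u in lborel. u \<noteq> (0::real)" by (rule AE_lborel_singleton)
  then have "(\<integral>\<^sup>+u. ennreal (sqrt (u\<^sup>2 + r\<^sup>2) powr (- e) * indicator {-R<..<R} u) \<partial>lborel)
     \<le> (\<integral>\<^sup>+u. ennreal (indicator {0<..<R} \<bar>u\<bar> * \<bar>u\<bar> powr (- e)) \<partial>lborel)"
  proof (intro nn_integral_mono_AE, eventually_elim)
    case (elim u)
    have "\<bar>u\<bar> \<le> sqrt (u\<^sup>2 + r\<^sup>2)" by (metis real_sqrt_sum_squares_ge1 power2_abs)
    then have "sqrt (u\<^sup>2 + r\<^sup>2) powr (- e) \<le> \<bar>u\<bar> powr (- e)"
      using elim assms by (intro powr_mono2') auto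
    then show ?case using elim by (auto intro!: ennreal_leI split: split_indicator)
  qed
  also have "\<dots> \<le> 2 * (\<integral>\<^sup>+u. ennreal (indicator {0<..<R} u * u powr (- e)) * indicator {0..} u \<partial>lborel)"
    by (rule nn_integral_even_le) auto
  also have "(\<integral>\<^sup>+u. ennreal (indicator {0<..<R} u * u powr (- e)) * indicator {0..} u \<partial>lborel)
      = (\<integral>\<^sup>+u. ennreal (indicator {0<..<R} u * u powr (- e)) \<partial>lborel)"
    by (intro nn_integral_cong) (auto split: split_indicator)
  also have "\<dots> = ennreal (R powr (1 - e) / (1 - e))"
    using powr_interval[of "- e" R] assms
    by (subst nn_integral_eq_integral) (auto simp: has_bochner_integral_iff)
  finally show ?thesis by (subst ennreal_mult') simp_all
qed

lemma norm_pair_ge_component: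
  fixes w :: "'a::euclidean_space" and r :: real
  assumes "b \<in> Basis"
  shows "sqrt ((w \<bullet> b)\<^sup>2 + r\<^sup>2) \<le> norm (w, r)"
  using Basis_le_norm[OF assms, of w]
  by (simp add: norm_prod_def power2_le_iff_abs_le)

text \<open>The integrand is the Poisson kernel of the half space up to a constant. With \<open>D\<close> the dimension,
  each of the \<open>D\<close> coordinates receives the exponent \<open>1 + 1/D\<close> and contributes \<open>r powr (-1/D)\<close>;
  the powers of \<open>r\<close> cancel.\<close>

lemma nn_integral_poisson:
  obtains C :: real where "0 \<le> C" "\<And>r. r > 0 \<Longrightarrow>
    (\<integral>\<^sup>+w. ennreal (r * norm (w, r) powr (- (real DIM('a) + 1))) \<partial>(lborel :: 'a::euclidean_space measure)) \<le> ennreal C"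
proof -
  define D where "D = real DIM('a)"
  have D: "D > 0" by (simp add: D_def)
  obtain C where C: "0 \<le> C" 
    "\<And>r. r > 0 \<Longrightarrow> (\<integral>\<^sup>+u. ennreal (sqrt (u\<^sup>2 + r\<^sup>2) powr (- (1 + 1 / D))) \<partial>lborel) \<le> ennreal (C * r powr (- (1 / D)))"
    using nn_integral_poisson_1[of "1 / D"] D by auto
  show ?thesis
  proof
    show "0 \<le> C ^ DIM('a)" using C by simp
    fix r :: real assume r: "r > 0"
    have "norm (w, r) powr (- (D + 1)) \<le> (\<Prod>b\<in>Basis. sqrt ((w \<bullet> b)\<^sup>2 + r\<^sup>2) powr (- (1 + 1 / D)))" for w :: 'a
      using powr_le_prod_Basis[of "\<lambda>b. sqrt ((w \<bullet> b)\<^sup>2 + r\<^sup>2)" "norm (w, r)" "D + 1"] r D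
      by (auto simp: norm_pair_ge_component add_nonneg_pos D_def[symmetric] add_divide_distrib)
    then have "(\<integral>\<^sup>+w. ennreal (r * norm (w, r) powr (- (D + 1))) \<partial>(lborel :: 'a measure))
      \<le> (\<integral>\<^sup>+w. ennreal r * ennreal (\<Prod>b\<in>Basis. sqrt ((w \<bullet> b)\<^sup>2 + r\<^sup>2) powr (- (1 + 1 / D))) \<partial>(lborel :: 'a measure))"
      using r by (intro nn_integral_mono) (auto simp: ennreal_mult[symmetric] prod_nonneg intro!: ennreal_leI)
    also have "\<dots> = ennreal r * (\<integral>\<^sup>+u. ennreal (sqrt (u\<^sup>2 + r\<^sup>2) powr (- (1 + 1 / D))) \<partial>lborel) ^ DIM('a)"
      by (subst nn_integral_cmult, simp, subst nn_integral_lborel_prod_same) auto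
    also have "\<dots> \<le> ennreal r * ennreal (C * r powr (- (1 / D))) ^ DIM('a)"
      using C(2)[OF r] by (intro mult_left_mono power_mono) auto
    also have "\<dots> = ennreal (r * (C ^ DIM('a) * (r powr (- (1 / D))) ^ DIM('a)))"
      using C r by (simp add: ennreal_power ennreal_mult[symmetric] power_mult_distrib)
    also have "(r powr (- (1 / D))) ^ DIM('a) = r powr (- 1)"
      using r D by (simp add: powr_powr D_def flip: powr_realpow)
    also have "r * (C ^ DIM('a) * r powr (- 1)) = C ^ DIM('a)"
      using r by (simp add: powr_minus)
    finally show "(\<integral>\<^sup>+w. ennreal (r * norm (w, r) powr (- (real DIM('a) + 1))) \<partial>(lborel :: 'a measure)) \<le> ennreal (C ^ DIM('a))"
      by (simp add: D_def add.commute)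
  qed
qed

text \<open>The exponent is one less than the dimension, so spread over the coordinates it stays below \<open>1\<close> and
  the integral is bounded up to the boundary \<open>r = 0\<close>.\<close>

lemma nn_integral_riesz:
  assumes "R \<ge> 0"
  obtains C :: real where "0 \<le> C" "\<And>r. r > 0 \<Longrightarrow>
    (\<integral>\<^sup>+w. ennreal (norm (w, r :: real) powr (- (real DIM('a) - 1)) * indicator (ball 0 R) w) \<partial>(lborel :: 'a::euclidean_space measure)) \<le> ennreal C"
proof -
  define D where "D = real DIM('a)"
  have D: "D \<ge> 1" using DIM_positive[where 'a='a] by (simp add: D_def)
  define e where "e = (D - 1) / D"
  have e: "0 \<le> e" "e < 1" using D by (auto simp: e_def)
  define C where "C = 2 * (R powr (1 - e) / (1 - e))"
  have C: "C \<ge> 0" using e assms by (auto simp: C_def)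
  show ?thesis
  proof
    show "0 \<le> C ^ DIM('a)" using C by simp
    fix r :: real assume r: "r > 0"
    have "norm (w, r) powr (- (D - 1)) * indicator (ball 0 R) w
       \<le> (\<Prod>b\<in>Basis. sqrt ((w \<bullet> b)\<^sup>2 + r\<^sup>2) powr (- e) * indicator {-R<..<R} (w \<bullet> b))" for w :: 'a
    proof (cases "w \<in> ball 0 R")
      case True
      then have "w \<bullet> b \<in> {-R<..<R}" if "b \<in> Basis" for b
        using Basis_le_norm[OF that, of w] by auto
      then have "(\<Prod>b\<in>Basis. sqrt ((w \<bullet> b)\<^sup>2 + r\<^sup>2) powr (- e) * indicator {-R<..<R} (w \<bullet> b))
          = (\<Prod>b\<in>Basis. sqrt ((w \<bullet> b)\<^sup>2 + r\<^sup>2) powr (- e))"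
        by (intro prod.cong) auto
      moreover have "norm (w, r) powr (- (D - 1)) \<le> (\<Prod>b\<in>Basis. sqrt ((w \<bullet> b)\<^sup>2 + r\<^sup>2) powr (- e))"
        using powr_le_prod_Basis[of "\<lambda>b. sqrt ((w \<bullet> b)\<^sup>2 + r\<^sup>2)" "norm (w, r)" "D - 1"] r D
        by (auto simp: norm_pair_ge_component add_nonneg_pos D_def[symmetric] e_def)
      ultimately show ?thesis using True by simp
    qed (simp add: prod_nonneg)
    then have "(\<integral>\<^sup>+w. ennreal (norm (w, r) powr (- (D - 1)) * indicator (ball 0 R) w) \<partial>(lborel :: 'a measure))
      \<le> (\<integral>\<^sup>+w. ennreal (\<Prod>b\<in>Basis. sqrt ((w \<bullet> b)\<^sup>2 + r\<^sup>2) powr (- e) * indicator {-R<..<R} (w \<bullet> b)) \<partial>(lborel :: 'a measure))"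
      by (intro nn_integral_mono ennreal_leI)
    also have "\<dots> = (\<integral>\<^sup>+u. ennreal (sqrt (u\<^sup>2 + r\<^sup>2) powr (- e) * indicator {-R<..<R} u) \<partial>lborel) ^ DIM('a)"
      by (rule nn_integral_lborel_prod_same) auto
    also have "\<dots> \<le> ennreal C ^ DIM('a)"
      unfolding C_def using nn_integral_riesz_1[OF e assms r] by (intro power_mono) auto
    also have "\<dots> = ennreal (C ^ DIM('a))" using C by (simp add: ennreal_power)
    finally show "(\<integral>\<^sup>+w. ennreal (norm (w, r) powr (- (real DIM('a) - 1)) * indicator (ball 0 R) w) \<partial>(lborel :: 'a measure)) \<le> ennreal (C ^ DIM('a))"
      by (simp add: D_def)
  qed
qed

section \<open>The heat kernel\<close>

lemma heat_kernel_nonneg [simp]: "0 \<le> heat_kernel x t"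
  by (simp add: heat_kernel_def)

lemma heat_kernel_measurable [measurable]:
  assumes [measurable]: "f \<in> borel_measurable M" "g \<in> borel_measurable M"
  shows "(\<lambda>x. heat_kernel (f x) (g x)) \<in> borel_measurable M"
  unfolding heat_kernel_def by measurable

text \<open>The heat kernel of the whole space factors into its tangential and its normal part; this is what
  makes the variables separate later.\<close>

lemma heat_kernel_boundary:
  fixes z :: "real^'m" and y :: "'m::finite space"
  assumes "t > 0"
  shows "heat_kernel ((z, 0) - y) t = heat_kernel (z - fst y) t * heat_kernel (snd y) t"
proof -
  have nrm: "(norm ((z, 0) - y))\<^sup>2 = (norm (z - fst y))\<^sup>2 + (norm (snd y))\<^sup>2"
    by (cases y) (simp add: norm_prod_def)
  have "- (real DIM('m space) / 2) = - (real DIM(real^'m) / 2) + - (real DIM(real) / 2)"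
    by (simp add: add_divide_distrib)
  then have 1: "(4 * pi * t) powr (- (real DIM('m space) / 2))
      = (4 * pi * t) powr (- (real DIM(real^'m) / 2)) * (4 * pi * t) powr (- (real DIM(real) / 2))"
    by (metis powr_add)
  have 2: "exp (- (A + B) / (4 * t)) = exp (- A / (4 * t)) * exp (- B / (4 * t))" for A B
    by (simp add: diff_divide_distrib flip: exp_add)
  show ?thesis
    unfolding heat_kernel_def nrm 1 2 by (simp add: mult_ac)
qed

text \<open>Reduces the total mass of the heat kernel to that of the normal distribution of variance \<open>2 t\<close>.\<close>

lemma heat_kernel_eq_prod:
  fixes x :: "'a::euclidean_space"
  assumes "t > 0"
  shows "heat_kernel x t = (\<Prod>b\<in>Basis. normal_density 0 (sqrt (2 * t)) (x \<bullet> b))"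
proof -
  have "(\<Prod>b\<in>(Basis::'a set). normal_density 0 (sqrt (2 * t)) (x \<bullet> b))
     = (\<Prod>b\<in>(Basis::'a set). (4 * pi * t) powr (- (1/2)) * exp (- (x \<bullet> b)\<^sup>2 / (4 * t)))"
    using assms by (simp add: normal_density_def powr_minus powr_half_sqrt field_simps)
  also have "\<dots> = ((4 * pi * t) powr (- (1/2))) ^ DIM('a) * exp (\<Sum>b\<in>(Basis::'a set). - (x \<bullet> b)\<^sup>2 / (4 * t))"
    by (simp add: prod.distrib exp_sum)
  also have "((4 * pi * t) powr (- (1/2))) ^ DIM('a) = (4 * pi * t) powr (- (real DIM('a) / 2))"
    using assms by (simp add: powr_powr flip: powr_realpow)
  also have "(\<Sum>b\<in>(Basis::'a set). - (x \<bullet> b)\<^sup>2 / (4 * t)) = - (norm x)\<^sup>2 / (4 * t)"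
    by (simp add: norm_eq_sqrt_inner euclidean_inner[of x x] power2_eq_square sum_divide_distrib[symmetric]
        sum_negf sum_nonneg)
  finally show ?thesis by (simp add: heat_kernel_def)
qed

lemma nn_integral_heat_kernel:
  assumes "t > 0"
  shows "(\<integral>\<^sup>+x. ennreal (heat_kernel x t) \<partial>(lborel :: 'a::euclidean_space measure)) = 1"
proof -
  have "(\<integral>\<^sup>+u. ennreal (normal_density 0 (sqrt (2 * t)) u) \<partial>lborel) = 1"
    using assms by (subst nn_integral_eq_integral) auto
  then show ?thesis
    using assms by (subst heat_kernel_eq_prod) (simp_all add: nn_integral_lborel_prod_same)
qed

lemma heat_kernel_integrable: "t > 0 \<Longrightarrow> integrable lborel (\<lambda>x::'a::euclidean_space. heat_kernel x t)"
  by (rule integrableI_nonneg) (auto simp: nn_integral_heat_kernel)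

lemma integral_heat_kernel: "t > 0 \<Longrightarrow> (LINT x|lborel. heat_kernel (x::'a::euclidean_space) t) = 1"
  using heat_kernel_integrable[of t, where 'a='a]
  by (simp add: nn_integral_heat_kernel integral_eq_nn_integral)

lemma lborel_integral_shift:
  fixes f :: "'a::euclidean_space \<Rightarrow> real"
  assumes [measurable]: "f \<in> borel_measurable borel"
  shows "(LINT x|lborel. f (c + x)) = (LINT x|lborel. f x)"
  by (subst (2) lborel_distr_plus[of c, symmetric]) (simp add: integral_distr)

lemma lborel_integrable_shift:
  fixes f :: "'a::euclidean_space \<Rightarrow> real"
  assumes "integrable lborel f"
  shows "integrable lborel (\<lambda>x. f (c + x))"
proof -
  have [measurable]: "f \<in> borel_measurable borel" using assms by auto
  show ?thesis using assms
    by (subst (asm) lborel_distr_plus[of c, symmetric]) (simp add: integrable_distr_eq)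
qed

lemma heat_kernel_shift_integrable:
  "t > 0 \<Longrightarrow> integrable lborel (\<lambda>z::'a::euclidean_space. heat_kernel (z - y) t)"
  using lborel_integrable_shift[OF heat_kernel_integrable, of t "- y"] by simp

text \<open>Half of the Gaussian decay is split off; it pays for polynomial weights and for tails, while the
  remaining half is again a heat kernel, at twice the time.\<close>

lemma heat_kernel_double:
  fixes w :: "'a::euclidean_space"
  assumes "t > 0"
  shows "heat_kernel w t = 2 powr (real DIM('a) / 2) * exp (- (norm w)\<^sup>2 / (8 * t)) * heat_kernel w (2 * t)"
proof -
  have "exp (- (norm w)\<^sup>2 / (4 * t)) = exp (- (norm w)\<^sup>2 / (8 * t)) * exp (- (norm w)\<^sup>2 / (4 * (2 * t)))"
    using assms by (simp add: field_simps flip: exp_add)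
  moreover have "(4 * pi * (2 * t)) powr (- (real DIM('a) / 2))
      = 2 powr (- (real DIM('a) / 2)) * (4 * pi * t) powr (- (real DIM('a) / 2))"
    using assms by (subst powr_mult[symmetric]) (auto simp: ac_simps)
  moreover have "2 powr (real DIM('a) / 2) * 2 powr (- (real DIM('a) / 2)) = (1::real)"
    by (simp flip: powr_add)
  ultimately show ?thesis
    by (simp add: heat_kernel_def mult_ac)
qed

lemma heat_kernel_moment_le:
  fixes s :: real
  assumes "0 \<le> s"
  obtains C where "0 \<le> C" "\<And>w t. 0 < t \<Longrightarrow> t \<le> 1 \<Longrightarrow>
    heat_kernel (w::'a::euclidean_space) t * (1 + norm w) powr s \<le> C * heat_kernel w (2 * t)"
proof
  let ?K = "2 powr (real DIM('a) / 2)"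
  show "0 \<le> ?K * exp (2 * s\<^sup>2)" by simp
  fix w :: 'a and t :: real assume t: "0 < t" "t \<le> 1"
  have "(1 + norm w) powr s \<le> exp (norm w) powr s"
    using assms by (intro powr_mono2) (auto intro: exp_ge_add_one_self)
  also have "\<dots> = exp (s * norm w)" by (simp add: powr_def)
  finally have 1: "(1 + norm w) powr s \<le> exp (s * norm w)" .
  \<comment> \<open>A square is completed in order to absorb the linear exponent into a part of the Gaussian.\<close>
  have "0 \<le> (norm w - 4 * s)\<^sup>2" by simp
  then have "s * norm w \<le> 2 * s\<^sup>2 + (norm w)\<^sup>2 / 8" by (simp add: power2_eq_square field_simps)
  also have "\<dots> \<le> 2 * s\<^sup>2 + (norm w)\<^sup>2 / (8 * t)"
    using t by (intro add_left_mono divide_left_mono) auto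
  finally have "s * norm w - (norm w)\<^sup>2 / (8 * t) \<le> 2 * s\<^sup>2" by simp
  then have 2: "exp (- (norm w)\<^sup>2 / (8 * t)) * exp (s * norm w) \<le> exp (2 * s\<^sup>2)"
    by (simp flip: exp_add)
  have "heat_kernel w t * (1 + norm w) powr s
      \<le> (?K * exp (- (norm w)\<^sup>2 / (8 * t)) * heat_kernel w (2 * t)) * exp (s * norm w)"
    using 1 heat_kernel_double[OF t(1), of w] by (metis heat_kernel_nonneg mult_left_mono)
  also have "\<dots> = ?K * heat_kernel w (2 * t) * (exp (- (norm w)\<^sup>2 / (8 * t)) * exp (s * norm w))"
    by (simp add: mult_ac)
  also have "\<dots> \<le> ?K * heat_kernel w (2 * t) * exp (2 * s\<^sup>2)"
    by (intro mult_left_mono 2) auto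
  finally show "heat_kernel w t * (1 + norm w) powr s \<le> ?K * exp (2 * s\<^sup>2) * heat_kernel w (2 * t)"
    by (simp add: mult_ac)
qed

lemma DERIV_heat_kernel_real:
  assumes "t > 0"
  shows "((\<lambda>s. heat_kernel (y + s) t) has_real_derivative - (y / (2 * t)) * heat_kernel (y::real) t) (at 0)"
proof -
  let ?c = "(4 * pi * t) powr (- (real DIM(real) / 2))"
  have "((\<lambda>s. ?c * exp (- (norm (y + s))\<^sup>2 / (4 * t))) has_real_derivative
      ?c * (exp (- (norm y)\<^sup>2 / (4 * t)) * (- (2 * y) / (4 * t)))) (at 0)"
    by (rule DERIV_cmult) (use assms in \<open>auto intro!: derivative_eq_intros\<close>)
  moreover have "?c * (E * (- (2 * y) / (4 * t))) = - (y / (2 * t)) * (?c * E)" for E by simp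
  ultimately show ?thesis
    unfolding heat_kernel_def by (simp only:)
qed

section \<open>The Newton kernel and differentiation under the integral\<close>

lemma DERIV_norm_powr:
  fixes x e :: "'a::real_inner"
  assumes "x + s *\<^sub>R e \<noteq> 0"
  shows "((\<lambda>s. norm (x + s *\<^sub>R e) powr a) has_real_derivative
            a * norm (x + s *\<^sub>R e) powr (a - 2) * ((x + s *\<^sub>R e) \<bullet> e)) (at s)"
proof -
  let ?q = "\<lambda>s. (x + s *\<^sub>R e) \<bullet> (x + s *\<^sub>R e)"
  have pos: "0 < ?q s" using assms by simp
  have eq: "norm v powr b = (v \<bullet> v) powr (b / 2)" for v :: 'a and b
  proof (cases "v = 0")
    case False
    have "norm v = (v \<bullet> v) powr (1/2)" by (simp add: norm_eq_sqrt_inner powr_half_sqrt)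
    then show ?thesis by (simp add: powr_powr)
  qed simp
  have "?q = (\<lambda>s. x \<bullet> x + 2 * s * (x \<bullet> e) + s\<^sup>2 * (e \<bullet> e))"
    by (auto simp: inner_add inner_commute power2_eq_square algebra_simps)
  moreover have "((\<lambda>s. x \<bullet> x + 2 * s * (x \<bullet> e) + s\<^sup>2 * (e \<bullet> e)) has_real_derivative 2 * ((x + s *\<^sub>R e) \<bullet> e)) (at s)"
    by (auto intro!: derivative_eq_intros simp: inner_add algebra_simps)
  ultimately have "(?q has_real_derivative 2 * ((x + s *\<^sub>R e) \<bullet> e)) (at s)" by simp
  from DERIV_fun_powr[OF this pos, of "a / 2"]
  have "((\<lambda>s. ?q s powr (a / 2)) has_real_derivative a / 2 * ?q s powr (a / 2 - of_nat 1) * (2 * ((x + s *\<^sub>R e) \<bullet> e))) (at s)" .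
  moreover have "a / 2 - of_nat 1 = (a - 2) / 2" by (simp add: field_simps)
  ultimately show ?thesis unfolding eq by (simp only:) (simp add: mult_ac)
qed

text \<open>The derivative of the Newton kernel in direction \<open>e\<close>.\<close>

definition newton_grad :: "'a::euclidean_space \<Rightarrow> 'a \<Rightarrow> real" where
  "newton_grad e x = (x \<bullet> e) * norm x powr (- real DIM('a)) / (real DIM('a) * unit_ball_vol (real DIM('a)))"

text \<open>The mixed second derivative of the Newton kernel in two orthogonal directions. For directions
  that are not orthogonal a further term would appear.\<close>

definition newton_mixed :: "'a::euclidean_space \<Rightarrow> 'a \<Rightarrow> 'a \<Rightarrow> real" where
  "newton_mixed e e' x = - ((x \<bullet> e) * (x \<bullet> e') * norm x powr (- real DIM('a) - 2) / unit_ball_vol (real DIM('a)))"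

lemma newton_kernel_measurable [measurable]:
  assumes [measurable]: "f \<in> borel_measurable M"
  shows "(\<lambda>x. newton_kernel (f x)) \<in> borel_measurable M"
  unfolding newton_kernel_def Let_def by measurable

lemma newton_grad_measurable [measurable]:
  assumes [measurable]: "f \<in> borel_measurable M"
  shows "(\<lambda>x. newton_grad e (f x)) \<in> borel_measurable M"
  unfolding newton_grad_def by measurable

lemma newton_mixed_measurable [measurable]:
  assumes [measurable]: "f \<in> borel_measurable M"
  shows "(\<lambda>x. newton_mixed e e' (f x)) \<in> borel_measurable M"
  unfolding newton_mixed_def by measurable

lemma DERIV_newton_kernel:
  fixes x e :: "'a::euclidean_space"
  assumes "DIM('a) \<ge> 3" "x + s *\<^sub>R e \<noteq> 0"
  shows "((\<lambda>s. newton_kernel (x + s *\<^sub>R e)) has_real_derivative newton_grad e (x + s *\<^sub>R e)) (at s)"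
proof -
  define n where "n = real DIM('a)"
  define v where "v = unit_ball_vol n"
  have n: "n \<ge> 3" "v > 0" using assms(1) by (auto simp: n_def v_def)
  have "((\<lambda>s. - (1 / (n * (n - 2) * v)) * norm (x + s *\<^sub>R e) powr (2 - n)) has_real_derivative
     - (1 / (n * (n - 2) * v)) * ((2 - n) * norm (x + s *\<^sub>R e) powr (2 - n - 2) * ((x + s *\<^sub>R e) \<bullet> e))) (at s)"
    by (intro DERIV_cmult DERIV_norm_powr assms)
  also have "- (1 / (n * (n - 2) * v)) * ((2 - n) * norm (x + s *\<^sub>R e) powr (2 - n - 2) * ((x + s *\<^sub>R e) \<bullet> e))
     = newton_grad e (x + s *\<^sub>R e)"
  proof -
    have "- (1 / (n * (n - 2) * v)) * (2 - n) = 1 / (n * v)" using n by (simp add: field_simps)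
    then have "- (1 / (n * (n - 2) * v)) * ((2 - n) * N * I) = 1 / (n * v) * N * I" for N I
      by (metis mult.assoc)
    then show ?thesis
      unfolding newton_grad_def n_def[symmetric] v_def[symmetric] by simp
  qed
  finally show ?thesis
    by (simp add: newton_kernel_def Let_def n_def v_def)
qed

lemma DERIV_newton_grad:
  fixes x e :: "'a::euclidean_space"
  assumes "x + s *\<^sub>R e' \<noteq> 0" "e' \<bullet> e = 0"
  shows "((\<lambda>s. newton_grad e (x + s *\<^sub>R e')) has_real_derivative newton_mixed e e' (x + s *\<^sub>R e')) (at s)"
proof -
  define n where "n = real DIM('a)"
  define v where "v = unit_ball_vol n"
  have n: "n > 0" "v > 0" by (auto simp: n_def v_def)
  have ce: "(x + s *\<^sub>R e') \<bullet> e = x \<bullet> e" for s using assms by (simp add: inner_add)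
  have "((\<lambda>s. (x \<bullet> e) / (n * v) * norm (x + s *\<^sub>R e') powr (- n)) has_real_derivative
     (x \<bullet> e) / (n * v) * (- n * norm (x + s *\<^sub>R e') powr (- n - 2) * ((x + s *\<^sub>R e') \<bullet> e'))) (at s)"
    by (intro DERIV_cmult DERIV_norm_powr assms)
  then show ?thesis
    unfolding newton_grad_def newton_mixed_def n_def[symmetric] v_def[symmetric] ce using n by (simp add: mult_ac)
qed

lemma abs_newton_kernel:
  fixes x :: "'a::euclidean_space"
  assumes "DIM('a) \<ge> 3"
  obtains C where "0 \<le> C" "\<And>x::'a. \<bar>newton_kernel x\<bar> = C * norm x powr (2 - real DIM('a))"
  by (rule that[of "1 / (real DIM('a) * (real DIM('a) - 2) * unit_ball_vol (real DIM('a)))"])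
     (use assms in \<open>auto simp: newton_kernel_def Let_def abs_mult abs_divide\<close>)

lemma abs_newton_grad_le:
  fixes x e :: "'a::euclidean_space"
  assumes "norm e = 1"
  shows "\<bar>newton_grad e x\<bar> \<le> norm x powr (1 - real DIM('a)) / (real DIM('a) * unit_ball_vol (real DIM('a)))"
proof (cases "x = 0")
  case False
  have "\<bar>x \<bullet> e\<bar> * norm x powr (- real DIM('a)) \<le> norm x * norm x powr (- real DIM('a))"
    using Cauchy_Schwarz_ineq2[of x e] assms by (intro mult_right_mono) auto
  also have "\<dots> = norm x powr (1 - real DIM('a))"
    using False powr_add[of "norm x" 1 "- real DIM('a)"] by simp
  finally show ?thesis by (simp add: newton_grad_def abs_mult abs_divide divide_right_mono)
qed (simp add: newton_grad_def)

lemma abs_newton_mixed_le: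
  fixes x e :: "'a::euclidean_space"
  assumes "norm e = 1" "norm e' = 1"
  shows "\<bar>newton_mixed e e' x\<bar> \<le> norm x powr (- real DIM('a)) / unit_ball_vol (real DIM('a))"
proof (cases "x = 0")
  case False
  have "\<bar>x \<bullet> e\<bar> * \<bar>x \<bullet> e'\<bar> * norm x powr (- real DIM('a) - 2) \<le> norm x * norm x * norm x powr (- real DIM('a) - 2)"
    using Cauchy_Schwarz_ineq2[of x e] Cauchy_Schwarz_ineq2[of x e'] assms by (intro mult_right_mono mult_mono) auto
  also have "norm x * norm x = norm x powr 2" using False by (simp add: power2_eq_square)
  also have "norm x powr 2 * norm x powr (- real DIM('a) - 2) = norm x powr (- real DIM('a))"
    using powr_add[of "norm x" 2 "- real DIM('a) - 2"] by simp
  finally show ?thesis by (simp add: newton_mixed_def abs_mult abs_divide divide_right_mono)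
qed (simp add: newton_mixed_def)

lemma snd_le_norm_diff:
  fixes x :: "'m::finite space"
  shows "\<bar>snd x\<bar> \<le> norm (x - (z, 0))"
  using norm_snd_le[of "snd x" "fst x - z"] by (cases x) simp

text \<open>The kernels are singular at the origin only. A point of the half space keeps at least the distance
  \<open>snd x\<close> from the boundary, so all integrals over the boundary have bounded kernels.\<close>

lemma newton_bounded_above:
  fixes r :: real and e e' :: "'m::finite space"
  assumes "CARD('m) \<ge> 2" "r > 0" "norm e = 1" "norm e' = 1"
  obtains C where "0 \<le> C"
    "\<And>x :: 'm space. r \<le> norm x \<Longrightarrow> \<bar>newton_kernel x\<bar> \<le> C"
    "\<And>x :: 'm space. r \<le> norm x \<Longrightarrow> \<bar>newton_grad e x\<bar> \<le> C"
    "\<And>x :: 'm space. r \<le> norm x \<Longrightarrow> \<bar>newton_mixed e e' x\<bar> \<le> C"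
proof -
  let ?n = "real DIM('m space)"
  have dim: "DIM('m space) \<ge> 3" using assms(1) by simp
  obtain K where K: "0 \<le> K" "\<And>x::'m space. \<bar>newton_kernel x\<bar> = K * norm x powr (2 - ?n)"
    using abs_newton_kernel[OF dim] by metis
  let ?v = "unit_ball_vol ?n"
  have v: "?v > 0" by simp
  let ?C1 = "K * r powr (2 - ?n)" and ?C2 = "r powr (1 - ?n) / (?n * ?v)" and ?C3 = "r powr (- ?n) / ?v"
  have nn: "0 \<le> ?C1" "0 \<le> ?C2" "0 \<le> ?C3" using K v by auto
  show ?thesis
  proof (rule that[of "?C1 + ?C2 + ?C3"])
    show "0 \<le> ?C1 + ?C2 + ?C3" using nn by linarith
    fix x :: "'m space" assume x: "r \<le> norm x"
    have p: "norm x powr a \<le> r powr a" if "a \<le> 0" for a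
      using x assms that by (intro powr_mono2') auto
    have "K * norm x powr (2 - ?n) \<le> ?C1" using K dim by (intro mult_left_mono p) auto
    then show "\<bar>newton_kernel x\<bar> \<le> ?C1 + ?C2 + ?C3" unfolding K(2) using nn by linarith
    have "norm x powr (1 - ?n) / (?n * ?v) \<le> ?C2" using v by (intro divide_right_mono p) auto
    then show "\<bar>newton_grad e x\<bar> \<le> ?C1 + ?C2 + ?C3"
      using nn abs_newton_grad_le[OF assms(3), of x] by linarith
    have "norm x powr (- ?n) / ?v \<le> ?C3" using v by (intro divide_right_mono p) auto
    then show "\<bar>newton_mixed e e' x\<bar> \<le> ?C1 + ?C2 + ?C3"
      using nn abs_newton_mixed_le[OF assms(3,4), of x] by linarith
  qed
qed

text \<open>Differentiation under the integral sign, by dominated convergence of the difference quotients,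
  which the mean value theorem bounds by \<open>C\<close>.\<close>

lemma DERIV_weighted_integral:
  fixes F F' :: "real \<Rightarrow> 'b \<Rightarrow> real" and w :: "'b \<Rightarrow> real"
  assumes "\<delta> > 0" and w: "integrable M w"
    and F_meas [measurable]: "\<And>s. F s \<in> borel_measurable M" "F' 0 \<in> borel_measurable M"
    and deriv: "\<And>s z. \<bar>s\<bar> < \<delta> \<Longrightarrow> ((\<lambda>s. F s z) has_real_derivative F' s z) (at s)"
    and F_bd: "\<And>s z. \<bar>s\<bar> < \<delta> \<Longrightarrow> \<bar>F s z\<bar> \<le> C" and F'_bd: "\<And>s z. \<bar>s\<bar> < \<delta> \<Longrightarrow> \<bar>F' s z\<bar> \<le> C"
  shows "((\<lambda>s. LINT z|M. F s z * w z) has_real_derivative (LINT z|M. F' 0 z * w z)) (at 0)"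
proof -
  have w_meas [measurable]: "w \<in> borel_measurable M" using w by auto
  have int: "integrable M (\<lambda>z. F s z * w z)" if "\<bar>s\<bar> < \<delta>" for s
  proof (rule Bochner_Integration.integrable_bound[OF integrable_mult_right[of C, OF integrable_abs[OF w]]])
    show "AE z in M. norm (F s z * w z) \<le> norm (C * \<bar>w z\<bar>)"
      using F_bd[OF that] by (intro AE_I2) (auto simp: abs_mult intro!: mult_right_mono intro: order_trans[OF _ abs_ge_self])
  qed auto
  have lip: "\<bar>(F h z - F 0 z) / h\<bar> \<le> C" if h: "\<bar>h\<bar> < \<delta>" "h \<noteq> 0" for h z
  proof -
    have "norm (F h z - F 0 z) \<le> C * norm (h - 0)"
    proof (rule field_differentiable_bound[where S="{-\<delta><..<\<delta>}" and f'="\<lambda>s. F' s z"])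
      show "((\<lambda>s. F s z) has_field_derivative F' s z) (at s within {-\<delta><..<\<delta>})" if "s \<in> {-\<delta><..<\<delta>}" for s
        using that deriv[of s z] by (auto intro: has_field_derivative_at_within simp: abs_less_iff)
      show "norm (F' s z) \<le> C" if "s \<in> {-\<delta><..<\<delta>}" for s using that F'_bd[of s z] by (auto simp: abs_less_iff)
    qed (use h in auto)
    then show ?thesis using h by (simp add: abs_divide divide_le_eq)
  qed
  show ?thesis
    unfolding DERIV_def tendsto_at_iff_sequentially comp_def
  proof (intro allI impI)
    fix X :: "nat \<Rightarrow> real" assume X: "\<forall>i. X i \<in> UNIV - {0}" "X \<longlonglongrightarrow> 0"
    \<comment> \<open>Only the tail of the sequence lies within \<open>\<delta>\<close>; the other members are set to zero to be dominated too.\<close>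
    define G where "G i z = (if \<bar>X i\<bar> < \<delta> then (F (X i) z - F 0 z) / X i * w z else 0)" for i z
    have ev: "\<forall>\<^sub>F i in sequentially. \<bar>X i\<bar> < \<delta>"
      using tendsto_rabs[OF X(2)] \<open>\<delta> > 0\<close> by (intro order_tendstoD) auto
    have "(\<lambda>i. LINT z|M. G i z) \<longlonglongrightarrow> (LINT z|M. F' 0 z * w z)"
    proof (rule integral_dominated_convergence[where w="\<lambda>z. C * \<bar>w z\<bar>"])
      show "integrable M (\<lambda>z. C * \<bar>w z\<bar>)" using w by auto
      show "AE z in M. (\<lambda>i. G i z) \<longlonglongrightarrow> F' 0 z * w z"
      proof (intro AE_I2)
        fix z
        have "(\<lambda>i. (F (X i) z - F 0 z) / X i) \<longlonglongrightarrow> F' 0 z"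
          using deriv[of 0 z] \<open>\<delta> > 0\<close> X
          unfolding DERIV_def tendsto_at_iff_sequentially comp_def by auto
        then have "(\<lambda>i. (F (X i) z - F 0 z) / X i * w z) \<longlonglongrightarrow> F' 0 z * w z"
          by (intro tendsto_intros)
        then show "(\<lambda>i. G i z) \<longlonglongrightarrow> F' 0 z * w z"
          by (rule Lim_transform_eventually) (use ev in eventually_elim, auto simp: G_def)
      qed
      have C: "0 \<le> C" if "z \<in> space M" for z
        using F_bd[of 0 z] \<open>\<delta> > 0\<close> by auto
      show "AE z in M. norm (G i z) \<le> C * \<bar>w z\<bar>" for i
        using lip[of "X i"] X(1) C
        by (intro AE_I2) (simp only: G_def abs_mult real_norm_def split: if_split, auto intro!: mult_right_mono simp del: abs_divide)
    qed (auto simp: G_def)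
    moreover have "\<forall>\<^sub>F i in sequentially. (LINT z|M. G i z)
        = ((LINT z|M. F (0 + X i) z * w z) - (LINT z|M. F 0 z * w z)) / X i"
      using ev
    proof eventually_elim
      case (elim i)
      have "(LINT z|M. G i z) = (LINT z|M. (F (X i) z * w z - F 0 z * w z) / X i)"
        using elim by (intro Bochner_Integration.integral_cong) (auto simp: G_def field_simps)
      also have "\<dots> = ((LINT z|M. F (0 + X i) z * w z) - (LINT z|M. F 0 z * w z)) / X i"
        using int[OF elim] int[of 0] \<open>\<delta> > 0\<close> by simp
      finally show ?case .
    qed
    ultimately show "(\<lambda>i. ((LINT z|M. F (0 + X i) z * w z) - (LINT z|M. F 0 z * w z)) / X i)
        \<longlonglongrightarrow> (LINT z|M. F' 0 z * w z)"
      by (rule Lim_transform_eventually)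
  qed
qed

section \<open>The pressure kernel\<close>

lemma norm_e [simp]: "norm (e_n :: 'm::finite space) = 1" "norm (e_tan k :: 'm::finite space) = 1"
  by (simp_all add: e_n_def e_tan_def)

lemma e_in_Basis: "(e_n :: 'm::finite space) \<in> Basis" "(e_tan k :: 'm::finite space) \<in> Basis"
  by (auto simp: e_n_def e_tan_def Basis_prod_def axis_in_Basis_iff)

lemma e_tan_neq_e_n: "e_tan k \<noteq> (e_n :: 'm::finite space)"
  by (auto simp: e_n_def e_tan_def)

lemma inner_e:
  fixes x :: "'m::finite space"
  shows "x \<bullet> e_n = snd x" "x \<bullet> e_tan k = fst x $ k"
  by (cases x; simp add: e_n_def e_tan_def cart_eq_inner_axis)+

lemma fst_snd_e [simp]:
  "fst (e_n :: 'm::finite space) = 0" "snd (e_n :: 'm::finite space) = 1"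
  "fst (e_tan k) = axis k 1" "snd (e_tan k) = 0"
  by (simp_all add: e_n_def e_tan_def)

text \<open>The potential at \<open>x\<close> of a density \<open>w\<close> spread over the boundary hyperplane.\<close>

definition layer_potential :: "('m::finite space \<Rightarrow> real) \<Rightarrow> (real^'m \<Rightarrow> real) \<Rightarrow> 'm space \<Rightarrow> real" where
  "layer_potential Q w x = (LINT z|lborel. Q (x - (z, 0)) * w z)"

definition heat_avg :: "('m::finite space \<Rightarrow> real) \<Rightarrow> 'm space \<Rightarrow> real^'m \<Rightarrow> real \<Rightarrow> real" where
  "heat_avg Q x y t = layer_potential Q (\<lambda>z. heat_kernel (z - y) t) x"

text \<open>The regularity of the kernels that makes their layer potentials well-behaved at every point
  off the boundary.\<close>

definition tame_kernel :: "('m::finite space \<Rightarrow> real) \<Rightarrow> bool" where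
  "tame_kernel Q \<longleftrightarrow> Q \<in> borel_measurable borel \<and> (\<forall>r>0. \<exists>C. \<forall>p. r \<le> norm p \<longrightarrow> \<bar>Q p\<bar> \<le> C)"

lemma tame_kernel_measurable: "tame_kernel Q \<Longrightarrow> Q \<in> borel_measurable borel"
  by (simp add: tame_kernel_def)

lemma tame_kernel_bound:
  assumes "tame_kernel Q" "r > 0"
  obtains C where "0 \<le> C" "\<And>p. r \<le> norm p \<Longrightarrow> \<bar>Q p\<bar> \<le> C"
proof -
  obtain C where C: "\<And>p. r \<le> norm p \<Longrightarrow> \<bar>Q p\<bar> \<le> C" using assms unfolding tame_kernel_def by blast
  show ?thesis by (rule that[of "\<bar>C\<bar>"]) (use C in force)+
qed

lemma tame_newton:
  assumes "CARD('m) \<ge> 2" "norm e = 1" "norm e' = 1"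
  shows "tame_kernel (newton_kernel :: 'm::finite space \<Rightarrow> real)"
    and "tame_kernel (newton_grad e :: 'm space \<Rightarrow> real)"
    and "tame_kernel (newton_mixed e e' :: 'm space \<Rightarrow> real)"
  unfolding tame_kernel_def using newton_bounded_above[OF assms(1) _ assms(2,3)] by (auto, meson+)

text \<open>A layer potential may be differentiated under the integral, since a displacement by less than
  half the height keeps the kernel away from its singularity.\<close>

lemma DERIV_layer_potential:
  fixes Q Q' :: "'m::finite space \<Rightarrow> real"
  assumes "tame_kernel Q" "tame_kernel Q'"
    and deriv: "\<And>p s. p + s *\<^sub>R e \<noteq> 0 \<Longrightarrow> ((\<lambda>s. Q (p + s *\<^sub>R e)) has_real_derivative Q' (p + s *\<^sub>R e)) (at s)"
    and "norm e = 1" "snd x > 0" "integrable lborel w"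
  shows "((\<lambda>s. layer_potential Q w (x + s *\<^sub>R e)) has_real_derivative layer_potential Q' w x) (at 0)"
proof -
  note [measurable] = assms(1,2)[THEN tame_kernel_measurable]
  define r where "r = snd x / 2"
  have r: "r > 0" using assms by (simp add: r_def)
  obtain C1 C2 where C: "0 \<le> C1" "\<And>p. r \<le> norm p \<Longrightarrow> \<bar>Q p\<bar> \<le> C1" "0 \<le> C2" "\<And>p. r \<le> norm p \<Longrightarrow> \<bar>Q' p\<bar> \<le> C2"
    using tame_kernel_bound[OF _ r] assms(1,2) by metis
  have far: "r \<le> norm (x + s *\<^sub>R e - (z, 0))" if "\<bar>s\<bar> < r" for s z
  proof -
    have "\<bar>s * snd e\<bar> \<le> \<bar>s\<bar> * 1"
      unfolding abs_mult using norm_snd_le[of "snd e" "fst e"] assms by (intro mult_left_mono) auto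
    then have "r \<le> \<bar>snd (x + s *\<^sub>R e)\<bar>" using that r by (simp add: r_def)
    also have "\<dots> \<le> norm (x + s *\<^sub>R e - (z, 0))" by (rule snd_le_norm_diff)
    finally show ?thesis .
  qed
  have "((\<lambda>s. LINT z|lborel. Q (x + s *\<^sub>R e - (z, 0)) * w z) has_real_derivative
        (LINT z|lborel. Q' (x + 0 *\<^sub>R e - (z, 0)) * w z)) (at 0)"
  proof (rule DERIV_weighted_integral[where \<delta>=r and C="C1 + C2" and F'="\<lambda>s z. Q' (x + s *\<^sub>R e - (z, 0))"])
    show "((\<lambda>s. Q (x + s *\<^sub>R e - (z, 0))) has_real_derivative Q' (x + s *\<^sub>R e - (z, 0))) (at s)"
      if "\<bar>s\<bar> < r" for s z
    proof -
      have eq: "x + s *\<^sub>R e - (z, 0) = (x - (z, 0)) + s *\<^sub>R e" for s by simp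
      have "x + s *\<^sub>R e - (z, 0) \<noteq> 0" using far[OF that, of z] r by (metis norm_zero not_le)
      then show ?thesis unfolding eq by (rule deriv)
    qed
    show "\<bar>Q (x + s *\<^sub>R e - (z, 0))\<bar> \<le> C1 + C2" if "\<bar>s\<bar> < r" for s z
      using C(2)[OF far[OF that, of z]] C(3) by linarith
    show "\<bar>Q' (x + s *\<^sub>R e - (z, 0))\<bar> \<le> C1 + C2" if "\<bar>s\<bar> < r" for s z
      using C(4)[OF far[OF that, of z]] C(1) by linarith
  qed (use r assms in auto)
  then show ?thesis unfolding layer_potential_def by simp
qed

lemma boundary_potential_eq:
  "t > 0 \<Longrightarrow> boundary_potential x y t = heat_kernel (snd y) t * heat_avg newton_kernel x (fst y) t"
  unfolding boundary_potential_def heat_avg_def layer_potential_def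
  by (subst integral_mult_right_zero[symmetric]) (simp add: heat_kernel_boundary mult_ac)

text \<open>In the potential the variable \<open>x\<close> occurs only in the Newton kernel, and \<open>y_n\<close> only in the normal heat
  kernel. Hence \<open>D_{x_n}\<close> and \<open>D_{y_n}\<close> act on different factors and produce the two terms.\<close>

lemma pressure_kernel_comp_e_tan:
  fixes x y :: "'m::finite space"
  assumes "CARD('m) \<ge> 2" "snd x > 0" "t > 0"
  shows "pressure_kernel_comp (e_tan k) x y t =
    4 * (heat_kernel (snd y) t * heat_avg (newton_mixed e_n (e_tan k)) x (fst y) t
       - (snd y / (2 * t)) * heat_kernel (snd y) t * heat_avg (newton_grad (e_tan k)) x (fst y) t)"
proof -
  have dim: "DIM('m space) \<ge> 3" using assms(1) by simp
  have N: "((\<lambda>s. heat_avg newton_kernel (x + s *\<^sub>R e) (fst y) t) has_real_derivative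
             heat_avg (newton_grad e) x (fst y) t) (at 0)"
    if "snd x > 0" "norm e = 1" for x e :: "'m space"
    unfolding heat_avg_def using that assms
    by (intro DERIV_layer_potential DERIV_newton_kernel dim tame_newton[of e e] heat_kernel_shift_integrable) auto
  have G: "((\<lambda>s. heat_avg (newton_grad e_n) (x + s *\<^sub>R e_tan k) (fst y) t) has_real_derivative
             heat_avg (newton_mixed e_n (e_tan k)) x (fst y) t) (at 0)"
    unfolding heat_avg_def using assms
    by (intro DERIV_layer_potential DERIV_newton_grad tame_newton(2)[where e'=e_n] tame_newton(3) heat_kernel_shift_integrable)
       (auto simp: inner_e)
  have px: "partial e_n (\<lambda>x. boundary_potential x y t) x
      = heat_kernel (snd y) t * heat_avg (newton_grad e_n) x (fst y) t" if "snd x > 0" for x :: "'m space"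
    unfolding partial_def boundary_potential_eq[OF assms(3)]
    by (intro DERIV_imp_deriv DERIV_cmult N that) simp
  have py: "partial e_n (\<lambda>y. boundary_potential x y t) y
      = - (snd y / (2 * t)) * heat_kernel (snd y) t * heat_avg newton_kernel x (fst y) t" for x :: "'m space"
    unfolding partial_def boundary_potential_eq[OF assms(3)]
    by (intro DERIV_imp_deriv) (use DERIV_cmult_right[OF DERIV_heat_kernel_real[OF assms(3)]] in simp)
  have "partial (e_tan k) (\<lambda>x. partial e_n (\<lambda>x. boundary_potential x y t) x
                  + partial e_n (\<lambda>y. boundary_potential x y t) y) x
      = deriv (\<lambda>s. heat_kernel (snd y) t * heat_avg (newton_grad e_n) (x + s *\<^sub>R e_tan k) (fst y) t
           + - (snd y / (2 * t)) * heat_kernel (snd y) t * heat_avg newton_kernel (x + s *\<^sub>R e_tan k) (fst y) t) 0"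
    unfolding partial_def[of "e_tan k"] py using assms(2) by (simp add: px)
  also have "\<dots> = heat_kernel (snd y) t * heat_avg (newton_mixed e_n (e_tan k)) x (fst y) t
       + - (snd y / (2 * t)) * heat_kernel (snd y) t * heat_avg (newton_grad (e_tan k)) x (fst y) t"
    using assms by (intro DERIV_imp_deriv DERIV_add DERIV_cmult G N) auto
  finally show ?thesis
    by (simp add: pressure_kernel_comp_def e_tan_neq_e_n)
qed

lemma pressure_kernel_inner:
  fixes x y :: "'m::finite space"
  assumes "e \<in> Basis"
  shows "pressure_kernel x y t \<bullet> e = pressure_kernel_comp e x y t"
  unfolding pressure_kernel_def using assms by (simp add: inner_sum_left inner_Basis if_distrib cong: if_cong)

lemma pressure_kernel_comp_e_n: "pressure_kernel_comp e_n x y t = 0"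
  by (simp add: pressure_kernel_comp_def)

section \<open>The spatial profiles of the force\<close>

definition grad_comp :: "'m \<Rightarrow> (real^'m \<Rightarrow> real) \<Rightarrow> real^'m::finite \<Rightarrow> real" where
  "grad_comp k u z = frechet_derivative u (at z) (axis k 1)"

lemma smooth_on_differentiable:
  assumes "smooth_on S F" "x \<in> S"
  shows "F differentiable (at x)"
proof -
  have "Ck_on (Suc 0) S F" using assms(1) unfolding smooth_on_def by blast
  then show ?thesis using assms(2) by simp
qed

lemma smooth_on_continuous_derivative:
  assumes "smooth_on S F"
  shows "continuous_on S (\<lambda>x. frechet_derivative F (at x) v)"
proof -
  have "Ck_on (Suc 0) S F" using assms unfolding smooth_on_def by blast
  then show ?thesis by simp
qed

lemma smooth_on_continuous:
  assumes "smooth_on S F"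
  shows "continuous_on S F"
proof -
  have "Ck_on 0 S F" using assms unfolding smooth_on_def by blast
  then show ?thesis by simp
qed

lemma DERIV_along:
  fixes u :: "'a::euclidean_space \<Rightarrow> real"
  assumes "u differentiable (at (z + s *\<^sub>R v))"
  shows "((\<lambda>s. u (z + s *\<^sub>R v)) has_real_derivative frechet_derivative u (at (z + s *\<^sub>R v)) v) (at s)"
proof -
  let ?D = "frechet_derivative u (at (z + s *\<^sub>R v))"
  have u: "(u has_derivative ?D) (at (z + s *\<^sub>R v))" using assms by (simp add: frechet_derivative_works)
  have "((\<lambda>s. z + s *\<^sub>R v) has_derivative (\<lambda>h. h *\<^sub>R v)) (at s)" by (auto intro!: derivative_eq_intros)
  from has_derivative_compose[OF this u]
  have "((\<lambda>s. u (z + s *\<^sub>R v)) has_derivative (\<lambda>h. ?D (h *\<^sub>R v))) (at s)" by simp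
  moreover have "?D (h *\<^sub>R v) = h *\<^sub>R ?D v" for h
    using u by (intro linear_scale) (simp add: has_derivative_linear)
  ultimately show ?thesis by (simp add: has_field_derivative_def mult.commute[of _ "?D v"])
qed

lemma DERIV_tangential:
  assumes "tangential_profile gT"
  shows "((\<lambda>s. gT (z + s *\<^sub>R axis k 1)) has_real_derivative grad_comp k gT (z + s *\<^sub>R axis k 1)) (at s)"
  using assms unfolding grad_comp_def tangential_profile_def
  by (intro DERIV_along smooth_on_differentiable) auto

lemma integrable_indicator_ball: "integrable lborel (\<lambda>z::'a::euclidean_space. indicator (ball c r) z :: real)"
  using emeasure_lborel_ball_finite by (intro integrable_real_indicator) (auto simp: less_top[symmetric])

lemma bounded_of_continuous_support_in_ball:
  fixes u :: "'a::euclidean_space \<Rightarrow> real"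
  assumes "continuous_on UNIV u" "\<And>z. 1 \<le> norm z \<Longrightarrow> u z = 0"
  obtains M where "0 \<le> M" "\<And>z. \<bar>u z\<bar> \<le> M * indicator (ball 0 1) z" "integrable lborel u"
proof -
  have "compact (u ` cball 0 1)" using assms(1) by (intro compact_continuous_image) (auto intro: continuous_on_subset)
  then obtain M where M: "\<And>z. norm z \<le> 1 \<Longrightarrow> \<bar>u z\<bar> \<le> M"
    by (metis bounded_iff compact_imp_bounded imageI mem_cball_0 real_norm_def)
  have M0: "0 \<le> M" using M[of 0] by simp
  have b: "\<bar>u z\<bar> \<le> M * indicator (ball 0 1) z" for z
    using M[of z] assms(2)[of z] by (cases "norm z < 1") auto
  have [measurable]: "u \<in> borel_measurable borel" using assms(1) by (rule borel_measurable_continuous_onI)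
  have "integrable lborel u"
  proof (rule Bochner_Integration.integrable_bound[where f="\<lambda>z. M * indicator (ball 0 1) z"])
    show "integrable lborel (\<lambda>z::'a. M * indicator (ball 0 1) z)"
      by (intro integrable_mult_right integrable_indicator_ball)
    show "AE z in lborel. norm (u z) \<le> norm (M * indicator (ball 0 1) z)"
      using b M0 by (intro AE_I2) (auto simp: abs_mult)
  qed auto
  then show ?thesis using M0 b that by blast
qed

lemma zero_outside_support:
  fixes u :: "'a::euclidean_space \<Rightarrow> real"
  assumes "closure {z. u z \<noteq> 0} \<subseteq> ball 0 1" "1 \<le> norm z"
  shows "u z = 0" "frechet_derivative u (at z) v = 0"
proof -
  have z: "z \<in> - closure {z. u z \<noteq> 0}" using assms by auto
  then show "u z = 0" using closure_subset[of "{z. u z \<noteq> 0}"] by auto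
  have "(u has_derivative (\<lambda>h. 0)) (at z)"
  proof (rule has_derivative_transform_within_open[OF has_derivative_const[of 0] _ z])
    fix y assume "y \<in> - closure {z. u z \<noteq> 0}"
    then show "0 = u y" using closure_subset[of "{z. u z \<noteq> 0}"] by auto
  qed auto
  then show "frechet_derivative u (at z) v = 0" by (metis frechet_derivative_at)
qed

lemma tangential_profile_bounds:
  assumes "tangential_profile gT"
  obtains M where "0 \<le> M" "\<And>z. \<bar>gT z\<bar> \<le> M * indicator (ball 0 1) z" "\<And>z. \<bar>grad_comp k gT z\<bar> \<le> M * indicator (ball 0 1) z"
    "continuous_on UNIV gT" "continuous_on UNIV (grad_comp k gT)" "integrable lborel gT" "integrable lborel (grad_comp k gT)"
proof -
  have sm: "smooth_on UNIV gT" and supp: "closure {z. gT z \<noteq> 0} \<subseteq> ball 0 1"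
    using assms by (auto simp: tangential_profile_def)
  have c1: "continuous_on UNIV gT"
    by (rule smooth_on_continuous[OF sm])
  have c2: "continuous_on UNIV (grad_comp k gT)"
    unfolding grad_comp_def by (rule smooth_on_continuous_derivative[OF sm])
  obtain M1 where M1: "0 \<le> M1" "\<And>z. \<bar>gT z\<bar> \<le> M1 * indicator (ball 0 1) z" "integrable lborel gT"
    using bounded_of_continuous_support_in_ball[OF c1 zero_outside_support(1)[OF supp]] by blast
  obtain M2 where M2: "0 \<le> M2" "\<And>z. \<bar>grad_comp k gT z\<bar> \<le> M2 * indicator (ball 0 1) z" "integrable lborel (grad_comp k gT)"
    by (rule bounded_of_continuous_support_in_ball[OF c2])
       (use zero_outside_support(2)[OF supp] in \<open>auto simp: grad_comp_def\<close>)
  show ?thesis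
  proof (rule that[of "M1 + M2"])
    show "\<bar>gT z\<bar> \<le> (M1 + M2) * indicator (ball 0 1) z" for z
      using M1(1) M1(2)[of z] M2(1) by (auto split: split_indicator)
    show "\<bar>grad_comp k gT z\<bar> \<le> (M1 + M2) * indicator (ball 0 1) z" for z
      using M1(1) M2(1) M2(2)[of z] by (auto split: split_indicator)
  qed (use M1 M2 c1 c2 in auto)
qed

text \<open>Extended by zero, the derivative turns integrals over the half space into integrals over the
  whole space.\<close>

definition normal_deriv :: "(real \<Rightarrow> real) \<Rightarrow> real \<Rightarrow> real" where
  "normal_deriv gN y = indicator {0<..} y * deriv gN y"

lemma deriv_eq_frechet:
  fixes g :: "real \<Rightarrow> real"
  assumes "g differentiable (at y)"
  shows "(g has_real_derivative deriv g y) (at y)" "deriv g y = frechet_derivative g (at y) 1"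
proof -
  have "(g has_real_derivative frechet_derivative g (at y) 1) (at y)"
    using DERIV_along[of g y 0 1] assms DERIV_shift[of g _ 0 y] by (simp add: add.commute)
  then show "deriv g y = frechet_derivative g (at y) 1" "(g has_real_derivative deriv g y) (at y)"
    using DERIV_imp_deriv by metis+
qed

text \<open>Near \<open>0\<close> the profile is an explicit power, on \<open>{1..2}\<close> its derivative is bounded by compactness, and
  beyond it vanishes. A single multiple of \<open>y powr (- \<beta>)\<close> on \<open>{0<..<2}\<close> dominates all three ranges.\<close>

lemma normal_profile_facts:
  assumes "normal_profile \<beta> gN" "0 < \<beta>" "\<beta> < 1"
  obtains M where "0 \<le> M" "normal_deriv gN \<in> borel_measurable borel"
    "\<And>y. \<bar>normal_deriv gN y\<bar> \<le> M * (indicator {0<..<2} y * y powr (- \<beta>))"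
    "\<And>y. 0 < y \<Longrightarrow> \<bar>gN y\<bar> \<le> M * (indicator {0<..<2} y * y powr (- \<beta>))"
    "\<And>y. 0 < y \<Longrightarrow> y < 1 \<Longrightarrow> normal_deriv gN y = (1 - \<beta>) * y powr (- \<beta>)"
    "\<And>y. 0 < y \<Longrightarrow> (gN has_real_derivative normal_deriv gN y) (at y)"
proof -
  have sm: "smooth_on {0<..} gN"
    and supp: "closure {r. r > 0 \<and> gN r \<noteq> 0} \<inter> {0<..} \<subseteq> {0<..<2}"
    and near: "\<And>r. 0 < r \<Longrightarrow> r \<le> 1 \<Longrightarrow> gN r = r powr (1 - \<beta>)"
    using assms by (auto simp: normal_profile_def)
  have diff: "gN differentiable (at y)" if "0 < y" for y
    using smooth_on_differentiable[OF sm] that by auto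
  have dN: "normal_deriv gN y = deriv gN y" if "0 < y" for y using that by (simp add: normal_deriv_def)
  have D: "(gN has_real_derivative normal_deriv gN y) (at y)" if "0 < y" for y
    unfolding dN[OF that] by (rule deriv_eq_frechet(1)[OF diff[OF that]])
  have cont: "continuous_on {0<..} (deriv gN)"
    using smooth_on_continuous_derivative[OF sm, of 1]
    by (rule continuous_on_eq) (simp add: deriv_eq_frechet(2)[OF diff])
  have contN: "continuous_on {0<..} gN" by (rule smooth_on_continuous[OF sm])
  have meas: "normal_deriv gN \<in> borel_measurable borel"
  proof -
    have "(\<lambda>y. indicator {0<..} y *\<^sub>R deriv gN y) \<in> borel_measurable borel"
      using cont by (intro borel_measurable_continuous_on_indicator) auto
    then show ?thesis by (simp add: normal_deriv_def[abs_def])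
  qed
  have out: "gN y = 0" "normal_deriv gN y = 0" if "2 \<le> y" for y
  proof -
    define U where "U = {0<..} - closure {r. r > 0 \<and> gN r \<noteq> 0}"
    have y: "y \<in> U" using that supp by (auto simp: U_def)
    have U: "gN r = 0" if "r \<in> U" for r using that closure_subset[of "{r. r > 0 \<and> gN r \<noteq> 0}"] by (auto simp: U_def)
    show "gN y = 0" using U y by blast
    have "open U" unfolding U_def by (intro open_Diff) auto
    have "(gN has_real_derivative 0) (at y)"
      by (rule has_field_derivative_transform_within_open[OF DERIV_const[of 0] \<open>open U\<close> y]) (use U in auto)
    then show "normal_deriv gN y = 0" using D[of y] that DERIV_unique by fastforce
  qed
  have inner: "normal_deriv gN y = (1 - \<beta>) * y powr (- \<beta>)" if "0 < y" "y < 1" for y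
  proof -
    have "((\<lambda>y. y powr (1 - \<beta>)) has_real_derivative (1 - \<beta>) * y powr (1 - \<beta> - 1)) (at y)"
      using that(1) by (rule has_real_derivative_powr)
    then have "(gN has_real_derivative (1 - \<beta>) * y powr (1 - \<beta> - 1)) (at y)"
      by (rule has_field_derivative_transform_within_open[where S="{0<..<1}"]) (use that near in auto)
    then show ?thesis using D[OF that(1)] DERIV_unique by fastforce
  qed
  have bdd: "\<exists>M. \<forall>y\<in>{1..2}. \<bar>u y\<bar> \<le> M" if "continuous_on {0<..} u" for u :: "real \<Rightarrow> real"
  proof -
    have "compact (u ` {1..2})" using that by (intro compact_continuous_image) (auto intro: continuous_on_subset)
    then show ?thesis using compact_imp_bounded bounded_iff by (metis image_eqI real_norm_def)
  qed
  obtain M1 where M1: "\<And>y. y \<in> {1..2} \<Longrightarrow> \<bar>deriv gN y\<bar> \<le> M1" using bdd[OF cont] by blast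
  obtain M2 where M2: "\<And>y. y \<in> {1..2} \<Longrightarrow> \<bar>gN y\<bar> \<le> M2" using bdd[OF contN] by blast
  define K where "K = max M1 M2"
  have K: "0 \<le> K" "\<And>y. y \<in> {1..2} \<Longrightarrow> \<bar>normal_deriv gN y\<bar> \<le> K" "\<And>y. y \<in> {1..2} \<Longrightarrow> \<bar>gN y\<bar> \<le> K"
    using M1[of 1] M1 M2 by (force simp: K_def dN le_max_iff_disj)+
  \<comment> \<open>The factor \<open>2 powr \<beta>\<close> compensates that \<open>y powr (- \<beta>)\<close> drops to \<open>2 powr (- \<beta>)\<close> at the end of the support.\<close>
  define M where "M = 1 + K * 2 powr \<beta>"
  have M: "1 \<le> M" using K by (simp add: M_def)
  have far: "K \<le> M * y powr (- \<beta>)" if "y \<in> {1..2}" for y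
  proof -
    have "1 = 2 powr \<beta> * 2 powr (- \<beta>)" by (simp add: powr_minus)
    also have "\<dots> \<le> 2 powr \<beta> * y powr (- \<beta>)" using that assms by (intro mult_left_mono powr_mono2') auto
    finally have "K \<le> K * (2 powr \<beta> * y powr (- \<beta>))" using K(1) by (metis mult.right_neutral mult_left_mono)
    also have "\<dots> \<le> M * y powr (- \<beta>)" by (simp add: M_def algebra_simps)
    finally show ?thesis .
  qed
  show ?thesis
  proof (rule that[of M])
    show "0 \<le> M" using M by simp
    show "\<bar>normal_deriv gN y\<bar> \<le> M * (indicator {0<..<2} y * y powr (- \<beta>))" for y
    proof -
      consider "y \<le> 0" | "0 < y" "y < 1" | "1 \<le> y" "y < 2" | "2 \<le> y" by linarith
      then show ?thesis
      proof cases
        case 2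
        have "(1 - \<beta>) * y powr (- \<beta>) \<le> M * y powr (- \<beta>)" using M assms by (intro mult_right_mono) auto
        then show ?thesis using 2 assms inner[OF 2] by (simp add: abs_mult)
      next
        case 3
        then show ?thesis using K(2)[of y] far[of y] by auto
      qed (use out in \<open>auto simp: normal_deriv_def\<close>)
    qed
    show "\<bar>gN y\<bar> \<le> M * (indicator {0<..<2} y * y powr (- \<beta>))" if "0 < y" for y
    proof -
      consider "y < 1" | "1 \<le> y" "y < 2" | "2 \<le> y" by linarith
      then show ?thesis
      proof cases
        case 1
        have "y powr (1 - \<beta>) \<le> 1 * y powr (- \<beta>)"
          using 1 that assms powr_mono'[of "- \<beta>" "1 - \<beta>" y] by auto
        also have "\<dots> \<le> M * y powr (- \<beta>)" using M by (intro mult_right_mono) auto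
        finally show ?thesis using 1 that near[of y] by simp
      next
        case 2
        then show ?thesis using K(3)[of y] far[of y] by auto
      qed (use out in auto)
    qed
  qed (use meas inner D in auto)
qed

lemma partial_n_space_profile:
  assumes "(gN has_real_derivative normal_deriv gN (snd y)) (at (snd y))"
  shows "partial e_n (space_profile gT gN) y = gT (fst y) * normal_deriv gN (snd y)"
proof -
  have "((\<lambda>s. gT (fst y) * gN (snd y + s)) has_real_derivative gT (fst y) * normal_deriv gN (snd y)) (at 0)"
    using assms DERIV_shift[of gN "normal_deriv gN (snd y)" 0 "snd y"] by (intro DERIV_cmult) (simp add: add.commute)
  then show ?thesis unfolding partial_def space_profile_def by (intro DERIV_imp_deriv) simp
qed

lemma partial_tan_space_profile:
  assumes "tangential_profile gT"
  shows "partial (e_tan k) (space_profile gT gN) y = grad_comp k gT (fst y) * gN (snd y)"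
proof -
  have "((\<lambda>s. gT (fst y + s *\<^sub>R axis k 1) * gN (snd y)) has_real_derivative grad_comp k gT (fst y) * gN (snd y)) (at 0)"
    using DERIV_tangential[OF assms, of "fst y" k 0] by (intro DERIV_cmult_right) simp
  then show ?thesis unfolding partial_def space_profile_def by (intro DERIV_imp_deriv) simp
qed

text \<open>Integration by parts along the boundary. It trades the derivative of the kernel for one of the
  density, and so lowers the singularity of the kernel by one order.\<close>

lemma layer_potential_grad_comp:
  fixes Q Q' :: "'m::finite space \<Rightarrow> real"
  assumes gT: "tangential_profile gT" and Q: "tame_kernel Q" "tame_kernel Q'"
    and deriv: "\<And>p s. p + s *\<^sub>R e_tan k \<noteq> 0 \<Longrightarrow>
      ((\<lambda>s. Q (p + s *\<^sub>R e_tan k)) has_real_derivative Q' (p + s *\<^sub>R e_tan k)) (at s)"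
    and x: "snd x > 0"
  shows "layer_potential Q' gT x = layer_potential Q (grad_comp k gT) x"
proof -
  note [measurable] = Q[THEN tame_kernel_measurable]
  obtain M where M: "0 \<le> M" "\<And>z. \<bar>gT z\<bar> \<le> M * indicator (ball 0 1) z"
      "\<And>z. \<bar>grad_comp k gT z\<bar> \<le> M * indicator (ball 0 1) z"
      and c: "continuous_on UNIV gT" "continuous_on UNIV (grad_comp k gT)"
      and i: "integrable lborel gT" "integrable lborel (grad_comp k gT)"
    by (rule tangential_profile_bounds[OF gT, of k]) blast
  have [measurable]: "gT \<in> borel_measurable borel" "grad_comp k gT \<in> borel_measurable borel"
    using c by (auto intro: borel_measurable_continuous_onI)
  obtain C where C: "0 \<le> C" "\<And>p. snd x \<le> norm p \<Longrightarrow> \<bar>Q p\<bar> \<le> C" using tame_kernel_bound[OF Q(1) x] by metis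
  let ?e = "axis k 1 :: real^'m"
  \<comment> \<open>The shifted density lives in the ball of radius 2, so the kernel may be cut off there; this makes it an integrable weight.\<close>
  define w where "w z = Q (x - (z, 0)) * indicator (ball 0 2) z" for z
  have [measurable]: "w \<in> borel_measurable borel" unfolding w_def[abs_def]
    by (intro borel_measurable_times borel_measurable_indicator) simp_all
  have Qx: "\<bar>Q (x - (z, 0))\<bar> \<le> C" for z using C(2) snd_le_norm_diff[of x z] x by auto
  have w: "integrable lborel w"
  proof (rule Bochner_Integration.integrable_bound[where f="\<lambda>z. C * indicator (ball 0 2) z"])
    show "integrable lborel (\<lambda>z::real^'m. C * indicator (ball 0 2) z)"
      by (intro integrable_mult_right integrable_indicator_ball)
    show "AE z in lborel. norm (w z) \<le> norm (C * indicator (ball 0 2) z)"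
      using Qx C by (intro AE_I2) (auto simp: w_def abs_mult split: split_indicator)
  qed simp
  \<comment> \<open>The potential is differentiated along the boundary in two ways: through the kernel, and, after a translation, through the density.\<close>
  have 1: "((\<lambda>s. layer_potential Q gT (x + s *\<^sub>R e_tan k)) has_real_derivative layer_potential Q' gT x) (at 0)"
    using i by (intro DERIV_layer_potential Q deriv x) auto
  have ind: "indicator (ball 0 1) z \<le> (1::real)" for z :: "real^'m" by (simp split: split_indicator)
  have 2: "((\<lambda>s. LINT z|lborel. gT (z + s *\<^sub>R ?e) * w z) has_real_derivative
      (LINT z|lborel. grad_comp k gT (z + 0 *\<^sub>R ?e) * w z)) (at 0)"
  proof (rule DERIV_weighted_integral[where \<delta>=1 and C=M and F'="\<lambda>s z. grad_comp k gT (z + s *\<^sub>R ?e)"])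
    show "\<bar>gT (z + s *\<^sub>R ?e)\<bar> \<le> M" "\<bar>grad_comp k gT (z + s *\<^sub>R ?e)\<bar> \<le> M" for s z
      using M(2,3)[of "z + s *\<^sub>R ?e"] mult_left_mono[OF ind M(1), of "z + s *\<^sub>R ?e"] by auto
  qed (use w in \<open>auto intro: DERIV_tangential[OF gT]\<close>)
  have eq: "layer_potential Q gT (x + s *\<^sub>R e_tan k) = (LINT z|lborel. gT (z + s *\<^sub>R ?e) * w z)" if "s \<in> ball 0 1" for s
  proof -
    have "layer_potential Q gT (x + s *\<^sub>R e_tan k)
        = (LINT z|lborel. Q (x + s *\<^sub>R e_tan k - (s *\<^sub>R ?e + z, 0)) * gT (s *\<^sub>R ?e + z))"
      unfolding layer_potential_def
      by (rule lborel_integral_shift[symmetric]) simp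
    also have "\<dots> = (LINT z|lborel. gT (z + s *\<^sub>R ?e) * w z)"
    proof (rule Bochner_Integration.integral_cong)
      fix z :: "real^'m"
      have e1: "x + s *\<^sub>R e_tan k - (s *\<^sub>R ?e + z, 0) = x - (z, 0)"
        by (intro prod_eqI) (simp_all add: e_tan_def)
      have e2: "gT (s *\<^sub>R ?e + z) = 0" if "z \<notin> ball 0 2"
      proof -
        have "norm z \<le> norm (s *\<^sub>R ?e + z) + norm (s *\<^sub>R ?e)"
          by (metis add_diff_cancel_left' norm_triangle_ineq4 add.commute)
        then have "s *\<^sub>R ?e + z \<notin> ball 0 1" using that \<open>s \<in> ball 0 1\<close> by simp
        then show ?thesis using M(2)[of "s *\<^sub>R ?e + z"] by simp
      qed
      show "Q (x + s *\<^sub>R e_tan k - (s *\<^sub>R ?e + z, 0)) * gT (s *\<^sub>R ?e + z) = gT (z + s *\<^sub>R ?e) * w z"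
        unfolding e1 using e2 by (cases "z \<in> ball 0 2") (simp_all add: w_def add.commute)
    qed simp
    finally show ?thesis .
  qed
  have "((\<lambda>s. layer_potential Q gT (x + s *\<^sub>R e_tan k)) has_real_derivative
      (LINT z|lborel. grad_comp k gT (z + 0 *\<^sub>R ?e) * w z)) (at 0)"
    by (rule has_field_derivative_transform_within_open[OF 2, of "ball 0 1"]) (use eq in auto)
  from DERIV_unique[OF 1 this] have "layer_potential Q' gT x = (LINT z|lborel. grad_comp k gT z * w z)" by simp
  also have "\<dots> = layer_potential Q (grad_comp k gT) x"
    unfolding layer_potential_def
  proof (rule Bochner_Integration.integral_cong)
    fix z show "grad_comp k gT z * w z = Q (x - (z, 0)) * grad_comp k gT z"
      using M(3)[of z] by (cases "z \<in> ball 0 2") (auto simp: w_def)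
  qed simp
  finally show ?thesis .
qed

section \<open>Separation of variables in the pressure\<close>

lemma fst_snd_borel [measurable (raw)]:
  fixes f :: "'b \<Rightarrow> 'a::euclidean_space \<times> 'c::euclidean_space"
  assumes "f \<in> borel_measurable M"
  shows "(\<lambda>x. fst (f x)) \<in> borel_measurable M" "(\<lambda>x. snd (f x)) \<in> borel_measurable M"
  by (rule measurable_compose[OF assms]; intro borel_measurable_continuous_onI continuous_intros)+

lemma has_bochner_integral_lborel_prod:
  fixes F :: "'a::euclidean_space \<Rightarrow> real" and G :: "'b::euclidean_space \<Rightarrow> real"
  assumes F: "integrable lborel F" and G: "integrable lborel G"
  shows "has_bochner_integral lborel (\<lambda>y. F (fst y) * G (snd y)) ((LINT z|lborel. F z) * (LINT z|lborel. G z))"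
proof -
  have [measurable]: "F \<in> borel_measurable borel" "G \<in> borel_measurable borel" using F G by auto
  let ?f = "\<lambda>y. F (fst y) * G (snd y)"
  have int: "integrable (lborel \<Otimes>\<^sub>M lborel) ?f"
  proof (rule lborel_pair.Fubini_integrable)
    show "integrable lborel (\<lambda>x. LINT y|lborel. norm (?f (x, y)))"
      using F by (simp add: abs_mult)
    show "AE x in lborel. integrable lborel (\<lambda>y. ?f (x, y))" using G by simp
  qed simp
  have "integral\<^sup>L (lborel \<Otimes>\<^sub>M lborel) ?f = (LINT z|lborel. F z) * (LINT z|lborel. G z)"
    using lborel_pair.integral_fst'[OF int] by simp
  then show ?thesis using int by (simp add: has_bochner_integral_iff lborel_prod)
qed

definition heat_smoothed :: "('m::finite space \<Rightarrow> real) \<Rightarrow> (real^'m \<Rightarrow> real) \<Rightarrow> 'm space \<Rightarrow> real \<Rightarrow> real" where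
  "heat_smoothed Q u x \<tau> = (LINT w|lborel. heat_kernel w \<tau> * layer_potential Q u (x - (w, 0)))"

lemma layer_potential_measurable [measurable]:
  fixes Q :: "'m::finite space \<Rightarrow> real"
  assumes [measurable]: "Q \<in> borel_measurable borel" "u \<in> borel_measurable borel" "f \<in> borel_measurable M"
  shows "(\<lambda>x. layer_potential Q u (f x)) \<in> borel_measurable M"
  unfolding layer_potential_def by measurable

lemma heat_smoothed_measurable [measurable]:
  fixes Q :: "'m::finite space \<Rightarrow> real"
  assumes [measurable]: "Q \<in> borel_measurable borel" "u \<in> borel_measurable borel" "f \<in> borel_measurable M" "g \<in> borel_measurable M"
  shows "(\<lambda>x. heat_smoothed Q u (f x) (g x)) \<in> borel_measurable M"
  unfolding heat_smoothed_def by measurable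

text \<open>Averaging over the heat kernel centred at \<open>y\<close> and integrating against \<open>u y\<close> amounts to
  smoothing the layer potential of \<open>u\<close> by the heat flow: after the shift \<open>z = y + w\<close> the two integrals
  are exchanged by Fubini's theorem.\<close>

lemma heat_avg_swap:
  fixes Q :: "'m::finite space \<Rightarrow> real"
  assumes Q: "tame_kernel Q" and x: "snd x > 0" and \<tau>: "\<tau> > 0" and u: "integrable lborel u"
  shows "has_bochner_integral lborel (\<lambda>y. heat_avg Q x y \<tau> * u y) (heat_smoothed Q u x \<tau>)"
proof -
  note [measurable] = Q[THEN tame_kernel_measurable]
  have [measurable]: "u \<in> borel_measurable borel" using u by auto
  obtain C where C: "0 \<le> C" "\<And>p. snd x \<le> norm p \<Longrightarrow> \<bar>Q p\<bar> \<le> C" using tame_kernel_bound[OF Q x] by metis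
  let ?f = "\<lambda>y w. Q (x - (y + w, 0)) * heat_kernel w \<tau> * u y"
  have dom: "integrable lborel (\<lambda>p. (C * \<bar>u (fst p)\<bar>) * heat_kernel (snd p :: real^'m) \<tau>)"
    using has_bochner_integral_lborel_prod[of "\<lambda>y. C * \<bar>u y\<bar>" "\<lambda>w::real^'m. heat_kernel w \<tau>"] u heat_kernel_integrable[OF \<tau>]
    by (auto simp: has_bochner_integral_iff)
  have int: "integrable (lborel \<Otimes>\<^sub>M lborel) (case_prod ?f)"
    unfolding lborel_prod
  proof (rule Bochner_Integration.integrable_bound[OF dom])
    show "AE p in lborel. norm (case_prod ?f p) \<le> norm ((C * \<bar>u (fst p)\<bar>) * heat_kernel (snd p :: real^'m) \<tau>)"
    proof (intro AE_I2)
      fix p :: "(real^'m) \<times> (real^'m)"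
      have "\<bar>Q (x - (fst p + snd p, 0))\<bar> \<le> C" using C(2) snd_le_norm_diff[of x "fst p + snd p"] x by auto
      then have "\<bar>Q (x - (fst p + snd p, 0))\<bar> * (heat_kernel (snd p) \<tau> * \<bar>u (fst p)\<bar>)
          \<le> C * (heat_kernel (snd p) \<tau> * \<bar>u (fst p)\<bar>)"
        by (intro mult_right_mono) auto
      then show "norm (case_prod ?f p) \<le> norm ((C * \<bar>u (fst p)\<bar>) * heat_kernel (snd p :: real^'m) \<tau>)"
        using C(1) by (simp add: case_prod_unfold abs_mult mult_ac)
    qed
    have "(\<lambda>p. Q (x - (fst p + snd p, 0)) * heat_kernel (snd p) \<tau> * u (fst p)) \<in> borel_measurable borel"
      by measurable
    then show "case_prod ?f \<in> borel_measurable lborel" by (simp add: case_prod_unfold)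
  qed
  have inner1: "(LINT w|lborel. ?f y w) = heat_avg Q x y \<tau> * u y" for y
  proof -
    have "heat_avg Q x y \<tau> = (LINT w|lborel. Q (x - (y + w, 0)) * heat_kernel (y + w - y) \<tau>)"
      unfolding heat_avg_def layer_potential_def by (rule lborel_integral_shift[symmetric]) simp
    then show ?thesis by (subst integral_mult_left_zero) simp
  qed
  have inner2: "(LINT y|lborel. ?f y w) = heat_kernel w \<tau> * layer_potential Q u (x - (w, 0))" for w
  proof -
    have "(LINT y|lborel. ?f y w) = (LINT y|lborel. heat_kernel w \<tau> * (Q (x - (w, 0) - (y, 0)) * u y))"
      by (intro Bochner_Integration.integral_cong) (auto simp: algebra_simps)
    then show ?thesis by (simp add: layer_potential_def)
  qed
  have "integrable lborel (\<lambda>y. heat_avg Q x y \<tau> * u y)"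
    using lborel_pair.integrable_fst'[OF int] by (simp only: prod.case inner1)
  moreover have "(LINT y|lborel. heat_avg Q x y \<tau> * u y) = heat_smoothed Q u x \<tau>"
    using lborel_pair.Fubini_integral[OF int] by (simp only: inner1 inner2 heat_smoothed_def)
  ultimately show ?thesis by (simp add: has_bochner_integral_iff)
qed

text \<open>The normal factors of the two terms of the pressure kernel, integrated against the derivative of
  the normal profile.\<close>

definition heat_moment0 :: "(real \<Rightarrow> real) \<Rightarrow> real \<Rightarrow> real" where
  "heat_moment0 gN \<tau> = (LINT y|lborel. heat_kernel y \<tau> * normal_deriv gN y)"

definition heat_moment1 :: "(real \<Rightarrow> real) \<Rightarrow> real \<Rightarrow> real" where
  "heat_moment1 gN \<tau> = (LINT y|lborel. y / (2 * \<tau>) * heat_kernel y \<tau> * normal_deriv gN y)"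

lemma integrable_powr_02:
  assumes "\<beta> < (1::real)"
  shows "integrable lborel (\<lambda>y. indicator {0<..<2} y * y powr (- \<beta>) :: real)"
  using powr_interval[of "- \<beta>" 2] assms by (auto simp: has_bochner_integral_iff)

lemma integrable_mult_normal_deriv:
  assumes gN: "normal_profile \<beta> gN" "0 < \<beta>" "\<beta> < 1"
    and [measurable]: "v \<in> borel_measurable borel" and v: "\<And>y. 0 < y \<Longrightarrow> y < 2 \<Longrightarrow> \<bar>v y\<bar> \<le> C"
  shows "integrable lborel (\<lambda>y. v y * normal_deriv gN y)"
proof -
  obtain M where M: "0 \<le> M" and [measurable]: "normal_deriv gN \<in> borel_measurable borel"
    and bd: "\<And>y. \<bar>normal_deriv gN y\<bar> \<le> M * (indicator {0<..<2} y * y powr (- \<beta>))"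
    by (rule normal_profile_facts[OF gN]) blast
  show ?thesis
  proof (rule Bochner_Integration.integrable_bound[OF integrable_mult_right[of "C * M", OF integrable_powr_02[OF gN(3)]]])
    show "AE y in lborel. norm (v y * normal_deriv gN y) \<le> norm (C * M * (indicator {0<..<2} y * y powr (- \<beta>)))"
    proof (intro AE_I2)
      fix y :: real
      show "norm (v y * normal_deriv gN y) \<le> norm (C * M * (indicator {0<..<2} y * y powr (- \<beta>)))"
      proof (cases "y \<in> {0<..<2}")
        case True
        have C: "0 \<le> C" using v[of y] True by auto
        then have "\<bar>v y\<bar> * \<bar>normal_deriv gN y\<bar> \<le> C * (M * (indicator {0<..<2} y * y powr (- \<beta>)))"
          using v[of y] True bd[of y] by (intro mult_mono) auto
        also have "\<dots> = C * M * (indicator {0<..<2} y * y powr (- \<beta>))" by (simp add: mult.assoc)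
        finally have "norm (v y * normal_deriv gN y) \<le> C * M * (indicator {0<..<2} y * y powr (- \<beta>))"
          by (simp only: real_norm_def abs_mult)
        then show ?thesis by (metis abs_ge_self order_trans real_norm_def)
      next
        case False
        then show ?thesis using bd[of y] by simp
      qed
    qed
  qed simp
qed

lemma heat_kernel_real_le: "\<tau> > 0 \<Longrightarrow> heat_kernel (y::real) \<tau> \<le> (4 * pi * \<tau>) powr (- (1/2))"
  unfolding heat_kernel_def by (simp add: mult_left_le)

lemma heat_moment_integrable:
  assumes gN: "normal_profile \<beta> gN" "0 < \<beta>" "\<beta> < 1" and \<tau>: "\<tau> > 0"
  shows "integrable lborel (\<lambda>y. heat_kernel y \<tau> * normal_deriv gN y)"
    and "integrable lborel (\<lambda>y. y / (2 * \<tau>) * heat_kernel y \<tau> * normal_deriv gN y)"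
proof -
  show "integrable lborel (\<lambda>y. heat_kernel y \<tau> * normal_deriv gN y)"
  proof (rule integrable_mult_normal_deriv[OF gN])
    show "\<bar>heat_kernel y \<tau>\<bar> \<le> (4 * pi * \<tau>) powr (- (1/2))" for y :: real
      using heat_kernel_real_le[OF \<tau>, of y] by simp
  qed simp
  show "integrable lborel (\<lambda>y. y / (2 * \<tau>) * heat_kernel y \<tau> * normal_deriv gN y)"
  proof (rule integrable_mult_normal_deriv[OF gN])
    fix y :: real assume y: "0 < y" "y < 2"
    have "y / (2 * \<tau>) * heat_kernel y \<tau> \<le> 2 / (2 * \<tau>) * (4 * pi * \<tau>) powr (- (1/2))"
      using y \<tau> heat_kernel_real_le[OF \<tau>] by (intro mult_mono divide_right_mono) auto
    then show "\<bar>y / (2 * \<tau>) * heat_kernel y \<tau>\<bar> \<le> 2 / (2 * \<tau>) * (4 * pi * \<tau>) powr (- (1/2))"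
      using y \<tau> by (subst abs_of_nonneg) auto
  qed simp
qed

definition pressure_density :: "'m \<Rightarrow> (real^'m \<Rightarrow> real) \<Rightarrow> (real \<Rightarrow> real) \<Rightarrow> 'm::finite space \<Rightarrow> real \<Rightarrow> real" where
  "pressure_density k gT gN x \<tau> =
     heat_moment0 gN \<tau> * heat_smoothed (newton_mixed e_n (e_tan k)) gT x \<tau>
     - heat_moment1 gN \<tau> * heat_smoothed (newton_grad (e_tan k)) gT x \<tau>"

text \<open>The component \<open>P_n\<close> of the kernel vanishes, so only the \<open>k\<close>-th component of the force is seen. It is a
  product of a function of \<open>fst y\<close> and one of \<open>snd y\<close>, and each term of the kernel is such a product too.\<close>

lemma pressure_space_integral:
  fixes x :: "'m::finite space"
  assumes card: "CARD('m) \<ge> 2" and gT: "tangential_profile gT" and gN: "normal_profile \<beta> gN" "0 < \<beta>" "\<beta> < 1"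
    and x: "snd x > 0" and \<tau>: "\<tau> > 0"
  shows "(LINT y:half_space|lborel. pressure_kernel x y \<tau> \<bullet> force \<alpha> a k gT gN y s)
     = 4 * a * time_profile \<alpha> s * pressure_density k gT gN x \<tau>"
proof -
  let ?c = "4 * a * time_profile \<alpha> s"
  let ?V2 = "\<lambda>z. heat_avg (newton_mixed e_n (e_tan k)) x z \<tau> * gT z"
  let ?V1 = "\<lambda>z. heat_avg (newton_grad (e_tan k)) x z \<tau> * gT z"
  let ?A = "\<lambda>y. heat_kernel y \<tau> * normal_deriv gN y"
  let ?B = "\<lambda>y. y / (2 * \<tau>) * heat_kernel y \<tau> * normal_deriv gN y"
  have D: "\<And>y. 0 < y \<Longrightarrow> (gN has_real_derivative normal_deriv gN y) (at y)"
    using normal_profile_facts[OF gN] by blast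
  have iT: "integrable lborel gT" using tangential_profile_bounds[OF gT] by blast
  have "indicator half_space y *\<^sub>R (pressure_kernel x y \<tau> \<bullet> force \<alpha> a k gT gN y s)
      = ?c * (?V2 (fst y) * ?A (snd y) - ?V1 (fst y) * ?B (snd y))" for y
  proof (cases "snd y > 0")
    case True
    have "pressure_kernel x y \<tau> \<bullet> force \<alpha> a k gT gN y s
        = pressure_kernel_comp (e_tan k) x y \<tau> * (a * (gT (fst y) * normal_deriv gN (snd y)) * time_profile \<alpha> s)"
      unfolding force_def inner_add_right inner_scaleR_right
      by (simp add: pressure_kernel_inner e_in_Basis pressure_kernel_comp_e_n partial_n_space_profile D True)
    also have "\<dots> = ?c * (?V2 (fst y) * ?A (snd y) - ?V1 (fst y) * ?B (snd y))"
      unfolding pressure_kernel_comp_e_tan[OF card x \<tau>] by (simp add: algebra_simps)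
    finally show ?thesis using True by (simp add: half_space_def)
  next
    case False
    then show ?thesis by (simp add: half_space_def normal_deriv_def)
  qed
  then have "(LINT y:half_space|lborel. pressure_kernel x y \<tau> \<bullet> force \<alpha> a k gT gN y s)
     = (LINT y|lborel. ?c * (?V2 (fst y) * ?A (snd y) - ?V1 (fst y) * ?B (snd y)))"
    unfolding set_lebesgue_integral_def by simp
  also have "\<dots> = ?c * (heat_smoothed (newton_mixed e_n (e_tan k)) gT x \<tau> * heat_moment0 gN \<tau>
        - heat_smoothed (newton_grad (e_tan k)) gT x \<tau> * heat_moment1 gN \<tau>)"
  proof (rule has_bochner_integral_integral_eq, intro has_bochner_integral_mult_right has_bochner_integral_diff)
    have V2: "has_bochner_integral lborel ?V2 (heat_smoothed (newton_mixed e_n (e_tan k)) gT x \<tau>)"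
      by (intro heat_avg_swap tame_newton card x \<tau> iT) auto
    have V1: "has_bochner_integral lborel ?V1 (heat_smoothed (newton_grad (e_tan k)) gT x \<tau>)"
      by (intro heat_avg_swap tame_newton(2)[where e'=e_n] card x \<tau> iT) auto
    show "has_bochner_integral lborel (\<lambda>y. ?V2 (fst y) * ?A (snd y))
        (heat_smoothed (newton_mixed e_n (e_tan k)) gT x \<tau> * heat_moment0 gN \<tau>)"
      using has_bochner_integral_lborel_prod[of ?V2 ?A] V2 heat_moment_integrable(1)[OF gN \<tau>]
      by (simp add: has_bochner_integral_iff heat_moment0_def)
    show "has_bochner_integral lborel (\<lambda>y. ?V1 (fst y) * ?B (snd y))
        (heat_smoothed (newton_grad (e_tan k)) gT x \<tau> * heat_moment1 gN \<tau>)"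
      using has_bochner_integral_lborel_prod[of ?V1 ?B] V1 heat_moment_integrable(2)[OF gN \<tau>]
      by (simp add: has_bochner_integral_iff heat_moment1_def)
  qed
  finally show ?thesis by (simp add: pressure_density_def mult_ac)
qed

lemma pressure_eq:
  fixes x :: "'m::finite space"
  assumes "CARD('m) \<ge> 2" "tangential_profile gT" "normal_profile \<beta> gN" "0 < \<beta>" "\<beta> < 1" "snd x > 0"
  shows "pressure (force \<alpha> a k gT gN) x t =
     4 * a * (LINT s:{0<..<t}|lborel. time_profile \<alpha> s * pressure_density k gT gN x (t - s))"
proof -
  have "pressure (force \<alpha> a k gT gN) x t
      = (LINT s:{0<..<t}|lborel. 4 * a * (time_profile \<alpha> s * pressure_density k gT gN x (t - s)))"
    unfolding pressure_def
    by (intro set_lebesgue_integral_cong) (auto simp: pressure_space_integral[OF assms] mult_ac)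
  then show ?thesis by simp
qed

lemma heat_moment_measurable [measurable]:
  assumes [measurable]: "normal_deriv gN \<in> borel_measurable borel" "f \<in> borel_measurable M"
  shows "(\<lambda>x. heat_moment0 gN (f x)) \<in> borel_measurable M" "(\<lambda>x. heat_moment1 gN (f x)) \<in> borel_measurable M"
  unfolding heat_moment0_def heat_moment1_def by measurable

lemma pressure_density_measurable [measurable]:
  assumes [measurable]: "normal_deriv gN \<in> borel_measurable borel" "gT \<in> borel_measurable borel"
    "f \<in> borel_measurable M" "g \<in> borel_measurable M"
  shows "(\<lambda>x. pressure_density k gT gN (f x) (g x)) \<in> borel_measurable M"
  unfolding pressure_density_def by measurable

lemma time_profile_measurable [measurable]:
  assumes [measurable]: "f \<in> borel_measurable M"
  shows "(\<lambda>x. time_profile \<alpha> (f x)) \<in> borel_measurable M"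
  unfolding time_profile_def by measurable

lemma pressure_measurable:
  fixes gT :: "real^'m::finite \<Rightarrow> real"
  assumes "CARD('m) \<ge> 2" "tangential_profile gT" "normal_profile \<beta> gN" "0 < \<beta>" "\<beta> < 1"
  shows "set_borel_measurable lborel (half_space \<times> {0<..<1}) (\<lambda>(x, t). pressure (force \<alpha> a k gT gN) x t)"
proof -
  have [measurable]: "normal_deriv gN \<in> borel_measurable borel"
    using normal_profile_facts[OF assms(3-5)] by blast
  have [measurable]: "gT \<in> borel_measurable borel"
    using tangential_profile_bounds[OF assms(2)] borel_measurable_continuous_onI by metis
  have hs: "(half_space :: 'm space set) \<times> {0<..<1::real} \<in> sets borel"
  proof -
    have "open (half_space :: 'm space set)" unfolding half_space_def
      by (intro open_Collect_less continuous_intros)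
    then show ?thesis by (intro borel_open open_Times) auto
  qed
  let ?F = "\<lambda>p. 4 * a * (LINT s|lborel. indicator {0<..<snd p} s * (time_profile \<alpha> s * pressure_density k gT gN (fst p) (snd p - s)))"
  have "(\<lambda>p. indicator (half_space \<times> {0<..<1}) p *\<^sub>R (case p of (x, t) \<Rightarrow> pressure (force \<alpha> a k gT gN) x t))
      = (\<lambda>p. indicator (half_space \<times> {0<..<1}) p *\<^sub>R ?F p)"
    using pressure_eq[OF assms] by (auto simp: fun_eq_iff set_lebesgue_integral_def half_space_def split: split_indicator)
  moreover have "?F \<in> borel_measurable borel"
  proof -
    have "(\<lambda>p::('m space \<times> real) \<times> real. indicator {0<..<snd (fst p)} (snd p) :: real)
        = (\<lambda>p. if 0 < snd p \<and> snd p < snd (fst p) then 1 else 0)" by (auto simp: fun_eq_iff)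
    then have [measurable]: "(\<lambda>p::('m space \<times> real) \<times> real. indicator {0<..<snd (fst p)} (snd p) :: real)
       \<in> borel_measurable (borel \<Otimes>\<^sub>M lborel)" by simp
    show ?thesis unfolding case_prod_unfold
      by (intro borel_measurable_times borel_measurable_const lborel.borel_measurable_lebesgue_integral)
         (simp add: case_prod_unfold)
  qed
  ultimately show ?thesis unfolding set_borel_measurable_def using hs by simp
qed

section \<open>Spatial decay and positivity\<close>

lemma pred_ball [measurable]: "Measurable.pred borel (\<lambda>x::'a::euclidean_space. x \<in> ball c r)"
  unfolding pred_def by simp

lemma abs_integral_le:
  fixes f g :: "'b \<Rightarrow> real"
  assumes "integrable M g" "\<And>z. \<bar>f z\<bar> \<le> g z"
  shows "\<bar>LINT z|M. f z\<bar> \<le> (LINT z|M. g z)"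
proof (cases "integrable M f")
  case True
  have "\<bar>LINT z|M. f z\<bar> \<le> (LINT z|M. \<bar>f z\<bar>)" by (rule integral_abs_bound)
  also have "\<dots> \<le> (LINT z|M. g z)" using True assms by (intro integral_mono) auto
  finally show ?thesis .
next
  case False
  have "0 \<le> (LINT z|M. g z)"
    by (intro integral_nonneg_AE AE_I2) (meson abs_ge_zero assms(2) order_trans)
  then show ?thesis using False by (simp add: not_integrable_integral_eq)
qed

lemma abs_integral_le_nn:
  fixes f :: "'b \<Rightarrow> real"
  assumes "(\<integral>\<^sup>+z. ennreal \<bar>f z\<bar> \<partial>M) \<le> ennreal C" "0 \<le> C"
  shows "\<bar>LINT z|M. f z\<bar> \<le> C"
proof (cases "integrable M f")
  case True
  have "ennreal \<bar>LINT z|M. f z\<bar> \<le> (\<integral>\<^sup>+z. ennreal \<bar>f z\<bar> \<partial>M)"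
    using integral_norm_bound_ennreal[OF True] by simp
  then show ?thesis using assms by (metis ennreal_le_iff order_trans)
qed (use assms in \<open>simp add: not_integrable_integral_eq\<close>)

lemma nn_integral_lborel_reflect:
  fixes f :: "'a::euclidean_space \<Rightarrow> ennreal"
  assumes [measurable]: "f \<in> borel_measurable borel"
  shows "(\<integral>\<^sup>+x. f (c - x) \<partial>lborel) = (\<integral>\<^sup>+x. f x \<partial>lborel)"
proof -
  have "lborel = distr lborel borel (\<lambda>x::'a. c + (- 1) *\<^sub>R x)"
    by (subst lborel_affine[of "- 1" c]) (auto simp: density_1)
  then have "(\<integral>\<^sup>+x. f x \<partial>lborel) = (\<integral>\<^sup>+x. f x \<partial>distr lborel borel (\<lambda>x::'a. c + (- 1) *\<^sub>R x))" by simp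
  also have "\<dots> = (\<integral>\<^sup>+x. f (c - x) \<partial>lborel)" by (subst nn_integral_distr) auto
  finally show ?thesis by simp
qed

lemma space_diff_pair: "x - (z, 0) = (fst x - z, snd x)" for x :: "'m::finite space"
  by (cases x) simp

text \<open>Near the support of the density the kernel is controlled only through an integrable majorant
  \<open>H\<close>, and only on a region \<open>S\<close> that contains the displacements from the points of the support.\<close>

lemma layer_potential_near:
  fixes Q :: "'m::finite space \<Rightarrow> real" and u :: "real^'m \<Rightarrow> real"
  assumes u: "\<And>z. \<bar>u z\<bar> \<le> M * indicator (ball 0 1) z" "0 \<le> M"
    and [measurable]: "H \<in> borel_measurable borel" "S \<in> sets borel"
    and QH: "\<And>z. norm z < 1 \<Longrightarrow> \<bar>Q (x - (z, 0))\<bar> \<le> H (fst x - z) \<and> fst x - z \<in> S" and H0: "\<And>w. 0 \<le> H w"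
    and H: "(\<integral>\<^sup>+w. ennreal (H w * indicator S w) \<partial>lborel) \<le> ennreal K" "0 \<le> K"
  shows "\<bar>layer_potential Q u x\<bar> \<le> M * K"
  unfolding layer_potential_def
proof (rule abs_integral_le_nn)
  have "(\<integral>\<^sup>+z. ennreal \<bar>Q (x - (z, 0)) * u z\<bar> \<partial>lborel)
      \<le> (\<integral>\<^sup>+z. ennreal M * ennreal (H (fst x - z) * indicator S (fst x - z)) \<partial>lborel)"
  proof (intro nn_integral_mono)
    fix z :: "real^'m"
    have "\<bar>Q (x - (z, 0)) * u z\<bar> \<le> M * (H (fst x - z) * indicator S (fst x - z))"
    proof (cases "norm z < 1")
      case True
      then have "\<bar>Q (x - (z, 0))\<bar> * \<bar>u z\<bar> \<le> H (fst x - z) * M"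
        using QH[OF True] u(1)[of z] by (intro mult_mono) (auto intro: H0)
      then show ?thesis using QH[OF True] by (simp add: abs_mult mult_ac)
    next
      case False
      then have "u z = 0" using u(1)[of z] by simp
      then show ?thesis using u(2) H0 by simp
    qed
    then show "ennreal \<bar>Q (x - (z, 0)) * u z\<bar> \<le> ennreal M * ennreal (H (fst x - z) * indicator S (fst x - z))"
      using u(2) H0 by (simp add: ennreal_mult[symmetric] ennreal_leI)
  qed
  also have "\<dots> = ennreal M * (\<integral>\<^sup>+w. ennreal (H w * indicator S w) \<partial>lborel)"
    by (subst nn_integral_cmult, simp, subst nn_integral_lborel_reflect[of "\<lambda>w. ennreal (H w * indicator S w)"]) auto
  also have "\<dots> \<le> ennreal M * ennreal K" by (intro mult_left_mono H) auto
  finally show "(\<integral>\<^sup>+z. ennreal \<bar>Q (x - (z, 0)) * u z\<bar> \<partial>lborel) \<le> ennreal (M * K)"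
    using u(2) H(2) by (simp add: ennreal_mult)
qed (use u(2) H(2) in simp)

text \<open>Seen from a distance of at least 2, the points of the unit ball are equally far away up to a factor.\<close>

lemma layer_potential_far:
  fixes Q :: "'m::finite space \<Rightarrow> real" and u :: "real^'m \<Rightarrow> real"
  assumes u: "\<And>z. \<bar>u z\<bar> \<le> M * indicator (ball 0 1) z" "0 \<le> M"
    and Q: "\<And>p. 1 \<le> norm p \<Longrightarrow> \<bar>Q p\<bar> \<le> K * norm p powr (- s)" and K: "0 \<le> K" "0 \<le> s" and x: "2 \<le> norm x"
  shows "\<bar>layer_potential Q u x\<bar> \<le> K * M * 3 powr s * measure lborel (ball (0 :: real^'m) 1) * (1 + norm x) powr (- s)"
proof -
  let ?B = "K * M * 3 powr s * (1 + norm x) powr (- s)"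
  have "\<bar>layer_potential Q u x\<bar> \<le> (LINT z|lborel. ?B * indicator (ball (0 :: real^'m) 1) z)"
    unfolding layer_potential_def
  proof (rule abs_integral_le)
    fix z :: "real^'m"
    show "\<bar>Q (x - (z, 0)) * u z\<bar> \<le> ?B * indicator (ball 0 1) z"
    proof (cases "norm z < 1")
      case True
      have "norm x - norm (z, 0::real) \<le> norm (x - (z, 0))" by (rule norm_triangle_ineq2)
      \<comment> \<open>The distance to the unit ball is at least \<open>norm x - 1\<close>, which is comparable to \<open>1 + norm x\<close> once \<open>norm x \<ge> 2\<close>.\<close>
      then have far: "(1 + norm x) / 3 \<le> norm (x - (z, 0))" using True x by simp
      have "norm (x - (z, 0)) powr (- s) \<le> ((1 + norm x) / 3) powr (- s)"
        using far K x by (intro powr_mono2') (auto simp: add_pos_nonneg)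
      also have "\<dots> = 3 powr s * (1 + norm x) powr (- s)"
        by (subst powr_divide) (simp_all add: powr_minus_divide)
      finally have "K * norm (x - (z, 0)) powr (- s) \<le> K * (3 powr s * (1 + norm x) powr (- s))"
        using K(1) by (rule mult_left_mono)
      moreover have "\<bar>Q (x - (z, 0))\<bar> \<le> K * norm (x - (z, 0)) powr (- s)"
      proof (rule Q)
        have "1 \<le> (1 + norm x) / 3" using x by simp
        then show "1 \<le> norm (x - (z, 0))" using far by (rule order_trans)
      qed
      ultimately have "\<bar>Q (x - (z, 0))\<bar> \<le> K * (3 powr s * (1 + norm x) powr (- s))" by linarith
      then have "\<bar>Q (x - (z, 0))\<bar> * \<bar>u z\<bar> \<le> K * (3 powr s * (1 + norm x) powr (- s)) * M"
        using u(1)[of z] True K by (intro mult_mono) auto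
      then show ?thesis using True by (simp add: abs_mult mult_ac)
    next
      case False
      then have "u z = 0" using u(1)[of z] by simp
      then show ?thesis using False by simp
    qed
  qed (intro integrable_mult_right integrable_indicator_ball)
  also have "\<dots> = ?B * measure lborel (ball (0 :: real^'m) 1)" by simp
  finally show ?thesis by (simp add: mult_ac)
qed

lemma decay_combine:
  fixes \<phi> :: "'m::finite space \<Rightarrow> real"
  assumes near: "\<And>x. snd x > 0 \<Longrightarrow> norm x \<le> 2 \<Longrightarrow> \<bar>\<phi> x\<bar> \<le> A" and far: "\<And>x. snd x > 0 \<Longrightarrow> 2 \<le> norm x \<Longrightarrow> \<bar>\<phi> x\<bar> \<le> B * (1 + norm x) powr (- s)"
    and nn: "0 \<le> A" "0 \<le> B" "0 \<le> s" and x: "snd x > 0"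
  shows "\<bar>\<phi> x\<bar> \<le> (A * 3 powr s + B) * (1 + norm x) powr (- s)"
proof (cases "norm x \<le> 2")
  case True
  have "3 powr (- s) \<le> (1 + norm x) powr (- s)" using True nn by (intro powr_mono2') (auto simp: add_pos_nonneg)
  then have "A * (3 powr s * 3 powr (- s)) \<le> A * (3 powr s * (1 + norm x) powr (- s))" using nn by (intro mult_left_mono) auto
  moreover have "3 powr s * 3 powr (- s) = (1::real)" by (simp add: powr_minus)
  moreover have "0 \<le> B * (1 + norm x) powr (- s)" using nn by simp
  ultimately show ?thesis using near[OF x True] by (simp add: algebra_simps)
next
  case False
  have "0 \<le> A * 3 powr s * (1 + norm x) powr (- s)" using nn by simp
  then show ?thesis using far[OF x] False by (simp add: algebra_simps)
qed

text \<open>Near the support of the density the tangential derivative is moved onto the density: there remain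
  the Newton kernel, which is locally integrable over the boundary, and its normal derivative, which is the
  Poisson kernel up to a constant. Far away the kernels are small themselves.\<close>

lemma layer_potential_decay:
  fixes gT :: "real^'m::finite \<Rightarrow> real"
  assumes card: "CARD('m) \<ge> 2" and gT: "tangential_profile gT"
  obtains C where "0 \<le> C"
    "\<And>x. snd x > 0 \<Longrightarrow> \<bar>layer_potential (newton_grad (e_tan k)) gT x\<bar> \<le> C * (1 + norm x) powr (- real CARD('m))"
    "\<And>x. snd x > 0 \<Longrightarrow> \<bar>layer_potential (newton_mixed e_n (e_tan k)) gT x\<bar> \<le> C * (1 + norm x) powr (- real CARD('m))"
proof -
  let ?d = "real CARD('m)" and ?n = "real DIM('m space)"
  let ?v = "unit_ball_vol ?n"
  let ?G = "newton_grad (e_tan k) :: 'm space \<Rightarrow> real" and ?H = "newton_mixed e_n (e_tan k) :: 'm space \<Rightarrow> real"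
  have n: "?n = ?d + 1" by simp
  have dim: "DIM('m space) \<ge> 3" using card by simp
  have v: "?v > 0" by simp
  obtain M where M: "0 \<le> M" "\<And>z. \<bar>gT z\<bar> \<le> M * indicator (ball 0 1) z" "\<And>z. \<bar>grad_comp k gT z\<bar> \<le> M * indicator (ball 0 1) z"
    by (rule tangential_profile_bounds[OF gT, of k]) blast
  have GN: "layer_potential ?G gT x = layer_potential newton_kernel (grad_comp k gT) x" if "snd x > 0" for x
    by (intro layer_potential_grad_comp gT tame_newton(1)[of e_n e_n] tame_newton(2)[of _ e_n] card that DERIV_newton_kernel dim) auto
  have HN: "layer_potential ?H gT x = layer_potential (newton_grad e_n) (grad_comp k gT) x" if "snd x > 0" for x
    by (intro layer_potential_grad_comp gT tame_newton(2)[of _ e_n] tame_newton(3) card that DERIV_newton_grad) (auto simp: inner_e)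
  obtain K where K: "0 \<le> K" "\<And>x::'m space. \<bar>newton_kernel x\<bar> = K * norm x powr (2 - ?n)"
    by (rule abs_newton_kernel[OF dim]) blast
  obtain R where R: "0 \<le> R" "\<And>r::real. r > 0 \<Longrightarrow>
      (\<integral>\<^sup>+w. ennreal (norm (w, r) powr (- (real DIM(real^'m) - 1)) * indicator (ball 0 3) w) \<partial>(lborel :: (real^'m) measure)) \<le> ennreal R"
    by (rule nn_integral_riesz[where 'a="real^'m", of 3]) (simp, blast)
  obtain P where P: "0 \<le> P" "\<And>r::real. r > 0 \<Longrightarrow>
      (\<integral>\<^sup>+w. ennreal (r * norm (w, r) powr (- (real DIM(real^'m) + 1))) \<partial>(lborel :: (real^'m) measure)) \<le> ennreal P"
    by (rule nn_integral_poisson[where 'a="real^'m"]) blast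
  have G_near: "\<bar>layer_potential ?G gT x\<bar> \<le> M * (K * R)" if x: "snd x > 0" "norm x \<le> 2" for x
    unfolding GN[OF x(1)]
  proof (rule layer_potential_near[OF M(3,1), where H="\<lambda>w. K * norm (w, snd x) powr (- (real DIM(real^'m) - 1))" and S="ball 0 3"])
    fix z :: "real^'m" assume z: "norm z < 1"
    have "norm (fst x - z) \<le> norm (fst x) + norm z" by (rule norm_triangle_ineq4)
    also have "\<dots> < 3" using z x(2) norm_fst_le[of "fst x" "snd x"] by simp
    finally show "\<bar>newton_kernel (x - (z, 0))\<bar> \<le> K * norm (fst x - z, snd x) powr (- (real DIM(real^'m) - 1)) \<and> fst x - z \<in> ball 0 3"
      unfolding K(2) by (simp add: space_diff_pair)
  next
    have "(\<integral>\<^sup>+w. ennreal (K * norm (w, snd x) powr (- (real DIM(real^'m) - 1)) * indicator (ball 0 3) w) \<partial>(lborel :: (real^'m) measure))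
       = ennreal K * (\<integral>\<^sup>+w. ennreal (norm (w, snd x) powr (- (real DIM(real^'m) - 1)) * indicator (ball 0 3) w) \<partial>(lborel :: (real^'m) measure))"
      using K(1) by (subst nn_integral_cmult[symmetric]) (auto simp: ennreal_mult mult.assoc simp del: DIM_cart)
    also have "\<dots> \<le> ennreal K * ennreal R" by (intro mult_left_mono R x) auto
    finally show "(\<integral>\<^sup>+w. ennreal (K * norm (w, snd x) powr (- (real DIM(real^'m) - 1)) * indicator (ball 0 3) w) \<partial>(lborel :: (real^'m) measure))
        \<le> ennreal (K * R)" using K(1) R(1) by (simp add: ennreal_mult)
  qed (use K(1) R(1) in auto)
  have H_near: "\<bar>layer_potential ?H gT x\<bar> \<le> M * (1 / (?n * ?v) * P)" if x: "snd x > 0" for x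
    unfolding HN[OF x]
  proof (rule layer_potential_near[OF M(3,1), where H="\<lambda>w. 1 / (?n * ?v) * (snd x * norm (w, snd x) powr (- (real DIM(real^'m) + 1)))" and S=UNIV])
    fix z :: "real^'m"
    show "\<bar>newton_grad e_n (x - (z, 0))\<bar> \<le> 1 / (?n * ?v) * (snd x * norm (fst x - z, snd x) powr (- (real DIM(real^'m) + 1))) \<and> fst x - z \<in> UNIV"
      using x v by (simp add: newton_grad_def inner_e space_diff_pair abs_mult abs_divide add.commute)
  next
    have "(\<integral>\<^sup>+w. ennreal (1 / (?n * ?v) * (snd x * norm (w, snd x) powr (- (real DIM(real^'m) + 1))) * indicator UNIV w) \<partial>(lborel :: (real^'m) measure))
       = ennreal (1 / (?n * ?v)) * (\<integral>\<^sup>+w. ennreal (snd x * norm (w, snd x) powr (- (real DIM(real^'m) + 1))) \<partial>(lborel :: (real^'m) measure))"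
      using v x by (subst nn_integral_cmult[symmetric], simp, subst ennreal_mult[symmetric]) (auto simp del: DIM_cart)
    also have "\<dots> \<le> ennreal (1 / (?n * ?v)) * ennreal P" by (intro mult_left_mono P x) auto
    also have "\<dots> = ennreal (1 / (?n * ?v) * P)" using v P(1) by (intro ennreal_mult[symmetric]) auto
    finally show "(\<integral>\<^sup>+w. ennreal (1 / (?n * ?v) * (snd x * norm (w, snd x) powr (- (real DIM(real^'m) + 1))) * indicator UNIV w) \<partial>(lborel :: (real^'m) measure))
        \<le> ennreal (1 / (?n * ?v) * P)" .
  qed (use v x P(1) M in auto)
  let ?V = "measure lborel (ball (0 :: real^'m) 1)"
  have G_far: "\<bar>layer_potential ?G gT x\<bar> \<le> 1 / (?n * ?v) * M * 3 powr ?d * ?V * (1 + norm x) powr (- ?d)" if "2 \<le> norm x" for x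
  proof (rule layer_potential_far[OF M(2,1)])
    fix p :: "'m space"
    show "\<bar>?G p\<bar> \<le> 1 / (?n * ?v) * norm p powr (- ?d)"
      using abs_newton_grad_le[OF norm_e(2), of k p] by simp
  qed (use v that in auto)
  have H_far: "\<bar>layer_potential ?H gT x\<bar> \<le> 1 / ?v * M * 3 powr ?d * ?V * (1 + norm x) powr (- ?d)" if "2 \<le> norm x" for x
  proof (rule layer_potential_far[OF M(2,1)])
    fix p :: "'m space" assume p: "1 \<le> norm p"
    have "norm p powr (- ?n) \<le> norm p powr (- ?d)" using p by (intro powr_mono) auto
    then have "norm p powr (- ?n) / ?v \<le> norm p powr (- ?d) / ?v" using v by (intro divide_right_mono) auto
    then show "\<bar>?H p\<bar> \<le> 1 / ?v * norm p powr (- ?d)"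
      using abs_newton_mixed_le[OF norm_e, of k p] by simp
  qed (use v that in auto)
  let ?C1 = "M * (K * R) * 3 powr ?d + 1 / (?n * ?v) * M * 3 powr ?d * ?V"
  let ?C2 = "M * (1 / (?n * ?v) * P) * 3 powr ?d + 1 / ?v * M * 3 powr ?d * ?V"
  have nn: "0 \<le> M * (K * R)" "0 \<le> 1 / (?n * ?v) * M * 3 powr ?d * ?V"
     "0 \<le> M * (1 / (?n * ?v) * P)" "0 \<le> 1 / ?v * M * 3 powr ?d * ?V"
    using M(1) K(1) R(1) P(1) v by auto
  have C: "0 \<le> ?C1" "0 \<le> ?C2"
    by (intro add_nonneg_nonneg mult_nonneg_nonneg[OF nn(1)] mult_nonneg_nonneg[OF nn(3)] nn(2,4) powr_ge_zero)+
  show ?thesis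
  proof (rule that[of "?C1 + ?C2"])
    show "0 \<le> ?C1 + ?C2" using C by linarith
    fix x :: "'m space" assume x: "snd x > 0"
    have "\<bar>layer_potential ?G gT x\<bar> \<le> ?C1 * (1 + norm x) powr (- ?d)"
      by (rule decay_combine[of "layer_potential ?G gT"]) (use nn G_near G_far x in auto)
    also have "\<dots> \<le> (?C1 + ?C2) * (1 + norm x) powr (- ?d)" using C by (intro mult_right_mono) auto
    finally show "\<bar>layer_potential ?G gT x\<bar> \<le> (?C1 + ?C2) * (1 + norm x) powr (- ?d)" .
    have "\<bar>layer_potential ?H gT x\<bar> \<le> ?C2 * (1 + norm x) powr (- ?d)"
      by (rule decay_combine[of "layer_potential ?H gT"]) (use nn H_near H_far x in auto)
    also have "\<dots> \<le> (?C1 + ?C2) * (1 + norm x) powr (- ?d)" using C by (intro mult_right_mono) auto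
    finally show "\<bar>layer_potential ?H gT x\<bar> \<le> (?C1 + ?C2) * (1 + norm x) powr (- ?d)" .
  qed
qed

text \<open>Peetre's inequality: polynomial decay survives a translation at the cost of a polynomial factor in
  the displacement.\<close>

lemma peetre:
  fixes x w :: "'a::real_normed_vector"
  assumes "0 \<le> s"
  shows "(1 + norm (x - w)) powr (- s) \<le> (1 + norm x) powr (- s) * (1 + norm w) powr s"
proof -
  have "norm x \<le> norm (x - w) + norm w" using norm_triangle_sub[of x w] by (simp add: add.commute)
  then have "1 + norm x \<le> 1 + norm (x - w) + norm w + norm (x - w) * norm w"
    using mult_nonneg_nonneg[OF norm_ge_zero[of "x - w"] norm_ge_zero[of w]] by linarith
  then have "1 + norm x \<le> (1 + norm (x - w)) * (1 + norm w)" by (simp add: algebra_simps)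
  then have le: "(1 + norm x) / (1 + norm w) \<le> 1 + norm (x - w)"
    by (simp add: divide_le_eq add_pos_nonneg)
  have "(1 + norm (x - w)) powr (- s) \<le> ((1 + norm x) / (1 + norm w)) powr (- s)"
    using le assms by (intro powr_mono2') (auto intro!: divide_pos_pos add_pos_nonneg)
  also have "\<dots> = (1 + norm x) powr (- s) * (1 + norm w) powr s"
    by (subst powr_divide) (simp_all add: powr_minus_divide)
  finally show ?thesis .
qed

text \<open>By Peetre's inequality, smoothing costs only a moment of the Gaussian, which is bounded for
  \<open>\<tau> \<le> 1\<close>.\<close>

lemma heat_smoothed_decay:
  fixes Q :: "'m::finite space \<Rightarrow> real"
  assumes s: "0 \<le> s" and C: "0 \<le> C" "\<And>x. snd x > 0 \<Longrightarrow> \<bar>layer_potential Q u x\<bar> \<le> C * (1 + norm x) powr (- s)"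
  obtains C' where "0 \<le> C'" "\<And>x \<tau>. snd x > 0 \<Longrightarrow> 0 < \<tau> \<Longrightarrow> \<tau> \<le> 1 \<Longrightarrow>
    \<bar>heat_smoothed Q u x \<tau>\<bar> \<le> C' * (1 + norm x) powr (- s)"
proof -
  obtain K where K: "0 \<le> K" "\<And>w t. 0 < t \<Longrightarrow> t \<le> 1 \<Longrightarrow>
    heat_kernel (w::real^'m) t * (1 + norm w) powr s \<le> K * heat_kernel w (2 * t)"
    using heat_kernel_moment_le[OF s] by blast
  show ?thesis
  proof (rule that[of "C * K"])
    show "0 \<le> C * K" using C K by simp
    fix x :: "'m space" and \<tau> :: real assume x: "snd x > 0" and \<tau>: "0 < \<tau>" "\<tau> \<le> 1"
    let ?X = "(1 + norm x) powr (- s)"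
    have "\<bar>heat_smoothed Q u x \<tau>\<bar> \<le> (LINT w|lborel. C * K * ?X * heat_kernel (w::real^'m) (2 * \<tau>))"
      unfolding heat_smoothed_def
    proof (rule abs_integral_le)
      show "integrable lborel (\<lambda>w::real^'m. C * K * ?X * heat_kernel w (2 * \<tau>))"
        using \<tau> by (intro integrable_mult_right heat_kernel_integrable) simp
      fix w :: "real^'m"
      have "\<bar>layer_potential Q u (x - (w, 0))\<bar> \<le> C * (1 + norm (x - (w, 0))) powr (- s)"
        by (rule C(2)) (simp add: x)
      also have "\<dots> \<le> C * (?X * (1 + norm w) powr s)"
        using peetre[OF s, of x "(w, 0)"] C(1) by (intro mult_left_mono) auto
      finally have "\<bar>heat_kernel w \<tau> * layer_potential Q u (x - (w, 0))\<bar> \<le> heat_kernel w \<tau> * (C * (?X * (1 + norm w) powr s))"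
        by (simp add: abs_mult mult_left_mono)
      also have "\<dots> = C * ?X * (heat_kernel w \<tau> * (1 + norm w) powr s)" by simp
      also have "\<dots> \<le> C * ?X * (K * heat_kernel w (2 * \<tau>))"
        using C(1) by (intro mult_left_mono K(2) \<tau>) auto
      finally show "\<bar>heat_kernel w \<tau> * layer_potential Q u (x - (w, 0))\<bar> \<le> C * K * ?X * heat_kernel w (2 * \<tau>)"
        by (simp add: mult_ac)
    qed
    also have "\<dots> = C * K * ?X" using integral_heat_kernel[of "2 * \<tau>", where 'a="real^'m"] \<tau> by simp
    finally show "\<bar>heat_smoothed Q u x \<tau>\<bar> \<le> C * K * ?X" .
  qed
qed

lemma tangential_profile_positive_ball:
  assumes "tangential_profile gT"
  obtains z0 r where "0 < r" "0 < gT z0" "\<And>z. z \<in> ball z0 r \<Longrightarrow> gT z0 / 2 \<le> gT z" "\<And>z. 0 \<le> gT z"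
proof -
  have c: "continuous_on UNIV gT" by (rule tangential_profile_bounds[OF assms]) blast
  obtain z0 where z0: "gT z0 > 0" and nn: "\<And>z. 0 \<le> gT z"
    using assms unfolding tangential_profile_def by (metis order_le_less)
  have "\<forall>\<^sub>F z in at z0. gT z > gT z0 / 2"
    using c z0 by (intro order_tendstoD) (auto simp: continuous_on_def)
  then obtain r where r: "r > 0" "\<And>z. z \<noteq> z0 \<Longrightarrow> dist z z0 < r \<Longrightarrow> gT z > gT z0 / 2"
    unfolding eventually_at by auto
  show ?thesis
  proof (rule that[OF r(1) z0 _ nn])
    fix z assume "z \<in> ball z0 r"
    then show "gT z0 / 2 \<le> gT z" using r(2)[of z] z0 by (cases "z = z0") (auto simp: dist_commute)
  qed
qed

lemma integral_tangential_pos: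
  assumes "tangential_profile gT"
  shows "0 < (LINT z|lborel. gT z)"
proof -
  have iT: "integrable lborel gT" by (rule tangential_profile_bounds[OF assms]) blast
  obtain z0 r where r: "0 < r" "0 < gT z0" and zr: "\<And>z. z \<in> ball z0 r \<Longrightarrow> gT z0 / 2 \<le> gT z" and nn: "\<And>z. 0 \<le> gT z"
    by (rule tangential_profile_positive_ball[OF assms]) blast
  have "0 < gT z0 / 2 * measure lborel (ball z0 r)" using r content_ball_pos[OF r(1)] by simp
  also have "\<dots> = (LINT z|lborel. gT z0 / 2 * indicator (ball z0 r) z)" by simp
  also have "\<dots> \<le> (LINT z|lborel. gT z)"
  proof (rule integral_mono[OF _ iT])
    show "integrable lborel (\<lambda>z. gT z0 / 2 * indicator (ball z0 r) z)"
      by (intro integrable_mult_right integrable_indicator_ball)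
    show "gT z0 / 2 * indicator (ball z0 r) z \<le> gT z" for z
      using zr[of z] nn[of z] by (auto split: split_indicator)
  qed
  finally show ?thesis .
qed

text \<open>For \<open>x\<close> with large \<open>k\<close>-th coordinate the kernel \<open>newton_grad (e_tan k)\<close> is positive on the
  whole unit ball, which contains the support of the density.\<close>

lemma layer_potential_lower:
  fixes gT :: "real^'m::finite \<Rightarrow> real"
  assumes card: "CARD('m) \<ge> 2" and gT: "tangential_profile gT" and R: "0 \<le> R"
  obtains c where "0 < c" "\<And>x. snd x > 0 \<Longrightarrow> 2 \<le> fst x $ k \<Longrightarrow> norm x \<le> R \<Longrightarrow>
    c \<le> layer_potential (newton_grad (e_tan k)) gT x"
proof -
  let ?n = "real DIM('m space)"
  let ?v = "unit_ball_vol ?n"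
  have v: "?v > 0" by simp
  obtain M where M: "0 \<le> M" "\<And>z. \<bar>gT z\<bar> \<le> M * indicator (ball 0 1) z" and iT: "integrable lborel gT"
    by (rule tangential_profile_bounds[OF gT]) blast
  have [measurable]: "gT \<in> borel_measurable borel" using iT by auto
  have nn: "0 \<le> gT z" for z using gT by (simp add: tangential_profile_def)
  let ?c = "(R + 1) powr (- ?n) / (?n * ?v)"
  have c: "?c > 0" using R v by auto
  show ?thesis
  proof (rule that[of "?c * (LINT z|lborel. gT z)"])
    show "0 < ?c * (LINT z|lborel. gT z)" by (intro mult_pos_pos c integral_tangential_pos gT)
    fix x :: "'m space" assume x: "snd x > 0" "2 \<le> fst x $ k" "norm x \<le> R"
    have tame: "tame_kernel (newton_grad (e_tan k) :: 'm space \<Rightarrow> real)"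
      by (rule tame_newton(2)[OF card norm_e(2) norm_e(2)])
    note [measurable] = tame_kernel_measurable[OF tame]
    obtain C where C: "0 \<le> C" "\<And>p :: 'm space. snd x \<le> norm p \<Longrightarrow> \<bar>newton_grad (e_tan k) p\<bar> \<le> C"
      using tame_kernel_bound[OF tame x(1)] by metis
    have "?c * (LINT z|lborel. gT z) = (LINT z|lborel. ?c * gT z)" by simp
    also have "\<dots> \<le> layer_potential (newton_grad (e_tan k)) gT x"
      unfolding layer_potential_def
    proof (rule integral_mono)
      show "integrable lborel (\<lambda>z. ?c * gT z)" using iT by simp
      show "integrable lborel (\<lambda>z. newton_grad (e_tan k) (x - (z, 0)) * gT z)"
      proof (rule Bochner_Integration.integrable_bound[OF integrable_mult_right[of C, OF iT]])
        have "\<bar>newton_grad (e_tan k) (x - (z, 0))\<bar> \<le> C" for z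
          using C(2) snd_le_norm_diff[of x z] x by auto
        then show "AE z in lborel. norm (newton_grad (e_tan k) (x - (z, 0)) * gT z) \<le> norm (C * gT z)"
          using C(1) by (intro AE_I2) (auto simp: abs_mult intro!: mult_right_mono)
      qed simp
      fix z :: "real^'m"
      show "?c * gT z \<le> newton_grad (e_tan k) (x - (z, 0)) * gT z"
      proof (cases "norm z < 1")
        case True
        have "z $ k \<le> 1" using component_le_norm_cart[of z k] True by simp
        then have 1: "1 \<le> fst x $ k - z $ k" using x(2) by simp
        have "norm (x - (z, 0)) \<le> norm x + norm (z, 0::real)" by (rule norm_triangle_ineq4)
        then have "norm (x - (z, 0)) \<le> R + 1" using x(3) True by simp
        moreover have "0 < norm (x - (z, 0))" using snd_le_norm_diff[of x z] x(1) by linarith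
        ultimately have 2: "(R + 1) powr (- ?n) \<le> norm (x - (z, 0)) powr (- ?n)"
          by (intro powr_mono2') auto
        have "1 * (R + 1) powr (- ?n) \<le> (fst x $ k - z $ k) * norm (x - (z, 0)) powr (- ?n)"
          using 1 2 by (intro mult_mono) auto
        then have "?c \<le> newton_grad (e_tan k) (x - (z, 0))"
          unfolding newton_grad_def inner_e using v by (intro divide_right_mono) auto
        then show ?thesis using nn by (intro mult_right_mono) auto
      next
        case False
        then have "gT z = 0" using M(2)[of z] by simp
        then show ?thesis by simp
      qed
    qed
    finally show "?c * (LINT z|lborel. gT z) \<le> layer_potential (newton_grad (e_tan k)) gT x" .
  qed
qed

lemma exp_neg_inverse_le: "0 < \<tau> \<Longrightarrow> exp (- (1 / (8 * \<tau>))) \<le> 8 * (\<tau>::real)"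
proof -
  assume \<tau>: "0 < \<tau>"
  have "1 / (8 * \<tau>) \<le> exp (1 / (8 * \<tau>))" using exp_ge_add_one_self[of "1 / (8 * \<tau>)"] by linarith
  then have "inverse (exp (1 / (8 * \<tau>))) \<le> inverse (1 / (8 * \<tau>))"
    using \<tau> by (intro le_imp_inverse_le) auto
  then show ?thesis by (simp add: exp_minus)
qed

text \<open>The Gaussian of variance \<open>2 \<tau>\<close> puts only the mass \<open>O(\<tau>)\<close> outside the unit ball. Inside it the
  lower bound for the layer potential applies, outside it the potential is bounded.\<close>

lemma heat_smoothed_lower:
  fixes gT :: "real^'m::finite \<Rightarrow> real"
  assumes card: "CARD('m) \<ge> 2" and gT: "tangential_profile gT" and R: "0 \<le> R"
  obtains c K where "0 < c" "0 \<le> K" "\<And>x \<tau>. snd x > 0 \<Longrightarrow> 3 \<le> fst x $ k \<Longrightarrow> norm x \<le> R \<Longrightarrow> 0 < \<tau> \<Longrightarrow>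
    c - K * \<tau> \<le> heat_smoothed (newton_grad (e_tan k)) gT x \<tau>"
proof -
  let ?L = "layer_potential (newton_grad (e_tan k)) gT"
  let ?D = "2 powr (real CARD('m) / 2)"
  obtain C where C: "0 \<le> C" "\<And>x. snd x > 0 \<Longrightarrow> \<bar>?L x\<bar> \<le> C * (1 + norm x) powr (- real CARD('m))"
    by (rule layer_potential_decay[OF card gT, of k]) blast
  have C1: "\<bar>?L x\<bar> \<le> C" if "snd x > 0" for x
  proof -
    have "(1 + norm x) powr (- real CARD('m)) \<le> 1 powr (- real CARD('m))" by (intro powr_mono2') auto
    then show ?thesis using C(2)[OF that] C(1) mult_left_mono[of "(1 + norm x) powr (- real CARD('m))" 1 C] by simp
  qed
  obtain c where c: "0 < c" "\<And>x. snd x > 0 \<Longrightarrow> 2 \<le> fst x $ k \<Longrightarrow> norm x \<le> R + 1 \<Longrightarrow> c \<le> ?L x"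
    using layer_potential_lower[OF card gT, of "R + 1" k] R by auto
  have [measurable]: "gT \<in> borel_measurable borel"
    using tangential_profile_bounds[OF gT] by (metis borel_measurable_continuous_onI)
  show ?thesis
  proof (rule that[of c "(c + C) * ?D * 8"])
    show "0 < c" "0 \<le> (c + C) * ?D * 8" using c C by auto
    fix x :: "'m space" and \<tau> :: real
    assume x: "snd x > 0" "3 \<le> fst x $ k" "norm x \<le> R" and \<tau>: "0 < \<tau>"
    have i1: "integrable lborel (\<lambda>w::real^'m. heat_kernel w \<tau>)" and i2: "integrable lborel (\<lambda>w::real^'m. heat_kernel w (2 * \<tau>))"
      using \<tau> by (auto intro: heat_kernel_integrable)
    have "c - (c + C) * ?D * 8 * \<tau>
       = (LINT w|lborel. c * heat_kernel (w::real^'m) \<tau> - (c + C) * (?D * (8 * \<tau>)) * heat_kernel w (2 * \<tau>))"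
      using i1 i2 \<tau> by (simp add: integral_heat_kernel)
    also have "\<dots> \<le> heat_smoothed (newton_grad (e_tan k)) gT x \<tau>"
      unfolding heat_smoothed_def
    proof (rule integral_mono)
      show "integrable lborel (\<lambda>w::real^'m. c * heat_kernel w \<tau> - (c + C) * (?D * (8 * \<tau>)) * heat_kernel w (2 * \<tau>))"
        using i1 i2 by simp
      show "integrable lborel (\<lambda>w. heat_kernel w \<tau> * ?L (x - (w, 0)))"
      proof (rule Bochner_Integration.integrable_bound[OF integrable_mult_right[of C, OF i1]])
        show "AE w in lborel. norm (heat_kernel w \<tau> * ?L (x - (w, 0))) \<le> norm (C * heat_kernel w \<tau>)"
        proof (intro AE_I2)
          fix w :: "real^'m"
          have "heat_kernel w \<tau> * \<bar>?L (x - (w, 0))\<bar> \<le> heat_kernel w \<tau> * C"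
            using C1[of "x - (w, 0)"] x(1) by (intro mult_left_mono) auto
          then show "norm (heat_kernel w \<tau> * ?L (x - (w, 0))) \<le> norm (C * heat_kernel w \<tau>)"
            using C(1) by (simp add: abs_mult mult.commute)
        qed
      qed simp
      fix w :: "real^'m"
      show "c * heat_kernel w \<tau> - (c + C) * (?D * (8 * \<tau>)) * heat_kernel w (2 * \<tau>) \<le> heat_kernel w \<tau> * ?L (x - (w, 0))"
      proof (cases "norm w \<le> 1")
        case True
        have "w $ k \<le> 1" using component_le_norm_cart[of w k] True by simp
        moreover have "norm (x - (w, 0)) \<le> norm x + norm (w, 0::real)" by (rule norm_triangle_ineq4)
        ultimately have "c \<le> ?L (x - (w, 0))" using x True by (intro c(2)) auto
        then have "c * heat_kernel w \<tau> \<le> heat_kernel w \<tau> * ?L (x - (w, 0))"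
          by (subst mult.commute) (intro mult_left_mono, auto)
        moreover have "0 \<le> (c + C) * (?D * (8 * \<tau>)) * heat_kernel w (2 * \<tau>)" using c C \<tau> by simp
        ultimately show ?thesis by linarith
      next
        case False
        have "(norm w)\<^sup>2 \<ge> 1" using False by (simp add: one_le_power)
        then have "1 / (8 * \<tau>) \<le> (norm w)\<^sup>2 / (8 * \<tau>)" using \<tau> by (intro divide_right_mono) auto
        then have "exp (- (norm w)\<^sup>2 / (8 * \<tau>)) \<le> exp (- (1 / (8 * \<tau>)))" by simp
        also have "\<dots> \<le> 8 * \<tau>" by (rule exp_neg_inverse_le[OF \<tau>])
        finally have e: "exp (- (norm w)\<^sup>2 / (8 * \<tau>)) \<le> 8 * \<tau>" .
        have "heat_kernel w \<tau> = ?D * exp (- (norm w)\<^sup>2 / (8 * \<tau>)) * heat_kernel w (2 * \<tau>)"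
          using heat_kernel_double[OF \<tau>, of w] by simp
        also have "\<dots> \<le> ?D * (8 * \<tau>) * heat_kernel w (2 * \<tau>)"
          using e by (intro mult_right_mono mult_left_mono) auto
        finally have "(c + C) * heat_kernel w \<tau> \<le> (c + C) * (?D * (8 * \<tau>) * heat_kernel w (2 * \<tau>))"
          using c C by (intro mult_left_mono) auto
        moreover have "- C \<le> ?L (x - (w, 0))" using C1[of "x - (w, 0)"] x(1) by simp
        then have "heat_kernel w \<tau> * (- C) \<le> heat_kernel w \<tau> * ?L (x - (w, 0))" by (intro mult_left_mono) auto
        ultimately show ?thesis by (simp add: algebra_simps)
      qed
    qed
    finally show "c - (c + C) * ?D * 8 * \<tau> \<le> heat_smoothed (newton_grad (e_tan k)) gT x \<tau>" .
  qed
qed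

section \<open>The factors depending on time\<close>

lemma integral_powr_interval:
  fixes c e :: real
  assumes "e > -1" "c \<ge> 0"
  shows "integrable lborel (\<lambda>u. indicator {0<..<c} u * u powr e)"
    and "(LINT u|lborel. indicator {0<..<c} u * u powr e) = c powr (e + 1) / (e + 1)"
  using powr_interval[OF assms] by (auto simp: has_bochner_integral_iff)

text \<open>The natural length is \<open>sqrt \<tau>\<close>: below it the kernel is bounded by its maximum, above it the power is
  bounded by its value there.\<close>

lemma heat_kernel_powr_le:
  fixes \<beta> \<tau> y :: real
  assumes "0 < \<beta>" "0 < \<tau>"
  shows "heat_kernel y \<tau> * (indicator {0<..<2} y * y powr (- \<beta>))
     \<le> (4 * pi * \<tau>) powr (- (1/2)) * (indicator {0<..<sqrt \<tau>} y * y powr (- \<beta>)) + \<tau> powr (- (\<beta> / 2)) * heat_kernel y \<tau>"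
proof -
  have nn: "0 \<le> (4 * pi * \<tau>) powr (- (1/2)) * (indicator {0<..<sqrt \<tau>} y * y powr (- \<beta>))"
    "0 \<le> \<tau> powr (- (\<beta> / 2)) * heat_kernel y \<tau>" by auto
  consider "y \<le> 0" | "0 < y" "y < sqrt \<tau>" | "0 < y" "sqrt \<tau> \<le> y" by linarith
  then show ?thesis
  proof cases
    case 1
    then show ?thesis using nn by simp
  next
    case 2
    have "heat_kernel y \<tau> * (indicator {0<..<2} y * y powr (- \<beta>)) \<le> (4 * pi * \<tau>) powr (- (1/2)) * (1 * y powr (- \<beta>))"
      using heat_kernel_real_le[OF assms(2)] by (intro mult_mono mult_right_mono) (auto split: split_indicator)
    moreover have "indicator {0<..<sqrt \<tau>} y = (1::real)" using 2 by simp
    ultimately have "heat_kernel y \<tau> * (indicator {0<..<2} y * y powr (- \<beta>))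
        \<le> (4 * pi * \<tau>) powr (- (1/2)) * (indicator {0<..<sqrt \<tau>} y * y powr (- \<beta>))" by (simp only:)
    then show ?thesis using nn(2) by linarith
  next
    case 3
    have "y powr (- \<beta>) \<le> sqrt \<tau> powr (- \<beta>)" using 3 assms by (intro powr_mono2') auto
    also have "sqrt \<tau> = \<tau> powr (1/2)" using assms by (simp add: powr_half_sqrt)
    also have "(\<tau> powr (1/2)) powr (- \<beta>) = \<tau> powr (- (\<beta> / 2))" by (simp add: powr_powr)
    finally have "indicator {0<..<2} y * y powr (- \<beta>) \<le> 1 * \<tau> powr (- (\<beta> / 2))"
      by (intro mult_mono) (auto split: split_indicator)
    then have "heat_kernel y \<tau> * (indicator {0<..<2} y * y powr (- \<beta>)) \<le> heat_kernel y \<tau> * \<tau> powr (- (\<beta> / 2))"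
      by (intro mult_left_mono) auto
    also have "\<dots> = \<tau> powr (- (\<beta> / 2)) * heat_kernel y \<tau>" by (rule mult.commute)
    finally show ?thesis using nn(1) by linarith
  qed
qed

lemma heat_powr_integral_le:
  fixes \<beta> :: real
  assumes \<beta>: "0 < \<beta>" "\<beta> < 1"
  obtains C where "0 \<le> C" "\<And>\<tau>. 0 < \<tau> \<Longrightarrow> integrable lborel (\<lambda>y. heat_kernel y \<tau> * (indicator {0<..<2} y * y powr (- \<beta>)))"
    "\<And>\<tau>. 0 < \<tau> \<Longrightarrow> (LINT y|lborel. heat_kernel y \<tau> * (indicator {0<..<2} y * y powr (- \<beta>))) \<le> C * \<tau> powr (- (\<beta> / 2))"
proof -
  define C where "C = (4 * pi) powr (- (1/2)) * (1 / (1 - \<beta>)) + 1"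
  show ?thesis
  proof (rule that[of C])
    show "0 \<le> C" using \<beta> by (simp add: C_def)
    fix \<tau> :: real assume \<tau>: "0 < \<tau>"
    let ?f = "\<lambda>y. heat_kernel y \<tau> * (indicator {0<..<2} y * y powr (- \<beta>))"
    let ?g = "\<lambda>y. (4 * pi * \<tau>) powr (- (1/2)) * (indicator {0<..<sqrt \<tau>} y * y powr (- \<beta>)) + \<tau> powr (- (\<beta> / 2)) * heat_kernel y \<tau>"
    have e: "- \<beta> > -1" "0 \<le> sqrt \<tau>" using \<beta> \<tau> by auto
    have ig: "integrable lborel ?g"
      using integral_powr_interval(1)[OF e] heat_kernel_integrable[OF \<tau>, where 'a=real] by auto
    show ifn: "integrable lborel ?f"
    proof (rule Bochner_Integration.integrable_bound[OF ig])
      show "AE y in lborel. norm (?f y) \<le> norm (?g y)"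
        using heat_kernel_powr_le[OF \<beta>(1) \<tau>] by (intro AE_I2) (smt (verit) heat_kernel_nonneg indicator_pos_le mult_nonneg_nonneg powr_ge_zero real_norm_def)
    qed simp
    have "(LINT y|lborel. ?f y) \<le> (LINT y|lborel. ?g y)"
      using heat_kernel_powr_le[OF \<beta>(1) \<tau>] by (intro integral_mono ifn ig) auto
    also have "\<dots> = (4 * pi * \<tau>) powr (- (1/2)) * (sqrt \<tau> powr (- \<beta> + 1) / (- \<beta> + 1)) + \<tau> powr (- (\<beta> / 2))"
      using integral_powr_interval[OF e] heat_kernel_integrable[OF \<tau>, where 'a=real] integral_heat_kernel[OF \<tau>, where 'a=real]
      by (subst Bochner_Integration.integral_add) auto
    also have "sqrt \<tau> powr (- \<beta> + 1) = \<tau> powr ((1 - \<beta>) / 2)"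
      using \<tau> by (simp add: powr_powr flip: powr_half_sqrt)
    also have "(4 * pi * \<tau>) powr (- (1/2)) = (4 * pi) powr (- (1/2)) * \<tau> powr (- (1/2))"
      using \<tau> by (simp add: powr_mult)
    also have "(4 * pi) powr (- (1/2)) * \<tau> powr (- (1/2)) * (\<tau> powr ((1 - \<beta>) / 2) / (- \<beta> + 1)) + \<tau> powr (- (\<beta> / 2))
       = (4 * pi) powr (- (1/2)) * (1 / (1 - \<beta>)) * (\<tau> powr (- (1/2)) * \<tau> powr ((1 - \<beta>) / 2)) + \<tau> powr (- (\<beta> / 2))"
      by simp
    also have "\<tau> powr (- (1/2)) * \<tau> powr ((1 - \<beta>) / 2) = \<tau> powr (- (\<beta> / 2))"
      by (simp add: diff_divide_distrib flip: powr_add)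
    finally show "(LINT y|lborel. ?f y) \<le> C * \<tau> powr (- (\<beta> / 2))" by (simp add: C_def algebra_simps)
  qed
qed

text \<open>The weight \<open>y / sqrt \<tau>\<close> is absorbed by half of the Gaussian.\<close>

lemma weighted_heat_kernel_le:
  fixes y \<tau> :: real
  assumes "0 < \<tau>" "0 \<le> y"
  shows "y / (2 * \<tau>) * heat_kernel y \<tau> \<le> 2 * \<tau> powr (- (1/2)) * heat_kernel y (2 * \<tau>)"
proof -
  define q where "q = sqrt (8 * \<tau>)"
  have q: "q > 0" "q\<^sup>2 = 8 * \<tau>" using assms by (auto simp: q_def)
  \<comment> \<open>With \<open>s = y / q\<close> this is the chain \<open>s \<le> 1 + s\<^sup>2 \<le> exp (s\<^sup>2)\<close>.\<close>
  have "0 \<le> (y / q - 1 / 2)\<^sup>2" by simp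
  then have "y / q \<le> 1 + (y / q)\<^sup>2" by (simp add: power2_eq_square algebra_simps)
  also have "\<dots> \<le> exp ((y / q)\<^sup>2)" by (rule exp_ge_add_one_self)
  also have "(y / q)\<^sup>2 = y\<^sup>2 / (8 * \<tau>)" by (simp add: power_divide q)
  finally have "y / q * exp (- (y\<^sup>2 / (8 * \<tau>))) \<le> exp (y\<^sup>2 / (8 * \<tau>)) * exp (- (y\<^sup>2 / (8 * \<tau>)))"
    by (intro mult_right_mono) auto
  then have "y / q * exp (- (y\<^sup>2 / (8 * \<tau>))) \<le> 1" by (simp flip: exp_add)
  then have "y * exp (- (y\<^sup>2 / (8 * \<tau>))) \<le> q" using q by (simp add: divide_le_eq)
  then have "y * exp (- (y\<^sup>2 / (8 * \<tau>))) * (sqrt 2 / (2 * \<tau>)) \<le> q * (sqrt 2 / (2 * \<tau>))"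
    using assms by (intro mult_right_mono) auto
  also have "q * (sqrt 2 / (2 * \<tau>)) = 2 * \<tau> powr (- (1/2))"
  proof -
    define r where "r = sqrt \<tau>"
    have r: "r > 0" "\<tau> = r * r" using assms by (auto simp: r_def)
    have "q * sqrt 2 = 4 * r" by (simp add: q_def r_def flip: real_sqrt_mult) (simp add: real_sqrt_mult)
    then have "q * (sqrt 2 / (2 * \<tau>)) = 4 * r / (2 * \<tau>)" by simp
    also have "\<dots> = 2 * (1 / r)" using r by (simp add: field_simps)
    also have "1 / r = \<tau> powr (- (1/2))" using assms by (simp add: r_def powr_minus powr_half_sqrt inverse_eq_divide)
    finally show ?thesis .
  qed
  finally have le: "y * exp (- (y\<^sup>2 / (8 * \<tau>))) * (sqrt 2 / (2 * \<tau>)) \<le> 2 * \<tau> powr (- (1/2))" .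
  have "y / (2 * \<tau>) * heat_kernel y \<tau> = y * exp (- (y\<^sup>2 / (8 * \<tau>))) * (sqrt 2 / (2 * \<tau>)) * heat_kernel y (2 * \<tau>)"
    using heat_kernel_double[OF assms(1), of y] by (simp add: powr_half_sqrt)
  also have "\<dots> \<le> 2 * \<tau> powr (- (1/2)) * heat_kernel y (2 * \<tau>)" by (intro mult_right_mono le) simp
  finally show ?thesis .
qed

text \<open>Scaling: both powers of \<open>y\<close> are effectively evaluated at the length \<open>sqrt \<tau>\<close>, where the weight
  \<open>y / (2 * \<tau>)\<close> has the size \<open>\<tau> powr (- 1/2)\<close>.\<close>

lemma heat_moment_upper:
  assumes gN: "normal_profile \<beta> gN" "0 < \<beta>" "\<beta> < 1"
  obtains C where "0 \<le> C" "\<And>\<tau>. 0 < \<tau> \<Longrightarrow> \<bar>heat_moment0 gN \<tau>\<bar> \<le> C * \<tau> powr (- (\<beta> / 2))"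
    "\<And>\<tau>. 0 < \<tau> \<Longrightarrow> \<bar>heat_moment1 gN \<tau>\<bar> \<le> C * \<tau> powr (- ((1 + \<beta>) / 2))"
proof -
  obtain M where M: "0 \<le> M" "\<And>y. \<bar>normal_deriv gN y\<bar> \<le> M * (indicator {0<..<2} y * y powr (- \<beta>))"
    by (rule normal_profile_facts[OF gN]) blast
  obtain C where C: "0 \<le> C" "\<And>\<tau>. 0 < \<tau> \<Longrightarrow> integrable lborel (\<lambda>y. heat_kernel y \<tau> * (indicator {0<..<2} y * y powr (- \<beta>)))"
    "\<And>\<tau>. 0 < \<tau> \<Longrightarrow> (LINT y|lborel. heat_kernel y \<tau> * (indicator {0<..<2} y * y powr (- \<beta>))) \<le> C * \<tau> powr (- (\<beta> / 2))"
    by (rule heat_powr_integral_le[OF gN(2,3)]) blast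
  show ?thesis
  proof (rule that[of "2 * M * C"])
    show "0 \<le> 2 * M * C" using M C by simp
    fix \<tau> :: real assume \<tau>: "0 < \<tau>"
    have "\<bar>heat_moment0 gN \<tau>\<bar> \<le> (LINT y|lborel. M * (heat_kernel y \<tau> * (indicator {0<..<2} y * y powr (- \<beta>))))"
      unfolding heat_moment0_def
    proof (rule abs_integral_le)
      fix y :: real
      have "heat_kernel y \<tau> * \<bar>normal_deriv gN y\<bar> \<le> heat_kernel y \<tau> * (M * (indicator {0<..<2} y * y powr (- \<beta>)))"
        by (intro mult_left_mono M) simp
      then show "\<bar>heat_kernel y \<tau> * normal_deriv gN y\<bar> \<le> M * (heat_kernel y \<tau> * (indicator {0<..<2} y * y powr (- \<beta>)))"
        by (simp add: abs_mult mult_ac)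
    qed (intro integrable_mult_right C \<tau>)
    also have "\<dots> \<le> M * (C * \<tau> powr (- (\<beta> / 2)))"
      using C(3)[OF \<tau>] M(1) by (simp add: mult_left_mono)
    also have "\<dots> \<le> 2 * M * C * \<tau> powr (- (\<beta> / 2))" using M C by simp
    finally show "\<bar>heat_moment0 gN \<tau>\<bar> \<le> 2 * M * C * \<tau> powr (- (\<beta> / 2))" .
    let ?K = "2 * \<tau> powr (- (1/2)) * M"
    have "\<bar>heat_moment1 gN \<tau>\<bar> \<le> (LINT y|lborel. ?K * (heat_kernel y (2 * \<tau>) * (indicator {0<..<2} y * y powr (- \<beta>))))"
      unfolding heat_moment1_def
    proof (rule abs_integral_le)
      fix y :: real
      show "\<bar>y / (2 * \<tau>) * heat_kernel y \<tau> * normal_deriv gN y\<bar> \<le> ?K * (heat_kernel y (2 * \<tau>) * (indicator {0<..<2} y * y powr (- \<beta>)))"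
      proof (cases "0 < y")
        case True
        have "y / (2 * \<tau>) * heat_kernel y \<tau> * \<bar>normal_deriv gN y\<bar>
          \<le> 2 * \<tau> powr (- (1/2)) * heat_kernel y (2 * \<tau>) * (M * (indicator {0<..<2} y * y powr (- \<beta>)))"
          using True by (intro mult_mono weighted_heat_kernel_le M \<tau>) auto
        then show ?thesis using True \<tau> by (simp add: abs_mult mult_ac)
      next
        case False
        then show ?thesis using M(2)[of y] by simp
      qed
    qed (use C(2)[of "2 * \<tau>"] \<tau> in auto)
    also have "\<dots> \<le> ?K * (C * (2 * \<tau>) powr (- (\<beta> / 2)))"
      using C(3)[of "2 * \<tau>"] M(1) \<tau> by (simp add: mult_left_mono)
    also have "\<dots> \<le> ?K * (C * \<tau> powr (- (\<beta> / 2)))"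
      using M C \<tau> gN by (intro mult_left_mono powr_mono2') auto
    also have "\<dots> = 2 * M * C * (\<tau> powr (- (1/2)) * \<tau> powr (- (\<beta> / 2)))" by simp
    also have "\<tau> powr (- (1/2)) * \<tau> powr (- (\<beta> / 2)) = \<tau> powr (- ((1 + \<beta>) / 2))"
      by (simp add: add_divide_distrib diff_divide_distrib flip: powr_add)
    finally show "\<bar>heat_moment1 gN \<tau>\<bar> \<le> 2 * M * C * \<tau> powr (- ((1 + \<beta>) / 2))" .
  qed
qed

text \<open>On \<open>{0<..<1}\<close> the integrand is positive, and on the interval from \<open>sqrt \<tau> / 2\<close> to \<open>sqrt \<tau>\<close> alone it already
  has an integral of the full order. The unknown sign on \<open>{1..2}\<close> costs only a constant, since the heat
  kernel is exponentially small there.\<close>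

lemma heat_moment1_lower:
  assumes gN: "normal_profile \<beta> gN" "0 < \<beta>" "\<beta> < 1"
  obtains c K where "0 < c" "0 \<le> K" "\<And>\<tau>. 0 < \<tau> \<Longrightarrow> \<tau> < 1 \<Longrightarrow> c * \<tau> powr (- ((1 + \<beta>) / 2)) - K \<le> heat_moment1 gN \<tau>"
proof -
  obtain M where M: "0 \<le> M" "\<And>y. \<bar>normal_deriv gN y\<bar> \<le> M * (indicator {0<..<2} y * y powr (- \<beta>))"
    "\<And>y. 0 < y \<Longrightarrow> y < 1 \<Longrightarrow> normal_deriv gN y = (1 - \<beta>) * y powr (- \<beta>)"
    by (rule normal_profile_facts[OF gN]) blast
  define c where "c = (4 * pi) powr (- (1/2)) * exp (- (1/4)) * (1 - \<beta>) / 8"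
  define K where "K = 16 * (8 * pi) powr (- (1/2)) * M"
  show ?thesis
  proof (rule that[of c K])
    show "0 < c" using gN by (simp add: c_def)
    show "0 \<le> K" using M by (simp add: K_def)
    fix \<tau> :: real assume \<tau>: "0 < \<tau>" "\<tau> < 1"
    define r where "r = sqrt \<tau>"
    have r: "0 < r" "r < 1" "r * r = \<tau>" using \<tau> by (auto simp: r_def)
    define h where "h = (4 * pi * \<tau>) powr (- (1/2)) * exp (- (1/4))"
    define L where "L = 1 / (4 * r) * h * ((1 - \<beta>) * r powr (- \<beta>))"
    have L: "L * (r / 2) = c * \<tau> powr (- ((1 + \<beta>) / 2))"
    proof -
      have "L * (r / 2) = (4 * pi * \<tau>) powr (- (1/2)) * exp (- (1/4)) * (1 - \<beta>) / 8 * r powr (- \<beta>)"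
        using r by (simp add: L_def h_def)
      also have "(4 * pi * \<tau>) powr (- (1/2)) = (4 * pi) powr (- (1/2)) * \<tau> powr (- (1/2))" using \<tau> by (simp add: powr_mult)
      also have "r powr (- \<beta>) = \<tau> powr (- (\<beta> / 2))"
        using \<tau> by (simp add: r_def powr_powr flip: powr_half_sqrt)
      finally have "L * (r / 2) = c * (\<tau> powr (- (1/2)) * \<tau> powr (- (\<beta> / 2)))" by (simp add: c_def)
      also have "\<tau> powr (- (1/2)) * \<tau> powr (- (\<beta> / 2)) = \<tau> powr (- ((1 + \<beta>) / 2))"
        by (simp add: add_divide_distrib diff_divide_distrib flip: powr_add)
      finally show ?thesis .
    qed
    have L0: "0 \<le> L" using r gN by (simp add: L_def h_def)
    have i1: "integrable lborel (\<lambda>y. L * indicator {r / 2<..<r} y)" "integrable lborel (\<lambda>y::real. K * indicator {1..2} y)"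
      using r by (auto intro!: integrable_mult_right integrable_real_indicator)
    have "c * \<tau> powr (- ((1 + \<beta>) / 2)) - K
        = (LINT y|lborel. L * indicator {r / 2<..<r} y - K * indicator {1..2} y)"
      using i1 r L by simp
    also have "\<dots> \<le> heat_moment1 gN \<tau>"
      unfolding heat_moment1_def
    proof (rule integral_mono)
      show "integrable lborel (\<lambda>y. L * indicator {r / 2<..<r} y - K * indicator {1..2} y)" using i1 by auto
      show "integrable lborel (\<lambda>y. y / (2 * \<tau>) * heat_kernel y \<tau> * normal_deriv gN y)"
        by (rule heat_moment_integrable(2)[OF gN \<tau>(1)])
      fix y :: real
      show "L * indicator {r / 2<..<r} y - K * indicator {1..2} y \<le> y / (2 * \<tau>) * heat_kernel y \<tau> * normal_deriv gN y"
      proof -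
        consider "y \<le> 0 \<or> 2 < y" | "0 < y" "y < 1" | "1 \<le> y" "y \<le> 2" by linarith
        then show ?thesis
        proof cases
          case 1
          then have "normal_deriv gN y = 0" using M(2)[of y] by auto
          moreover have "indicator {r / 2<..<r} y = (0::real)" using 1 r by (auto split: split_indicator)
          ultimately show ?thesis using \<open>0 \<le> K\<close> by (simp split: split_indicator)
        next
          case 2
          have nn: "0 \<le> y / (2 * \<tau>) * heat_kernel y \<tau> * normal_deriv gN y"
            unfolding M(3)[OF 2] using 2 \<tau> gN by simp
          show ?thesis
          proof (cases "y \<in> {r / 2<..<r}")
            case True
            have "1 / (4 * r) = (r / 2) / (2 * \<tau>)" using r(1) by (simp add: r(3)[symmetric])
            also have "\<dots> \<le> y / (2 * \<tau>)" using True \<tau> by (intro divide_right_mono) auto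
            finally have a: "1 / (4 * r) \<le> y / (2 * \<tau>)" .
            have "y\<^sup>2 \<le> r\<^sup>2" using True r by (intro power_mono) auto
            then have "y\<^sup>2 / (4 * \<tau>) \<le> \<tau> / (4 * \<tau>)" using r \<tau> by (intro divide_right_mono) (auto simp: power2_eq_square)
            also have "\<dots> = 1 / 4" using \<tau> by simp
            finally have "y\<^sup>2 / (4 * \<tau>) \<le> 1 / 4" .
            then have b: "h \<le> heat_kernel y \<tau>" unfolding h_def heat_kernel_def by (intro mult_mono) auto
            have "r powr (- \<beta>) \<le> y powr (- \<beta>)" using True r gN by (intro powr_mono2') auto
            then have d: "(1 - \<beta>) * r powr (- \<beta>) \<le> normal_deriv gN y"
              unfolding M(3)[OF 2] using gN by (intro mult_left_mono) auto
            have "L \<le> y / (2 * \<tau>) * heat_kernel y \<tau> * normal_deriv gN y"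
              unfolding L_def using a b d r 2 \<tau> gN by (intro mult_mono) (auto simp: h_def)
            then show ?thesis using True 2 by simp
          next
            case False
            then show ?thesis using nn 2 by simp
          qed
        next
          case 3
          have "1 / (8 * \<tau>) \<le> y\<^sup>2 / (8 * \<tau>)" using 3 \<tau> by (intro divide_right_mono) auto
          then have "exp (- (y\<^sup>2 / (8 * \<tau>))) \<le> exp (- (1 / (8 * \<tau>)))" by simp
          also have "\<dots> \<le> 8 * \<tau>" by (rule exp_neg_inverse_le[OF \<tau>(1)])
          finally have e: "exp (- (y\<^sup>2 / (8 * \<tau>))) \<le> 8 * \<tau>" .
          have "heat_kernel y (2 * \<tau>) = (8 * pi * \<tau>) powr (- (1/2)) * exp (- (y\<^sup>2 / (8 * \<tau>)))"
            by (simp add: heat_kernel_def mult_ac)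
          also have "\<dots> \<le> (8 * pi * \<tau>) powr (- (1/2)) * (8 * \<tau>)" using e by (intro mult_left_mono) auto
          finally have hk: "heat_kernel y (2 * \<tau>) \<le> (8 * pi * \<tau>) powr (- (1/2)) * (8 * \<tau>)" .
          have "y / (2 * \<tau>) * heat_kernel y \<tau> \<le> 2 * \<tau> powr (- (1/2)) * heat_kernel y (2 * \<tau>)"
            using 3 \<tau> by (intro weighted_heat_kernel_le) auto
          also have "\<dots> \<le> 2 * \<tau> powr (- (1/2)) * ((8 * pi * \<tau>) powr (- (1/2)) * (8 * \<tau>))"
            using hk by (intro mult_left_mono) auto
          also have "\<dots> = 16 * (8 * pi) powr (- (1/2)) * (\<tau> powr (- (1/2)) * \<tau> powr (- (1/2)) * \<tau>)"
            using \<tau> by (simp add: powr_mult mult_ac)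
          also have "\<tau> powr (- (1/2)) * \<tau> powr (- (1/2)) * \<tau> = 1"
            using \<tau> by (simp add: powr_minus_divide flip: powr_add)
          finally have w: "y / (2 * \<tau>) * heat_kernel y \<tau> \<le> 16 * (8 * pi) powr (- (1/2))" by simp
          have "indicator {0<..<2} y * y powr (- \<beta>) \<le> 1 * 1 powr (- \<beta>)"
            using 3 gN by (intro mult_mono powr_mono2') (auto split: split_indicator)
          then have g: "\<bar>normal_deriv gN y\<bar> \<le> M"
            using M(2)[of y] mult_left_mono[of "indicator {0<..<2} y * y powr (- \<beta>)" 1 M] M(1) by simp
          have "(y / (2 * \<tau>) * heat_kernel y \<tau>) * \<bar>normal_deriv gN y\<bar> \<le> 16 * (8 * pi) powr (- (1/2)) * M"
            using 3 \<tau> by (intro mult_mono[OF w g]) auto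
          then have "\<bar>y / (2 * \<tau>) * heat_kernel y \<tau> * normal_deriv gN y\<bar> \<le> K"
            using 3 \<tau> by (simp add: abs_mult K_def)
          then have "- K \<le> y / (2 * \<tau>) * heat_kernel y \<tau> * normal_deriv gN y" by linarith
          moreover have "indicator {r / 2<..<r} y = (0::real)" "indicator {1..2} y = (1::real)" using 3 r by auto
          ultimately show ?thesis by simp
        qed
      qed
    qed
    finally show "c * \<tau> powr (- ((1 + \<beta>) / 2)) - K \<le> heat_moment1 gN \<tau>" .
  qed
qed

text \<open>The Beta integral, up to constants.\<close>

lemma time_convolution:
  fixes \<alpha> \<gamma> :: real
  assumes \<alpha>: "0 < \<alpha>" "\<alpha> < 1" and \<gamma>: "0 < \<gamma>" "\<gamma> < 1" and t: "1/2 < t"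
  shows "integrable lborel (\<lambda>s. indicator {1/2<..<t} s * ((s - 1/2) powr (- \<alpha>) * (t - s) powr (- \<gamma>)))"
    and "(LINT s|lborel. indicator {1/2<..<t} s * ((s - 1/2) powr (- \<alpha>) * (t - s) powr (- \<gamma>)))
      \<le> (2 powr \<alpha> / (1 - \<gamma>) + 2 powr \<gamma> / (1 - \<alpha>)) * (t - 1/2) powr (1 - \<alpha> - \<gamma>)"
proof -
  define T where "T = t - 1/2"
  have T: "T > 0" using t by (simp add: T_def)
  let ?f = "\<lambda>s. indicator {1/2<..<t} s * ((s - 1/2) powr (- \<alpha>) * (t - s) powr (- \<gamma>))"
  let ?p = "\<lambda>e u. indicator {0<..<T} u * u powr (- e) :: real"
  let ?g = "\<lambda>s. (T / 2) powr (- \<alpha>) * ?p \<gamma> (t + (-1) * s) + (T / 2) powr (- \<gamma>) * ?p \<alpha> (- (1/2) + 1 * s)"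
  have p: "integrable lborel (?p e)" "(LINT u|lborel. ?p e u) = T powr (1 - e) / (1 - e)" if "e < 1" for e
    using integral_powr_interval[of "- e" T] that T by auto
  have i1: "integrable lborel (\<lambda>s. ?p \<gamma> (t + (-1) * s))" by (rule lborel_integrable_real_affine[OF p(1)[OF \<gamma>(2)]]) simp
  have i2: "integrable lborel (\<lambda>s. ?p \<alpha> (- (1/2) + 1 * s))" by (rule lborel_integrable_real_affine[OF p(1)[OF \<alpha>(2)]]) simp
  have I1: "(LINT s|lborel. ?p \<gamma> (t + (-1) * s)) = T powr (1 - \<gamma>) / (1 - \<gamma>)"
    using lborel_integral_real_affine[of "-1" "?p \<gamma>" t] p(2)[OF \<gamma>(2)] by simp
  have I2: "(LINT s|lborel. ?p \<alpha> (- (1/2) + 1 * s)) = T powr (1 - \<alpha>) / (1 - \<alpha>)"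
    using lborel_integral_real_affine[of 1 "?p \<alpha>" "- (1/2)"] p(2)[OF \<alpha>(2)] by simp
  have ig: "integrable lborel ?g" by (intro Bochner_Integration.integrable_add integrable_mult_right i1 i2)
  have le: "?f s \<le> ?g s" for s
  proof (cases "s \<in> {1/2<..<t}")
    case True
    have ind: "t + (-1) * s \<in> {0<..<T}" "- (1/2) + 1 * s \<in> {0<..<T}" using True by (auto simp: T_def)
    \<comment> \<open>One of the two distances \<open>s - 1/2\<close> and \<open>t - s\<close> is at least \<open>T / 2\<close>; the corresponding factor is bounded by its value there.\<close>
    show ?thesis
    proof (cases "T / 2 \<le> s - 1/2")
      case True
      have "(s - 1/2) powr (- \<alpha>) \<le> (T / 2) powr (- \<alpha>)" using True T \<alpha> by (intro powr_mono2') auto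
      then have "(s - 1/2) powr (- \<alpha>) * (t - s) powr (- \<gamma>) \<le> (T / 2) powr (- \<alpha>) * (t - s) powr (- \<gamma>)"
        by (intro mult_right_mono) auto
      also have "\<dots> \<le> (T / 2) powr (- \<alpha>) * (t - s) powr (- \<gamma>) + (T / 2) powr (- \<gamma>) * (s - 1/2) powr (- \<alpha>)" by simp
      finally show ?thesis using ind \<open>s \<in> {1/2<..<t}\<close> by (simp add: algebra_simps)
    next
      case False
      then have "T / 2 \<le> t - s" by (simp add: T_def field_simps)
      then have "(t - s) powr (- \<gamma>) \<le> (T / 2) powr (- \<gamma>)" using T \<gamma> by (intro powr_mono2') auto
      then have "(s - 1/2) powr (- \<alpha>) * (t - s) powr (- \<gamma>) \<le> (s - 1/2) powr (- \<alpha>) * (T / 2) powr (- \<gamma>)"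
        by (intro mult_left_mono) auto
      also have "\<dots> \<le> (T / 2) powr (- \<alpha>) * (t - s) powr (- \<gamma>) + (T / 2) powr (- \<gamma>) * (s - 1/2) powr (- \<alpha>)" by simp
      finally show ?thesis using ind \<open>s \<in> {1/2<..<t}\<close> by (simp add: algebra_simps)
    qed
  qed simp
  show ifn: "integrable lborel ?f"
  proof (rule Bochner_Integration.integrable_bound[OF ig])
    show "AE s in lborel. norm (?f s) \<le> norm (?g s)"
    proof (intro AE_I2)
      fix s :: real
      have "0 \<le> ?f s" by simp
      then show "norm (?f s) \<le> norm (?g s)" using le[of s] by (simp only: real_norm_def abs_of_nonneg)
    qed
  qed simp
  have "(LINT s|lborel. ?f s) \<le> (LINT s|lborel. ?g s)" by (intro integral_mono ifn ig le)
  also have "\<dots> = (T / 2) powr (- \<alpha>) * (T powr (1 - \<gamma>) / (1 - \<gamma>)) + (T / 2) powr (- \<gamma>) * (T powr (1 - \<alpha>) / (1 - \<alpha>))"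
    unfolding I1[symmetric] I2[symmetric]
    by (subst Bochner_Integration.integral_add) (auto intro!: integrable_mult_right i1[simplified] i2[simplified])
  also have "(T / 2) powr (- \<alpha>) = 2 powr \<alpha> * T powr (- \<alpha>)"
    using T by (subst powr_divide) (simp_all add: powr_minus_divide)
  also have "(T / 2) powr (- \<gamma>) = 2 powr \<gamma> * T powr (- \<gamma>)"
    using T by (subst powr_divide) (simp_all add: powr_minus_divide)
  also have "2 powr \<alpha> * T powr (- \<alpha>) * (T powr (1 - \<gamma>) / (1 - \<gamma>)) + 2 powr \<gamma> * T powr (- \<gamma>) * (T powr (1 - \<alpha>) / (1 - \<alpha>))
     = 2 powr \<alpha> / (1 - \<gamma>) * (T powr (- \<alpha>) * T powr (1 - \<gamma>)) + 2 powr \<gamma> / (1 - \<alpha>) * (T powr (- \<gamma>) * T powr (1 - \<alpha>))" by simp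
  also have "T powr (- \<alpha>) * T powr (1 - \<gamma>) = T powr (1 - \<alpha> - \<gamma>)"
    unfolding powr_add[symmetric] by (simp add: algebra_simps)
  also have "T powr (- \<gamma>) * T powr (1 - \<alpha>) = T powr (1 - \<alpha> - \<gamma>)"
    unfolding powr_add[symmetric] by (simp add: algebra_simps)
  finally show "(LINT s|lborel. ?f s) \<le> (2 powr \<alpha> / (1 - \<gamma>) + 2 powr \<gamma> / (1 - \<alpha>)) * (t - 1/2) powr (1 - \<alpha> - \<gamma>)"
    unfolding T_def by (simp only: distrib_right)
qed

section \<open>Pointwise upper bound and mixed norms\<close>

lemma pressure_density_upper:
  fixes gT :: "real^'m::finite \<Rightarrow> real"
  assumes card: "CARD('m) \<ge> 2" and gT: "tangential_profile gT" and gN: "normal_profile \<beta> gN" "0 < \<beta>" "\<beta> < 1"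
  obtains C where "0 \<le> C" "\<And>x \<tau>. snd x > 0 \<Longrightarrow> 0 < \<tau> \<Longrightarrow> \<tau> \<le> 1 \<Longrightarrow>
    \<bar>pressure_density k gT gN x \<tau>\<bar> \<le> C * (1 + norm x) powr (- real CARD('m)) * \<tau> powr (- ((1 + \<beta>) / 2))"
proof -
  let ?d = "real CARD('m)"
  obtain C0 where C0: "0 \<le> C0"
    "\<And>x. snd x > 0 \<Longrightarrow> \<bar>layer_potential (newton_grad (e_tan k)) gT x\<bar> \<le> C0 * (1 + norm x) powr (- ?d)"
    "\<And>x. snd x > 0 \<Longrightarrow> \<bar>layer_potential (newton_mixed e_n (e_tan k)) gT x\<bar> \<le> C0 * (1 + norm x) powr (- ?d)"
    by (rule layer_potential_decay[OF card gT, of k]) blast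
  have d0: "0 \<le> ?d" by simp
  obtain C1 where C1: "0 \<le> C1" "\<And>x \<tau>. snd x > 0 \<Longrightarrow> 0 < \<tau> \<Longrightarrow> \<tau> \<le> 1 \<Longrightarrow>
      \<bar>heat_smoothed (newton_grad (e_tan k)) gT x \<tau>\<bar> \<le> C1 * (1 + norm x) powr (- ?d)"
    by (rule heat_smoothed_decay[OF d0 C0(1,2)]) (assumption, blast)
  obtain C2 where C2: "0 \<le> C2" "\<And>x \<tau>. snd x > 0 \<Longrightarrow> 0 < \<tau> \<Longrightarrow> \<tau> \<le> 1 \<Longrightarrow>
      \<bar>heat_smoothed (newton_mixed e_n (e_tan k)) gT x \<tau>\<bar> \<le> C2 * (1 + norm x) powr (- ?d)"
    by (rule heat_smoothed_decay[OF d0 C0(1,3)]) (assumption, blast)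
  obtain B where B: "0 \<le> B" "\<And>\<tau>. 0 < \<tau> \<Longrightarrow> \<bar>heat_moment0 gN \<tau>\<bar> \<le> B * \<tau> powr (- (\<beta> / 2))"
    "\<And>\<tau>. 0 < \<tau> \<Longrightarrow> \<bar>heat_moment1 gN \<tau>\<bar> \<le> B * \<tau> powr (- ((1 + \<beta>) / 2))"
    by (rule heat_moment_upper[OF gN]) blast
  show ?thesis
  proof (rule that[of "B * C2 + B * C1"])
    show "0 \<le> B * C2 + B * C1" using B C1 C2 by simp
    fix x :: "'m space" and \<tau> :: real assume x: "snd x > 0" and \<tau>: "0 < \<tau>" "\<tau> \<le> 1"
    let ?X = "(1 + norm x) powr (- ?d)" and ?T = "\<tau> powr (- ((1 + \<beta>) / 2))"
    have "\<tau> powr (- (\<beta> / 2)) \<le> ?T" using \<tau> gN by (intro powr_mono') auto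
    then have "B * \<tau> powr (- (\<beta> / 2)) \<le> B * ?T" using B by (intro mult_left_mono) auto
    then have "\<bar>heat_moment0 gN \<tau>\<bar> \<le> B * ?T" using B(2)[OF \<tau>(1)] by linarith
    then have 1: "\<bar>heat_moment0 gN \<tau> * heat_smoothed (newton_mixed e_n (e_tan k)) gT x \<tau>\<bar> \<le> B * ?T * (C2 * ?X)"
      unfolding abs_mult using B C2(2)[OF x \<tau>] by (intro mult_mono) auto
    have 2: "\<bar>heat_moment1 gN \<tau> * heat_smoothed (newton_grad (e_tan k)) gT x \<tau>\<bar> \<le> B * ?T * (C1 * ?X)"
      unfolding abs_mult using B(1) B(3)[OF \<tau>(1)] C1(2)[OF x \<tau>] by (intro mult_mono) auto
    show "\<bar>pressure_density k gT gN x \<tau>\<bar> \<le> (B * C2 + B * C1) * ?X * ?T"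
      unfolding pressure_density_def using 1 2 by (simp add: algebra_simps)
  qed
qed

lemma pressure_eq_time_integral:
  fixes x :: "'m::finite space"
  assumes "CARD('m) \<ge> 2" "tangential_profile gT" "normal_profile \<beta> gN" "0 < \<beta>" "\<beta> < 1" "snd x > 0"
  shows "pressure (force \<alpha> a k gT gN) x t =
     4 * a * (LINT s|lborel. indicator {1/2<..<t} s * ((s - 1/2) powr (- \<alpha>) * pressure_density k gT gN x (t - s)))"
  unfolding pressure_eq[OF assms] set_lebesgue_integral_def
  by (intro arg_cong2[where f="(*)"] refl Bochner_Integration.integral_cong)
     (auto simp: time_profile_def split: split_indicator)

lemma time_integrand:
  fixes gT :: "real^'m::finite \<Rightarrow> real"
  assumes gT: "tangential_profile gT" and gN: "normal_profile \<beta> gN" "0 < \<beta>" "\<beta> < 1"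
    and \<alpha>: "0 < \<alpha>" "\<alpha> < 1" and t: "t < 1"
    and C: "0 \<le> C" "\<And>\<tau>. 0 < \<tau> \<Longrightarrow> \<tau> \<le> 1 \<Longrightarrow> \<bar>pressure_density k gT gN x \<tau>\<bar> \<le> C * \<tau> powr (- ((1 + \<beta>) / 2))"
  shows "\<bar>indicator {1/2<..<t} s * ((s - 1/2) powr (- \<alpha>) * pressure_density k gT gN x (t - s))\<bar>
      \<le> C * (indicator {1/2<..<t} s * ((s - 1/2) powr (- \<alpha>) * (t - s) powr (- ((1 + \<beta>) / 2))))"
    and "1/2 < t \<Longrightarrow> integrable lborel (\<lambda>s. indicator {1/2<..<t} s * ((s - 1/2) powr (- \<alpha>) * pressure_density k gT gN x (t - s)))"
proof -
  show bd: "\<bar>indicator {1/2<..<t} s * ((s - 1/2) powr (- \<alpha>) * pressure_density k gT gN x (t - s))\<bar>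
      \<le> C * (indicator {1/2<..<t} s * ((s - 1/2) powr (- \<alpha>) * (t - s) powr (- ((1 + \<beta>) / 2))))" for s
  proof (cases "s \<in> {1/2<..<t}")
    case True
    then have "\<bar>pressure_density k gT gN x (t - s)\<bar> \<le> C * (t - s) powr (- ((1 + \<beta>) / 2))"
      using t by (intro C) auto
    then have "(s - 1/2) powr (- \<alpha>) * \<bar>pressure_density k gT gN x (t - s)\<bar> \<le> (s - 1/2) powr (- \<alpha>) * (C * (t - s) powr (- ((1 + \<beta>) / 2)))"
      by (intro mult_left_mono) auto
    then show ?thesis using True by (simp add: abs_mult mult_ac)
  qed simp
  assume t2: "1/2 < t"
  have [measurable]: "normal_deriv gN \<in> borel_measurable borel" by (rule normal_profile_facts[OF gN]) blast
  have iT: "integrable lborel gT" by (rule tangential_profile_bounds[OF gT]) blast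
  have [measurable]: "gT \<in> borel_measurable borel" using iT by auto
  have \<gamma>: "0 < (1 + \<beta>) / 2" "(1 + \<beta>) / 2 < 1" using gN by auto
  show "integrable lborel (\<lambda>s. indicator {1/2<..<t} s * ((s - 1/2) powr (- \<alpha>) * pressure_density k gT gN x (t - s)))"
  proof (rule Bochner_Integration.integrable_bound[OF integrable_mult_right[of C, OF time_convolution(1)[OF \<alpha> \<gamma> t2]]])
    show "AE s in lborel. norm (indicator {1/2<..<t} s * ((s - 1/2) powr (- \<alpha>) * pressure_density k gT gN x (t - s)))
       \<le> norm (C * (indicator {1/2<..<t} s * ((s - 1/2) powr (- \<alpha>) * (t - s) powr (- ((1 + \<beta>) / 2)))))"
    proof (intro AE_I2)
      fix s
      show "norm (indicator {1/2<..<t} s * ((s - 1/2) powr (- \<alpha>) * pressure_density k gT gN x (t - s)))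
       \<le> norm (C * (indicator {1/2<..<t} s * ((s - 1/2) powr (- \<alpha>) * (t - s) powr (- ((1 + \<beta>) / 2)))))"
        unfolding real_norm_def by (rule order_trans[OF bd abs_ge_self])
    qed
  qed simp
qed

text \<open>The profile in time of the force (with \<open>e = - \<alpha>\<close>) and of the bound for the pressure.\<close>

definition time_decay :: "real \<Rightarrow> real \<Rightarrow> real" where
  "time_decay e t = indicator {1/2<..} t * (t - 1/2) powr e"

lemma pressure_upper:
  fixes gT :: "real^'m::finite \<Rightarrow> real"
  assumes card: "CARD('m) \<ge> 2" and gT: "tangential_profile gT" and gN: "normal_profile \<beta> gN" "0 < \<beta>" "\<beta> < 1"
    and \<alpha>: "0 < \<alpha>" "\<alpha> < 1"
  obtains C where "0 \<le> C" "\<And>a x t. 0 < a \<Longrightarrow> snd x > 0 \<Longrightarrow> t < 1 \<Longrightarrow>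
    \<bar>pressure (force \<alpha> a k gT gN) x t\<bar> \<le> a * C * (1 + norm x) powr (- real CARD('m)) * time_decay (1 - \<alpha> - (1 + \<beta>) / 2) t"
proof -
  let ?d = "real CARD('m)" and ?\<gamma> = "(1 + \<beta>) / 2"
  obtain C where C: "0 \<le> C" "\<And>x \<tau>. snd x > 0 \<Longrightarrow> 0 < \<tau> \<Longrightarrow> \<tau> \<le> 1 \<Longrightarrow>
    \<bar>pressure_density k gT gN x \<tau>\<bar> \<le> C * (1 + norm x) powr (- ?d) * \<tau> powr (- ?\<gamma>)"
    by (rule pressure_density_upper[OF card gT gN, of k]) blast
  have \<gamma>: "0 < ?\<gamma>" "?\<gamma> < 1" using gN by auto
  define D where "D = 2 powr \<alpha> / (1 - ?\<gamma>) + 2 powr ?\<gamma> / (1 - \<alpha>)"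
  have D: "0 \<le> D" unfolding D_def using \<alpha> \<gamma> by (intro add_nonneg_nonneg divide_nonneg_nonneg) auto
  show ?thesis
  proof (rule that[of "4 * C * D"])
    show "0 \<le> 4 * C * D" using C D by simp
    fix a :: real and x :: "'m space" and t :: real assume a: "0 < a" and x: "snd x > 0" and t: "t < 1"
    let ?X = "(1 + norm x) powr (- ?d)" and ?e = "1 - \<alpha> - ?\<gamma>"
    note eq = pressure_eq_time_integral[OF card gT gN x, of \<alpha> a k t]
    show "\<bar>pressure (force \<alpha> a k gT gN) x t\<bar> \<le> a * (4 * C * D) * ?X * time_decay ?e t"
    proof (cases "1/2 < t")
      case False
      then have "indicator {1/2<..<t} s = (0::real)" for s by (auto split: split_indicator)
      then have "pressure (force \<alpha> a k gT gN) x t = 0" unfolding eq by simp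
      then show ?thesis using a C(1) D by (simp add: time_decay_def)
    next
      case True
      have CX: "0 \<le> C * ?X" using C by simp
      have "\<bar>LINT s|lborel. indicator {1/2<..<t} s * ((s - 1/2) powr (- \<alpha>) * pressure_density k gT gN x (t - s))\<bar>
         \<le> (LINT s|lborel. (C * ?X) * (indicator {1/2<..<t} s * ((s - 1/2) powr (- \<alpha>) * (t - s) powr (- ?\<gamma>))))"
        by (rule abs_integral_le[OF _ time_integrand(1)[OF gT gN \<alpha> t CX C(2)[OF x]]])
           (intro integrable_mult_right time_convolution(1) \<alpha> \<gamma> True)
      also have "\<dots> = (C * ?X) * (LINT s|lborel. (indicator {1/2<..<t} s * ((s - 1/2) powr (- \<alpha>) * (t - s) powr (- ?\<gamma>))))"
        by simp
      also have "\<dots> \<le> (C * ?X) * (D * (t - 1/2) powr ?e)"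
        unfolding D_def by (intro mult_left_mono CX time_convolution(2)[OF \<alpha> \<gamma> True])
      finally have "4 * a * \<bar>LINT s|lborel. indicator {1/2<..<t} s * ((s - 1/2) powr (- \<alpha>) * pressure_density k gT gN x (t - s))\<bar>
         \<le> 4 * a * ((C * ?X) * (D * (t - 1/2) powr ?e))"
        using a by (intro mult_left_mono) auto
      then show ?thesis unfolding eq using a True by (simp add: abs_mult time_decay_def mult_ac)
    qed
  qed
qed

lemma epowr_ennreal: "0 \<le> x \<Longrightarrow> epowr (ennreal x) r = ennreal (x powr r)"
  by (simp add: epowr_def)

lemma epowr_mono:
  assumes "u \<le> v" "0 < r"
  shows "epowr u r \<le> epowr v r"
proof (cases "v = \<infinity>")
  case False
  then have u: "u \<noteq> \<infinity>" using assms by (auto simp: top_unique)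
  have "enn2real u \<le> enn2real v" using assms False by (intro enn2real_mono) (auto simp: less_top)
  then show ?thesis using u False assms by (auto simp: epowr_def intro!: ennreal_leI powr_mono2)
qed (simp add: epowr_def)

lemma Lnorm_le:
  assumes "0 < p" "0 \<le> c" "0 \<le> I" and [measurable]: "X \<in> borel_measurable M"
    and X: "\<And>x. x \<in> space M \<Longrightarrow> 0 \<le> X x" "\<And>x. x \<in> space M \<Longrightarrow> F x \<le> ennreal (c * X x)"
    and I: "(\<integral>\<^sup>+x. ennreal (X x powr p) \<partial>M) \<le> ennreal I"
  shows "Lnorm M p F \<le> ennreal (c * I powr (1 / p))"
proof -
  have "(\<integral>\<^sup>+x. epowr (F x) p \<partial>M) \<le> (\<integral>\<^sup>+x. ennreal (c powr p) * ennreal (X x powr p) \<partial>M)"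
  proof (intro nn_integral_mono)
    fix x assume x: "x \<in> space M"
    have "epowr (F x) p \<le> epowr (ennreal (c * X x)) p" by (intro epowr_mono X x assms)
    also have "\<dots> = ennreal (c powr p) * ennreal (X x powr p)"
      using X(1)[OF x] assms(2) by (simp add: epowr_ennreal powr_mult flip: ennreal_mult)
    finally show "epowr (F x) p \<le> ennreal (c powr p) * ennreal (X x powr p)" .
  qed
  also have "\<dots> = ennreal (c powr p) * (\<integral>\<^sup>+x. ennreal (X x powr p) \<partial>M)" by (intro nn_integral_cmult) simp
  also have "\<dots> \<le> ennreal (c powr p) * ennreal I" by (intro mult_left_mono I) simp
  also have "\<dots> = ennreal (c powr p * I)" using assms by (simp add: ennreal_mult)
  finally have "Lnorm M p F \<le> epowr (ennreal (c powr p * I)) (1 / p)"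
    unfolding Lnorm_def using assms by (intro epowr_mono) auto
  also have "\<dots> = ennreal (c * I powr (1 / p))"
    using assms by (simp add: epowr_ennreal powr_mult powr_powr)
  finally show ?thesis .
qed

lemma Lnorm_ge:
  assumes "0 < p" "0 \<le> c" "0 \<le> I" and [measurable]: "X \<in> borel_measurable M"
    and X: "\<And>x. x \<in> space M \<Longrightarrow> 0 \<le> X x" "\<And>x. x \<in> space M \<Longrightarrow> ennreal (c * X x) \<le> F x"
    and I: "ennreal I \<le> (\<integral>\<^sup>+x. ennreal (X x powr p) \<partial>M)"
  shows "ennreal (c * I powr (1 / p)) \<le> Lnorm M p F"
proof -
  have "ennreal (c powr p * I) = ennreal (c powr p) * ennreal I" using assms by (simp add: ennreal_mult)
  also have "\<dots> \<le> ennreal (c powr p) * (\<integral>\<^sup>+x. ennreal (X x powr p) \<partial>M)" by (intro mult_left_mono I) simp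
  also have "\<dots> = (\<integral>\<^sup>+x. ennreal (c powr p) * ennreal (X x powr p) \<partial>M)" by (intro nn_integral_cmult[symmetric]) simp
  also have "\<dots> \<le> (\<integral>\<^sup>+x. epowr (F x) p \<partial>M)"
  proof (intro nn_integral_mono)
    fix x assume x: "x \<in> space M"
    have "ennreal (c powr p) * ennreal (X x powr p) = epowr (ennreal (c * X x)) p"
      using X(1)[OF x] assms(2) by (simp add: epowr_ennreal powr_mult flip: ennreal_mult)
    also have "\<dots> \<le> epowr (F x) p" by (intro epowr_mono X x assms)
    finally show "ennreal (c powr p) * ennreal (X x powr p) \<le> epowr (F x) p" .
  qed
  finally have "epowr (ennreal (c powr p * I)) (1 / p) \<le> Lnorm M p F"
    unfolding Lnorm_def using assms by (intro epowr_mono) auto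
  moreover have "epowr (ennreal (c powr p * I)) (1 / p) = ennreal (c * I powr (1 / p))"
    using assms by (simp add: epowr_ennreal powr_mult powr_powr)
  ultimately show ?thesis by simp
qed

lemma half_space_sets [measurable]: "(half_space :: 'm::finite space set) \<in> sets borel"
  unfolding half_space_def by (intro borel_open open_Collect_less continuous_intros)

lemma LqLp_norm_le:
  fixes F :: "'m::finite space \<Rightarrow> real \<Rightarrow> 'b::real_normed_vector"
  assumes p: "0 < p" "0 < q" and nn: "0 \<le> A" "0 \<le> I" "0 \<le> J"
    and [measurable]: "X \<in> borel_measurable borel" "H \<in> borel_measurable borel"
    and XH: "\<And>x. 0 \<le> X x" "\<And>t. 0 \<le> H t"
    and bd: "\<And>x t. snd x > 0 \<Longrightarrow> 0 < t \<Longrightarrow> t < 1 \<Longrightarrow> norm (F x t) \<le> A * X x * H t"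
    and I: "(\<integral>\<^sup>+x. ennreal (X x powr p) \<partial>lborel) \<le> ennreal I"
    and J: "(\<integral>\<^sup>+t. ennreal (H t powr q) * indicator {0<..<1} t \<partial>lborel) \<le> ennreal J"
  shows "LqLp_norm q p F \<le> ennreal (A * I powr (1 / p) * J powr (1 / q))"
  unfolding LqLp_norm_def
proof (rule Lnorm_le[where X=H])
  fix t :: real assume "t \<in> space (restrict_space lborel {0<..<1})"
  then have t: "0 < t" "t < 1" by (auto simp: space_restrict_space)
  have "Lnorm (restrict_space lborel half_space) p (\<lambda>x. ennreal (norm (F x t))) \<le> ennreal ((A * H t) * I powr (1 / p))"
  proof (rule Lnorm_le[where X=X])
    fix x :: "'m space" assume "x \<in> space (restrict_space lborel half_space)"
    then have "snd x > 0" by (auto simp: space_restrict_space half_space_def)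
    from bd[OF this t] show "ennreal (norm (F x t)) \<le> ennreal (A * H t * X x)"
      by (intro ennreal_leI) (simp add: mult_ac)
  next
    have "(\<integral>\<^sup>+x. ennreal (X x powr p) \<partial>restrict_space lborel half_space)
        = (\<integral>\<^sup>+x. ennreal (X x powr p) * indicator half_space x \<partial>lborel)"
      by (intro nn_integral_restrict_space) simp
    also have "\<dots> \<le> (\<integral>\<^sup>+x. ennreal (X x powr p) \<partial>lborel)"
      by (intro nn_integral_mono) (auto split: split_indicator)
    finally show "(\<integral>\<^sup>+x. ennreal (X x powr p) \<partial>restrict_space lborel half_space) \<le> ennreal I" using I by simp
  qed (use p nn XH in \<open>auto intro!: measurable_restrict_space1\<close>)
  then show "Lnorm (restrict_space lborel half_space) p (\<lambda>x. ennreal (norm (F x t))) \<le> ennreal (A * I powr (1 / p) * H t)"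
    by (simp add: mult_ac)
next
  show "(\<integral>\<^sup>+x. ennreal (H x powr q) \<partial>restrict_space lborel {0<..<1}) \<le> ennreal J"
    using J by (subst nn_integral_restrict_space) auto
qed (use p nn XH in \<open>auto intro!: measurable_restrict_space1\<close>)

lemma LqLp_norm_ge:
  fixes F :: "'m::finite space \<Rightarrow> real \<Rightarrow> 'b::real_normed_vector"
  assumes p: "0 < p" "0 < q" and nn: "0 \<le> A" "0 \<le> I" "0 \<le> J"
    and [measurable]: "X \<in> borel_measurable borel" "H \<in> borel_measurable borel"
    and XH: "\<And>x. 0 \<le> X x" "\<And>t. 0 \<le> H t"
    and bd: "\<And>x t. snd x > 0 \<Longrightarrow> 0 < t \<Longrightarrow> t < 1 \<Longrightarrow> A * X x * H t \<le> norm (F x t)"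
    and I: "ennreal I \<le> (\<integral>\<^sup>+x. ennreal (X x powr p) * indicator half_space x \<partial>lborel)"
    and J: "ennreal J \<le> (\<integral>\<^sup>+t. ennreal (H t powr q) * indicator {0<..<1} t \<partial>lborel)"
  shows "ennreal (A * I powr (1 / p) * J powr (1 / q)) \<le> LqLp_norm q p F"
  unfolding LqLp_norm_def
proof (rule Lnorm_ge[where X=H])
  fix t :: real assume "t \<in> space (restrict_space lborel {0<..<1})"
  then have t: "0 < t" "t < 1" by (auto simp: space_restrict_space)
  have "ennreal ((A * H t) * I powr (1 / p)) \<le> Lnorm (restrict_space lborel half_space) p (\<lambda>x. ennreal (norm (F x t)))"
  proof (rule Lnorm_ge[where X=X])
    fix x :: "'m space" assume "x \<in> space (restrict_space lborel half_space)"
    then have "snd x > 0" by (auto simp: space_restrict_space half_space_def)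
    from bd[OF this t] show "ennreal (A * H t * X x) \<le> ennreal (norm (F x t))"
      by (intro ennreal_leI) (simp add: mult_ac)
  next
    show "ennreal I \<le> (\<integral>\<^sup>+x. ennreal (X x powr p) \<partial>restrict_space lborel half_space)"
      using I by (subst nn_integral_restrict_space) auto
  qed (use p nn XH in \<open>auto intro!: measurable_restrict_space1\<close>)
  then show "ennreal (A * I powr (1 / p) * H t) \<le> Lnorm (restrict_space lborel half_space) p (\<lambda>x. ennreal (norm (F x t)))"
    by (simp add: mult_ac)
next
  show "ennreal J \<le> (\<integral>\<^sup>+x. ennreal (H x powr q) \<partial>restrict_space lborel {0<..<1})"
    using J by (subst nn_integral_restrict_space) auto
qed (use p nn XH in \<open>auto intro!: measurable_restrict_space1\<close>)

lemma time_decay_measurable [measurable]: "time_decay e \<in> borel_measurable borel"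
  unfolding time_decay_def[abs_def] by measurable

lemma time_decay_nonneg [simp]: "0 \<le> time_decay e t"
  by (simp add: time_decay_def)

lemma nn_integral_time_decay:
  assumes "e * q > -1" "0 < q"
  shows "(\<integral>\<^sup>+t. ennreal (time_decay e t powr q) * indicator {0<..<1} t \<partial>lborel) \<le> ennreal ((1/2) powr (e * q + 1) / (e * q + 1))"
proof -
  let ?f = "\<lambda>u. indicator {0<..<1/2} u * u powr (e * q) :: real"
  have hb: "has_bochner_integral lborel ?f ((1/2) powr (e * q + 1) / (e * q + 1))"
    using powr_interval[of "e * q" "1/2"] assms by simp
  have "(\<integral>\<^sup>+t. ennreal (time_decay e t powr q) * indicator {0<..<1} t \<partial>lborel)
      = (\<integral>\<^sup>+t. ennreal (?f (- (1/2) + 1 * t)) \<partial>lborel)"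
  proof (intro nn_integral_cong)
    fix t :: real
    show "ennreal (time_decay e t powr q) * indicator {0<..<1} t = ennreal (?f (- (1/2) + 1 * t))"
      using assms by (cases "1/2 < t \<and> t < 1") (auto simp: time_decay_def powr_powr split: split_indicator)
  qed
  also have "\<dots> = (\<integral>\<^sup>+t. ennreal (?f t) \<partial>lborel)"
    using nn_integral_real_affine[of "\<lambda>t. ennreal (?f t)" 1 "- (1/2)"] by simp
  also have "\<dots> = ennreal ((1/2) powr (e * q + 1) / (e * q + 1))"
    using hb by (subst nn_integral_eq_integral) (auto simp: has_bochner_integral_iff)
  finally show ?thesis by simp
qed

section \<open>Norms of the force and of the pressure\<close>

lemma pressure_norm_finite:
  fixes gT :: "real^'m::finite \<Rightarrow> real"
  assumes card: "CARD('m) \<ge> 2" and gT: "tangential_profile gT" and gN: "normal_profile \<beta> gN" "0 < \<beta>" "\<beta> < 1"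
    and \<alpha>: "0 < \<alpha>" "\<alpha> < 1" and p: "0 < p" "real CARD('m) * p > real CARD('m) + 1"
    and q: "0 < q" "(1 - \<alpha> - (1 + \<beta>) / 2) * q > -1"
  obtains C where "0 \<le> C" "\<And>a. 0 < a \<Longrightarrow> LqLp_norm q p (pressure (force \<alpha> a k gT gN)) \<le> ennreal (a * C)"
proof -
  let ?d = "real CARD('m)" and ?e = "1 - \<alpha> - (1 + \<beta>) / 2"
  let ?X = "\<lambda>x :: 'm space. (1 + norm x) powr (- ?d)"
  obtain C where C: "0 \<le> C" "\<And>a x t. 0 < a \<Longrightarrow> snd x > 0 \<Longrightarrow> t < 1 \<Longrightarrow>
    \<bar>pressure (force \<alpha> a k gT gN) x t\<bar> \<le> a * C * ?X x * time_decay ?e t"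
    by (rule pressure_upper[OF card gT gN \<alpha>, of k]) blast
  define I where "I = enn2real (\<integral>\<^sup>+x. ennreal (?X x powr p) \<partial>lborel)"
  have "(\<integral>\<^sup>+x. ennreal (?X x powr p) \<partial>lborel) = (\<integral>\<^sup>+x. ennreal ((1 + norm x) powr (- (?d * p))) \<partial>(lborel :: 'm space measure))"
    by (simp add: powr_powr)
  also have "\<dots> < \<infinity>" using p by (intro nn_integral_one_plus_norm_powr) (simp add: add.commute)
  finally have I: "(\<integral>\<^sup>+x. ennreal (?X x powr p) \<partial>lborel) \<le> ennreal I" by (simp add: I_def)
  define J where "J = (1/2) powr (?e * q + 1) / (?e * q + 1)"
  have J0: "0 \<le> J" using q by (simp add: J_def)
  show ?thesis
  proof (rule that[of "C * I powr (1 / p) * J powr (1 / q)"])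
    show "0 \<le> C * I powr (1 / p) * J powr (1 / q)" using C by simp
    fix a :: real assume a: "0 < a"
    have "LqLp_norm q p (pressure (force \<alpha> a k gT gN)) \<le> ennreal (a * C * I powr (1 / p) * J powr (1 / q))"
    proof (rule LqLp_norm_le[where X="?X" and H="time_decay ?e"])
      show "(\<integral>\<^sup>+t. ennreal (time_decay ?e t powr q) * indicator {0<..<1} t \<partial>lborel) \<le> ennreal J"
        unfolding J_def by (rule nn_integral_time_decay[OF q(2,1)])
      show "norm (pressure (force \<alpha> a k gT gN) x t) \<le> a * C * ?X x * time_decay ?e t"
        if "snd x > 0" "0 < t" "t < 1" for x t
        using C(2)[OF a that(1,3)] by simp
    qed (use p q a C(1) J0 I in \<open>auto simp: I_def\<close>)
    then show "LqLp_norm q p (pressure (force \<alpha> a k gT gN)) \<le> ennreal (a * (C * I powr (1 / p) * J powr (1 / q)))"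
      by (simp add: mult_ac)
  qed
qed

lemma force_norm_eq:
  assumes "tangential_profile gT" "(gN has_real_derivative normal_deriv gN (snd x)) (at (snd x))"
  shows "force \<alpha> a k gT gN x t =
     (a * (gT (fst x) * normal_deriv gN (snd x)) * time_profile \<alpha> t) *\<^sub>R e_tan k
     + (- a * (grad_comp k gT (fst x) * gN (snd x)) * time_profile \<alpha> t) *\<^sub>R e_n"
  unfolding force_def using assms by (simp add: partial_n_space_profile partial_tan_space_profile)

lemma time_profile_eq_decay: "time_profile \<alpha> t = time_decay (- \<alpha>) t"
  by (simp add: time_profile_def time_decay_def)

lemma force_norm_finite:
  fixes gT :: "real^'m::finite \<Rightarrow> real"
  assumes gT: "tangential_profile gT" and gN: "normal_profile \<beta> gN" "0 < \<beta>" "\<beta> < 1"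
    and p: "0 < p" "\<beta> * p < 1" and q: "0 < q" "\<alpha> * q < 1" and a: "0 < a"
  shows "LqLp_norm q p (force \<alpha> a k gT gN) < \<infinity>"
proof -
  obtain M where M: "0 \<le> M" "\<And>z. \<bar>gT z\<bar> \<le> M * indicator (ball 0 1) z" "\<And>z. \<bar>grad_comp k gT z\<bar> \<le> M * indicator (ball 0 1) z"
    by (rule tangential_profile_bounds[OF gT, of k]) blast
  obtain N where N: "0 \<le> N"
    "\<And>y. \<bar>normal_deriv gN y\<bar> \<le> N * (indicator {0<..<2} y * y powr (- \<beta>))"
    "\<And>y. 0 < y \<Longrightarrow> \<bar>gN y\<bar> \<le> N * (indicator {0<..<2} y * y powr (- \<beta>))"
    and D: "\<And>y. 0 < y \<Longrightarrow> (gN has_real_derivative normal_deriv gN y) (at y)"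
    by (rule normal_profile_facts[OF gN]) blast
  let ?X = "\<lambda>x :: 'm space. indicator (ball 0 1) (fst x) * (indicator {0<..<2} (snd x) * snd x powr (- \<beta>))"
  define I where "I = measure lborel (ball (0 :: real^'m) 1) * (2 powr (- (\<beta> * p) + 1) / (- (\<beta> * p) + 1))"
  have I0: "0 \<le> I" unfolding I_def using p by (intro mult_nonneg_nonneg divide_nonneg_nonneg) auto
  have I: "(\<integral>\<^sup>+x. ennreal (?X x powr p) \<partial>lborel) = ennreal I"
  proof -
    have hb: "has_bochner_integral lborel
        (\<lambda>x :: 'm space. indicator (ball 0 1) (fst x) * (indicator {0<..<2} (snd x) * snd x powr (- (\<beta> * p)))) I"
      using has_bochner_integral_lborel_prod[of "indicator (ball (0 :: real^'m) 1)" "\<lambda>y. indicator {0<..<2} y * y powr (- (\<beta> * p))"]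
        integral_powr_interval[of "- (\<beta> * p)" 2] p
      by (simp add: I_def integrable_indicator_ball)
    have "?X x powr p = indicator (ball 0 1) (fst x) * (indicator {0<..<2} (snd x) * snd x powr (- (\<beta> * p)))" for x :: "'m space"
      using p by (auto simp: powr_powr split: split_indicator)
    then show ?thesis using hb
      by (simp add: nn_integral_eq_integral has_bochner_integral_iff)
  qed
  have "LqLp_norm q p (force \<alpha> a k gT gN) \<le> ennreal ((2 * a * M * N) * I powr (1 / p) * ((1/2) powr (- \<alpha> * q + 1) / (- \<alpha> * q + 1)) powr (1 / q))"
  proof (rule LqLp_norm_le[where X="?X" and H="time_decay (- \<alpha>)"])
    show "(\<integral>\<^sup>+t. ennreal (time_decay (- \<alpha>) t powr q) * indicator {0<..<1} t \<partial>lborel) \<le> ennreal ((1/2) powr (- \<alpha> * q + 1) / (- \<alpha> * q + 1))"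
      using q by (intro nn_integral_time_decay) auto
    fix x :: "'m space" and t :: real assume x: "snd x > 0"
    let ?h = "time_decay (- \<alpha>) t"
    have "\<bar>gT (fst x)\<bar> * \<bar>normal_deriv gN (snd x)\<bar> \<le> (M * indicator (ball 0 1) (fst x)) * (N * (indicator {0<..<2} (snd x) * snd x powr (- \<beta>)))"
      by (intro mult_mono M N) (auto intro: mult_nonneg_nonneg M)
    then have "(a * ?h) * (\<bar>gT (fst x)\<bar> * \<bar>normal_deriv gN (snd x)\<bar>) \<le> (a * ?h) * (M * N * ?X x)"
      using a by (intro mult_left_mono) (auto simp: mult_ac)
    then have 1: "norm ((a * (gT (fst x) * normal_deriv gN (snd x)) * ?h) *\<^sub>R (e_tan k :: 'm space)) \<le> (a * ?h) * (M * N * ?X x)"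
      using a by (simp add: abs_mult mult_ac)
    have "\<bar>grad_comp k gT (fst x)\<bar> * \<bar>gN (snd x)\<bar> \<le> (M * indicator (ball 0 1) (fst x)) * (N * (indicator {0<..<2} (snd x) * snd x powr (- \<beta>)))"
      by (intro mult_mono M N x) (auto intro: mult_nonneg_nonneg M)
    then have "(a * ?h) * (\<bar>grad_comp k gT (fst x)\<bar> * \<bar>gN (snd x)\<bar>) \<le> (a * ?h) * (M * N * ?X x)"
      using a by (intro mult_left_mono) (auto simp: mult_ac)
    then have 2: "norm ((- a * (grad_comp k gT (fst x) * gN (snd x)) * ?h) *\<^sub>R (e_n :: 'm space)) \<le> (a * ?h) * (M * N * ?X x)"
      using a by (simp add: abs_mult mult_ac)
    have "norm (force \<alpha> a k gT gN x t) \<le> (a * ?h) * (M * N * ?X x) + (a * ?h) * (M * N * ?X x)"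
      unfolding force_norm_eq[OF gT D[OF x]] time_profile_eq_decay by (rule norm_triangle_le) (rule add_mono[OF 1 2])
    then show "norm (force \<alpha> a k gT gN x t) \<le> 2 * a * M * N * ?X x * ?h" by (simp add: mult_ac)
  qed (use p q a M(1) N(1) I I0 in auto)
  also have "\<dots> < \<infinity>" by simp
  finally show ?thesis .
qed

text \<open>A positive lower bound that is linear in \<open>a\<close>, like the upper bound for the pressure. It makes possible an
  estimate of the pressure through the norm of the force.\<close>

lemma force_norm_lower:
  fixes gT :: "real^'m::finite \<Rightarrow> real"
  assumes gT: "tangential_profile gT" and gN: "normal_profile \<beta> gN" "0 < \<beta>" "\<beta> < 1"
    and p: "0 < p" and q: "0 < q" and \<alpha>: "0 < \<alpha>"
  obtains c where "0 < c" "\<And>a. 0 < a \<Longrightarrow> ennreal (a * c) \<le> LqLp_norm q p (force \<alpha> a k gT gN)"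
proof -
  obtain N where N: "\<And>y. 0 < y \<Longrightarrow> y < 1 \<Longrightarrow> normal_deriv gN y = (1 - \<beta>) * y powr (- \<beta>)"
    and D: "\<And>y. 0 < y \<Longrightarrow> (gN has_real_derivative normal_deriv gN y) (at y)"
    by (rule normal_profile_facts[OF gN]) blast
  obtain z0 r where r: "0 < r" "0 < gT z0" and zr: "\<And>z. z \<in> ball z0 r \<Longrightarrow> gT z0 / 2 \<le> gT z" and nn: "\<And>z. 0 \<le> gT z"
    by (rule tangential_profile_positive_ball[OF gT]) blast
  let ?X = "\<lambda>x :: 'm space. indicator (ball z0 r) (fst x) * indicator {0<..<1} (snd x) :: real"
  let ?H = "\<lambda>t :: real. indicator {1/2<..<1} t :: real"
  define I where "I = measure lborel (ball z0 r) * measure lborel {0<..<1::real}"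
  have I0: "0 < I" unfolding I_def using content_ball_pos[OF r(1), of z0] by simp
  have hb: "has_bochner_integral lborel ?X I"
    using has_bochner_integral_lborel_prod[of "indicator (ball z0 r)" "indicator {0<..<1::real}"]
    by (simp add: I_def integrable_indicator_ball)
  have I: "ennreal I \<le> (\<integral>\<^sup>+x. ennreal (?X x powr p) * indicator half_space x \<partial>lborel)"
  proof -
    have "ennreal (?X x powr p) * indicator half_space x = ennreal (?X x)" for x
      using p by (auto simp: half_space_def split: split_indicator)
    then show ?thesis using hb by (simp add: nn_integral_eq_integral has_bochner_integral_iff)
  qed
  have J: "ennreal (1/2) \<le> (\<integral>\<^sup>+t. ennreal (?H t powr q) * indicator {0<..<1} t \<partial>lborel)"
  proof -
    have "(\<integral>\<^sup>+t. ennreal (?H t powr q) * indicator {0<..<1} t \<partial>lborel) = (\<integral>\<^sup>+t. indicator {1/2<..<1::real} t \<partial>lborel)"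
      using q by (intro nn_integral_cong) (auto split: split_indicator)
    then show ?thesis by simp
  qed
  define c where "c = gT z0 / 2 * (1 - \<beta>)"
  have c: "0 < c" using r gN by (simp add: c_def)
  show ?thesis
  proof (rule that[of "c * I powr (1 / p) * (1/2) powr (1 / q)"])
    show "0 < c * I powr (1 / p) * (1/2) powr (1 / q)" using c I0 by simp
    fix a :: real assume a: "0 < a"
    have "ennreal (a * c * I powr (1 / p) * (1/2) powr (1 / q)) \<le> LqLp_norm q p (force \<alpha> a k gT gN)"
    proof (rule LqLp_norm_ge[where X="?X" and H="?H"])
      fix x :: "'m space" and t :: real assume x: "snd x > 0" and t: "0 < t" "t < 1"
      show "a * c * ?X x * ?H t \<le> norm (force \<alpha> a k gT gN x t)"
      proof (cases "fst x \<in> ball z0 r \<and> snd x < 1 \<and> 1/2 < t")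
        case True
        have "1 = 1 powr (- \<beta>)" by simp
        also have "1 powr (- \<beta>) \<le> snd x powr (- \<beta>)" using x True gN by (intro powr_mono2') auto
        finally have "(1 - \<beta>) * 1 \<le> normal_deriv gN (snd x)"
          unfolding N[OF x conjunct1[OF conjunct2[OF True]]] using gN by (intro mult_left_mono) auto
        then have 1: "c \<le> gT (fst x) * normal_deriv gN (snd x)"
          unfolding c_def using zr[of "fst x"] True r nn gN by (intro mult_mono) auto
        have "1 = 1 powr (- \<alpha>)" by simp
        also have "1 powr (- \<alpha>) \<le> (t - 1/2) powr (- \<alpha>)" using t True \<alpha> by (intro powr_mono2') auto
        finally have 2: "1 \<le> time_profile \<alpha> t" using True by (simp add: time_profile_def)
        have "(a * c) * 1 \<le> (a * (gT (fst x) * normal_deriv gN (snd x))) * time_profile \<alpha> t"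
          using 1 2 a c by (intro mult_mono) auto
        also have "\<dots> = force \<alpha> a k gT gN x t \<bullet> e_tan k"
          unfolding force_norm_eq[OF gT D[OF x]] by (simp add: inner_add_left inner_e axis_def)
        also have "\<dots> \<le> norm (force \<alpha> a k gT gN x t) * norm (e_tan k :: 'm space)" by (rule norm_cauchy_schwarz)
        finally show ?thesis using True x t by simp
      next
        case False
        then have "?X x * ?H t = 0" by (auto split: split_indicator)
        then show ?thesis by (simp only: mult.assoc) simp
      qed
    qed (use p q a c I0 I J in auto)
    then show "ennreal (a * (c * I powr (1 / p) * (1/2) powr (1 / q))) \<le> LqLp_norm q p (force \<alpha> a k gT gN)"
      by (simp add: mult_ac)
  qed
qed

text \<open>For small \<open>\<tau>\<close> the first term of the density is smaller than the second by a factor of order \<open>sqrt \<tau>\<close>.\<close>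

lemma pressure_density_lower:
  fixes gT :: "real^'m::finite \<Rightarrow> real"
  assumes card: "CARD('m) \<ge> 2" and gT: "tangential_profile gT" and gN: "normal_profile \<beta> gN" "0 < \<beta>" "\<beta> < 1"
    and R: "0 \<le> R"
  obtains c \<delta> where "0 < c" "0 < \<delta>" "\<delta> \<le> 1/2" "\<And>x \<tau>. snd x > 0 \<Longrightarrow> 3 \<le> fst x $ k \<Longrightarrow> norm x \<le> R \<Longrightarrow> 0 < \<tau> \<Longrightarrow> \<tau> < \<delta> \<Longrightarrow>
    c * \<tau> powr (- ((1 + \<beta>) / 2)) \<le> - pressure_density k gT gN x \<tau>"
proof -
  let ?\<gamma> = "(1 + \<beta>) / 2"
  let ?Phi = "heat_smoothed (newton_grad (e_tan k)) gT" and ?Psi = "heat_smoothed (newton_mixed e_n (e_tan k)) gT"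
  obtain c1 K1 where c1: "0 < c1" "0 \<le> K1" "\<And>x \<tau>. snd x > 0 \<Longrightarrow> 3 \<le> fst x $ k \<Longrightarrow> norm x \<le> R \<Longrightarrow> 0 < \<tau> \<Longrightarrow>
    c1 - K1 * \<tau> \<le> ?Phi x \<tau>"
    by (rule heat_smoothed_lower[OF card gT R, of k]) blast
  obtain c2 K2 where c2: "0 < c2" "0 \<le> K2" "\<And>\<tau>. 0 < \<tau> \<Longrightarrow> \<tau> < 1 \<Longrightarrow> c2 * \<tau> powr (- ?\<gamma>) - K2 \<le> heat_moment1 gN \<tau>"
    by (rule heat_moment1_lower[OF gN]) blast
  obtain B where B: "0 \<le> B" "\<And>\<tau>. 0 < \<tau> \<Longrightarrow> \<bar>heat_moment0 gN \<tau>\<bar> \<le> B * \<tau> powr (- (\<beta> / 2))"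
    by (rule heat_moment_upper[OF gN]) blast
  obtain C0 where C0: "0 \<le> C0"
    "\<And>x. snd x > 0 \<Longrightarrow> \<bar>layer_potential (newton_mixed e_n (e_tan k)) gT x\<bar> \<le> C0 * (1 + norm x) powr (- real CARD('m))"
    by (rule layer_potential_decay[OF card gT, of k]) blast
  have d0: "0 \<le> real CARD('m)" by simp
  obtain C where C: "0 \<le> C" "\<And>x \<tau>. snd x > 0 \<Longrightarrow> 0 < \<tau> \<Longrightarrow> \<tau> \<le> 1 \<Longrightarrow> \<bar>?Psi x \<tau>\<bar> \<le> C * (1 + norm x) powr (- real CARD('m))"
    by (rule heat_smoothed_decay[OF d0 C0]) (assumption, blast)
  have C1: "\<bar>?Psi x \<tau>\<bar> \<le> C" if "snd x > 0" "0 < \<tau>" "\<tau> \<le> 1" for x \<tau>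
  proof -
    have "(1 + norm x) powr (- real CARD('m)) \<le> 1 powr (- real CARD('m))" by (intro powr_mono2') auto
    then show ?thesis using C(2)[OF that] C(1) mult_left_mono[of "(1 + norm x) powr (- real CARD('m))" 1 C] by simp
  qed
  \<comment> \<open>The error terms are at most \<open>L\<close> times \<open>\<tau> powr (- (\<beta> / 2))\<close>, that is \<open>L * sqrt \<tau>\<close> times the main power. Below \<open>\<delta>1\<close> the smoothed potential is at least \<open>c1 / 2\<close>, and below \<open>\<delta>2\<close> the errors are at most half of the main term.\<close>
  define L where "L = K2 * c1 / 2 + B * C"
  have L: "0 \<le> L" using c1 c2 B C by (simp add: L_def)
  define \<delta>1 where "\<delta>1 = c1 / (2 * (K1 + 1))"
  define \<delta>2 where "\<delta>2 = (c1 * c2 / (4 * (L + 1)))\<^sup>2"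
  have \<delta>: "0 < \<delta>1" "0 < \<delta>2" using c1 c2 L by (auto simp: \<delta>1_def \<delta>2_def intro!: zero_less_power divide_pos_pos)
  show ?thesis
  proof (rule that[of "c1 * c2 / 4" "min (1/2) (min \<delta>1 \<delta>2)"])
    show "0 < c1 * c2 / 4" using c1 c2 by simp
    show "0 < min (1/2) (min \<delta>1 \<delta>2)" "min (1/2) (min \<delta>1 \<delta>2) \<le> 1/2" using \<delta> by auto
    fix x :: "'m space" and \<tau> :: real
    assume x: "snd x > 0" "3 \<le> fst x $ k" "norm x \<le> R" and \<tau>: "0 < \<tau>" "\<tau> < min (1/2) (min \<delta>1 \<delta>2)"
    let ?T = "\<tau> powr (- ?\<gamma>)"
    have "K1 * \<tau> \<le> (K1 + 1) * \<delta>1" using c1 \<tau> by (intro mult_mono) auto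
    also have "\<dots> = c1 / 2" using c1 by (simp add: \<delta>1_def field_simps)
    finally have Phi: "c1 / 2 \<le> ?Phi x \<tau>" using c1(3)[OF x \<tau>(1)] by linarith
    have "sqrt \<tau> \<le> sqrt \<delta>2" using \<tau> by simp
    also have "\<dots> = c1 * c2 / (4 * (L + 1))" using c1 c2 L by (simp add: \<delta>2_def)
    finally have "L * sqrt \<tau> \<le> (L + 1) * (c1 * c2 / (4 * (L + 1)))" using L \<tau> by (intro mult_mono) auto
    also have "\<dots> = c1 * c2 / 4" using L by (simp add: field_simps)
    finally have small: "L * sqrt \<tau> * ?T \<le> c1 * c2 / 4 * ?T" by (intro mult_right_mono) auto
    have sq: "sqrt \<tau> * ?T = \<tau> powr (- (\<beta> / 2))"
    proof -
      have "sqrt \<tau> * ?T = \<tau> powr (1/2 + - ?\<gamma>)"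
        unfolding powr_add using \<tau> by (simp add: powr_half_sqrt)
      also have "1/2 + - ?\<gamma> = - (\<beta> / 2)" by (simp add: field_simps)
      finally show ?thesis .
    qed
    have one: "1 \<le> \<tau> powr (- (\<beta> / 2))"
      using powr_mono2'[of "- (\<beta> / 2)" \<tau> 1] \<tau> gN by auto
    have "K2 * c1 / 2 * 1 \<le> K2 * c1 / 2 * \<tau> powr (- (\<beta> / 2))" using one c1 c2 by (intro mult_left_mono) auto
    then have LL: "K2 * c1 / 2 + B * C * \<tau> powr (- (\<beta> / 2)) \<le> L * sqrt \<tau> * ?T"
      unfolding mult.assoc sq by (simp add: L_def algebra_simps)
    have "\<bar>heat_moment0 gN \<tau> * ?Psi x \<tau>\<bar> \<le> B * \<tau> powr (- (\<beta> / 2)) * C"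
      unfolding abs_mult using B \<tau> C1[OF x(1)] by (intro mult_mono) auto
    then have A: "heat_moment0 gN \<tau> * ?Psi x \<tau> \<le> B * C * \<tau> powr (- (\<beta> / 2))" by (simp add: mult_ac)
    have "(c2 * ?T - K2) * (c1 / 2) \<le> heat_moment1 gN \<tau> * ?Phi x \<tau>"
    proof -
      have "K2 * c1 / 2 \<le> c1 * c2 / 4 * ?T"
        using LL small B C by (smt (verit) mult_nonneg_nonneg powr_ge_zero)
      then have "0 \<le> (c2 * ?T - K2) * (c1 / 2)" using c1 c2 by (simp add: algebra_simps)
      then have p: "0 \<le> c2 * ?T - K2" using c1(1) by (simp add: zero_le_mult_iff)
      show ?thesis using c2(3)[of \<tau>] \<tau> p Phi c1(1) by (intro mult_mono) auto
    qed
    moreover have "(c2 * ?T - K2) * (c1 / 2) = c1 * c2 / 4 * ?T + c1 * c2 / 4 * ?T - K2 * c1 / 2"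
      by (simp add: algebra_simps)
    ultimately have "c1 * c2 / 4 * ?T \<le> heat_moment1 gN \<tau> * ?Phi x \<tau> - heat_moment0 gN \<tau> * ?Psi x \<tau>"
      using A LL small by linarith
    then show "c1 * c2 / 4 * ?T \<le> - pressure_density k gT gN x \<tau>"
      by (simp add: pressure_density_def)
  qed
qed

text \<open>The integrand keeps its sign, so the integral in time is at least the length of the interval times the
  product of the smallest values of the two powers.\<close>

lemma pressure_lower:
  fixes gT :: "real^'m::finite \<Rightarrow> real"
  assumes card: "CARD('m) \<ge> 2" and gT: "tangential_profile gT" and gN: "normal_profile \<beta> gN" "0 < \<beta>" "\<beta> < 1"
    and \<alpha>: "0 < \<alpha>" "\<alpha> < 1" and R: "0 \<le> R" and a: "0 < a"
  obtains c \<delta> where "0 < c" "0 < \<delta>" "\<delta> \<le> 1/2" "\<And>x t. snd x > 0 \<Longrightarrow> 3 \<le> fst x $ k \<Longrightarrow> norm x \<le> R \<Longrightarrow> 1/2 < t \<Longrightarrow> t < 1/2 + \<delta> \<Longrightarrow>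
    c * (t - 1/2) powr (1 - \<alpha> - (1 + \<beta>) / 2) \<le> \<bar>pressure (force \<alpha> a k gT gN) x t\<bar>"
proof -
  let ?\<gamma> = "(1 + \<beta>) / 2"
  have \<gamma>: "0 < ?\<gamma>" "?\<gamma> < 1" using gN by auto
  obtain c \<delta> where c: "0 < c" and \<delta>: "0 < \<delta>" "\<delta> \<le> 1/2"
    and low: "\<And>x \<tau>. snd x > 0 \<Longrightarrow> 3 \<le> fst x $ k \<Longrightarrow> norm x \<le> R \<Longrightarrow> 0 < \<tau> \<Longrightarrow> \<tau> < \<delta> \<Longrightarrow>
      c * \<tau> powr (- ?\<gamma>) \<le> - pressure_density k gT gN x \<tau>"
    by (rule pressure_density_lower[OF card gT gN R, of k]) blast
  obtain C where C: "0 \<le> C" "\<And>x \<tau>. snd x > 0 \<Longrightarrow> 0 < \<tau> \<Longrightarrow> \<tau> \<le> 1 \<Longrightarrow>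
    \<bar>pressure_density k gT gN x \<tau>\<bar> \<le> C * (1 + norm x) powr (- real CARD('m)) * \<tau> powr (- ?\<gamma>)"
    by (rule pressure_density_upper[OF card gT gN, of k]) blast
  show ?thesis
  proof (rule that[OF _ \<delta>, of "4 * a * c"])
    show "0 < 4 * a * c" using a c by simp
    fix x :: "'m space" and t :: real
    assume x: "snd x > 0" "3 \<le> fst x $ k" "norm x \<le> R" and t: "1/2 < t" "t < 1/2 + \<delta>"
    define T where "T = t - 1/2"
    have T: "0 < T" "T < \<delta>" "t < 1" using t \<delta> by (auto simp: T_def)
    have CX: "0 \<le> C * (1 + norm x) powr (- real CARD('m))" using C by simp
    let ?f = "\<lambda>s. indicator {1/2<..<t} s * ((s - 1/2) powr (- \<alpha>) * pressure_density k gT gN x (t - s))"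
    have i: "integrable lborel ?f"
      by (rule time_integrand(2)[OF gT gN \<alpha> T(3) CX C(2)[OF x(1)] t(1)])
    let ?g = "\<lambda>s. c * T powr (- \<alpha> - ?\<gamma>) * indicator {1/2<..<t} s"
    have "c * T powr (1 - \<alpha> - ?\<gamma>) = c * T powr (- \<alpha> - ?\<gamma>) * T"
    proof -
      have "1 - \<alpha> - ?\<gamma> = (- \<alpha> - ?\<gamma>) + 1" by simp
      then have "T powr (1 - \<alpha> - ?\<gamma>) = T powr (- \<alpha> - ?\<gamma>) * T powr 1" by (simp only: powr_add)
      then show ?thesis using T by simp
    qed
    also have "\<dots> = (LINT s|lborel. ?g s)" using t by (simp add: T_def)
    also have "\<dots> \<le> (LINT s|lborel. - ?f s)"
    proof (rule integral_mono)
      show "integrable lborel ?g" using t by (intro integrable_mult_right integrable_real_indicator) auto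
      show "integrable lborel (\<lambda>s. - ?f s)" using i by simp
      fix s :: real
      show "?g s \<le> - ?f s"
      proof (cases "s \<in> {1/2<..<t}")
        case True
        have 1: "T powr (- \<alpha>) \<le> (s - 1/2) powr (- \<alpha>)" using True \<alpha> by (intro powr_mono2') (auto simp: T_def)
        have "T powr (- ?\<gamma>) \<le> (t - s) powr (- ?\<gamma>)" using True \<gamma> by (intro powr_mono2') (auto simp: T_def)
        then have "c * T powr (- ?\<gamma>) \<le> c * (t - s) powr (- ?\<gamma>)" using c by (intro mult_left_mono) auto
        also have "\<dots> \<le> - pressure_density k gT gN x (t - s)" using True T by (intro low x) (auto simp: T_def)
        finally have 2: "c * T powr (- ?\<gamma>) \<le> - pressure_density k gT gN x (t - s)" .
        have "c * T powr (- \<alpha> - ?\<gamma>) = T powr (- \<alpha>) * (c * T powr (- ?\<gamma>))"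
          using powr_add[of T "- \<alpha>" "- ?\<gamma>"] by simp
        also have "\<dots> \<le> (s - 1/2) powr (- \<alpha>) * (- pressure_density k gT gN x (t - s))"
          using 1 2 c by (intro mult_mono) auto
        finally show ?thesis using True by simp
      qed simp
    qed
    also have "\<dots> = - (LINT s|lborel. ?f s)" by simp
    finally have "c * T powr (1 - \<alpha> - ?\<gamma>) \<le> \<bar>LINT s|lborel. ?f s\<bar>" by linarith
    then have "4 * a * (c * T powr (1 - \<alpha> - ?\<gamma>)) \<le> 4 * a * \<bar>LINT s|lborel. ?f s\<bar>" using a by (intro mult_left_mono) auto
    then show "4 * a * c * (t - 1/2) powr (1 - \<alpha> - ?\<gamma>) \<le> \<bar>pressure (force \<alpha> a k gT gN) x t\<bar>"
      unfolding pressure_eq_time_integral[OF card gT gN x(1)] using a by (simp add: abs_mult T_def mult_ac)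
  qed
qed

text \<open>The power dominates \<open>u powr (\<epsilon> - 1)\<close> for every \<open>0 < \<epsilon> \<le> 1\<close>, whose integral is at least \<open>\<delta> / \<epsilon>\<close>.\<close>

lemma nn_integral_powr_diverges:
  fixes e \<delta> :: real
  assumes e: "e \<le> -1" and \<delta>: "0 < \<delta>" "\<delta> \<le> 1"
  shows "(\<integral>\<^sup>+u. ennreal (indicator {0<..<\<delta>} u * u powr e) \<partial>lborel) = \<infinity>"
proof (rule ccontr)
  let ?I = "\<integral>\<^sup>+u. ennreal (indicator {0<..<\<delta>} u * u powr e) \<partial>lborel"
  assume "?I \<noteq> \<infinity>"
  then obtain K where K: "0 \<le> K" "?I = ennreal K" by (metis ennreal_cases infinity_ennreal_def)
  have "\<delta> / \<epsilon> \<le> K" if \<epsilon>: "0 < \<epsilon>" "\<epsilon> \<le> 1" for \<epsilon>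
  proof -
    have "\<delta> \<le> \<delta> powr \<epsilon>" using powr_mono'[of \<epsilon> 1 \<delta>] \<delta> \<epsilon> by simp
    then have "ennreal (\<delta> / \<epsilon>) \<le> ennreal (\<delta> powr ((\<epsilon> - 1) + 1) / ((\<epsilon> - 1) + 1))"
      using \<epsilon> by (intro ennreal_leI) (simp add: divide_right_mono)
    also have "\<dots> = (\<integral>\<^sup>+u. ennreal (indicator {0<..<\<delta>} u * u powr (\<epsilon> - 1)) \<partial>lborel)"
      using powr_interval[of "\<epsilon> - 1" \<delta>] \<epsilon> \<delta> by (subst nn_integral_eq_integral) (auto simp: has_bochner_integral_iff)
    also have "\<dots> \<le> ?I"
    proof (intro nn_integral_mono ennreal_leI)
      fix u :: real
      show "indicator {0<..<\<delta>} u * u powr (\<epsilon> - 1) \<le> indicator {0<..<\<delta>} u * u powr e"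
        using powr_mono'[of e "\<epsilon> - 1" u] e \<delta> \<epsilon> by (auto split: split_indicator)
    qed
    finally show ?thesis using K by simp
  qed
  from this[of "\<delta> / (K + 1)"] have "K + 1 \<le> K" using \<delta> K by (simp add: divide_le_eq)
  then show False by simp
qed

lemma Lnorm_infinite:
  assumes "0 < q" "0 < c" and [measurable]: "X \<in> borel_measurable M"
    and X: "\<And>x. x \<in> space M \<Longrightarrow> 0 \<le> X x" "\<And>x. x \<in> space M \<Longrightarrow> ennreal (c * X x) \<le> F x"
    and I: "(\<integral>\<^sup>+x. ennreal (X x powr q) \<partial>M) = \<infinity>"
  shows "Lnorm M q F = \<infinity>"
proof -
  have "\<infinity> = ennreal (c powr q) * (\<integral>\<^sup>+x. ennreal (X x powr q) \<partial>M)"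
    using I assms by (simp add: ennreal_mult_top)
  also have "\<dots> = (\<integral>\<^sup>+x. ennreal (c powr q) * ennreal (X x powr q) \<partial>M)" by (intro nn_integral_cmult[symmetric]) simp
  also have "\<dots> \<le> (\<integral>\<^sup>+x. epowr (F x) q \<partial>M)"
  proof (intro nn_integral_mono)
    fix x assume x: "x \<in> space M"
    have "ennreal (c powr q) * ennreal (X x powr q) = epowr (ennreal (c * X x)) q"
      using X(1)[OF x] assms(2) by (simp add: epowr_ennreal powr_mult flip: ennreal_mult)
    also have "\<dots> \<le> epowr (F x) q" by (intro epowr_mono X x assms)
    finally show "ennreal (c powr q) * ennreal (X x powr q) \<le> epowr (F x) q" .
  qed
  finally show ?thesis by (simp add: Lnorm_def epowr_def top_unique)
qed

text \<open>Above the unit ball around the point \<open>4\<close> of the \<open>k\<close>-th tangential axis, the modulus of the pressure exceeds a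
  multiple of \<open>(t - 1/2) powr e\<close> for \<open>t\<close> slightly above \<open>1/2\<close>, and the \<open>q\<close>-th power of that is not integrable.\<close>

lemma pressure_locally_unbounded:
  fixes gT :: "real^'m::finite \<Rightarrow> real"
  assumes card: "CARD('m) \<ge> 2" and gT: "tangential_profile gT" and gN: "normal_profile \<beta> gN" "0 < \<beta>" "\<beta> < 1"
    and \<alpha>: "0 < \<alpha>" "\<alpha> < 1" and a: "0 < a" and q: "0 < q" "(1 - \<alpha> - (1 + \<beta>) / 2) * q \<le> -1"
    and ab: "0 \<le> a'" "a' < b'"
  shows "Lnorm (restrict_space lborel
                 {((x', x\<^sub>n), t). norm x' > 2 \<and> x\<^sub>n \<in> {a'<..<b'} \<and> t \<in> {0<..<1}}) q
          (\<lambda>(x, t). ennreal \<bar>pressure (force \<alpha> a k gT gN) x t\<bar>) = \<infinity>"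
proof -
  let ?e = "1 - \<alpha> - (1 + \<beta>) / 2"
  let ?S = "{((x'::real^'m, x\<^sub>n::real), t::real). norm x' > 2 \<and> x\<^sub>n \<in> {a'<..<b'} \<and> t \<in> {0<..<1}}"
  define z0 :: "real^'m" where "z0 = 4 *\<^sub>R axis k 1"
  have R: "0 \<le> 5 + b'" using ab by simp
  obtain c \<delta> where c: "0 < c" and \<delta>: "0 < \<delta>" "\<delta> \<le> 1/2"
    and low: "\<And>x t. snd x > 0 \<Longrightarrow> 3 \<le> fst x $ k \<Longrightarrow> norm x \<le> 5 + b' \<Longrightarrow> 1/2 < t \<Longrightarrow> t < 1/2 + \<delta> \<Longrightarrow>
    c * (t - 1/2) powr ?e \<le> \<bar>pressure (force \<alpha> a k gT gN) x t\<bar>"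
    by (rule pressure_lower[OF card gT gN \<alpha> R a, of k]) blast
  have S: "?S \<in> sets borel"
  proof -
    have "?S = ({z. 2 < norm z} \<times> {a'<..<b'}) \<times> {0<..<1}" by auto
    moreover have "open {z :: real^'m. 2 < norm z}" by (intro open_Collect_less continuous_intros)
    ultimately show ?thesis by (simp add: borel_open open_Times)
  qed
  let ?W = "\<lambda>x :: 'm space. indicator (ball z0 1) (fst x) * indicator {a'<..<b'} (snd x) :: real"
  let ?h = "\<lambda>t. indicator {1/2<..<1/2 + \<delta>} t * (t - 1/2) powr ?e"
  let ?X = "\<lambda>p. ?W (fst p) * ?h (snd p)"
  have near: "3 \<le> z $ k" "2 < norm z" "norm z \<le> 5" if "z \<in> ball z0 1" for z
  proof -
    have "\<bar>(z0 - z) $ k\<bar> \<le> norm (z0 - z)" by (rule component_le_norm_cart)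
    also have "\<dots> < 1" using that by (simp add: dist_norm)
    finally show 1: "3 \<le> z $ k" by (simp add: z0_def)
    show "2 < norm z" using 1 component_le_norm_cart[of z k] by simp
    have "norm z \<le> norm z0 + norm (z0 - z)" by (metis norm_minus_commute norm_triangle_sub)
    then show "norm z \<le> 5" using \<open>norm (z0 - z) < 1\<close> by (simp add: z0_def)
  qed
  show ?thesis
  proof (rule Lnorm_infinite[where X="?X", OF q(1) c])
    show "?X \<in> borel_measurable (restrict_space lborel ?S)"
      by (rule measurable_restrict_space1) simp
    show "0 \<le> ?X p" for p by simp
    fix p assume "p \<in> space (restrict_space lborel ?S)"
    then have p: "p \<in> ?S" by (simp add: space_restrict_space)
    show "ennreal (c * ?X p) \<le> (case p of (x, t) \<Rightarrow> ennreal \<bar>pressure (force \<alpha> a k gT gN) x t\<bar>)"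
    proof (cases "fst (fst p) \<in> ball z0 1 \<and> snd p \<in> {1/2<..<1/2 + \<delta>}")
      case True
      have sp: "0 < snd (fst p)" "snd (fst p) < b'" "a' < snd (fst p)" using p ab by auto
      have "norm (fst p) \<le> norm (fst (fst p)) + norm (snd (fst p))" by (metis norm_Pair_le prod.collapse)
      also have "\<dots> \<le> 5 + b'" using near(3) True sp by (intro add_mono) auto
      finally have "c * (snd p - 1/2) powr ?e \<le> \<bar>pressure (force \<alpha> a k gT gN) (fst p) (snd p)\<bar>"
        using True sp near(1) by (intro low) auto
      then show ?thesis using True sp by (auto simp: case_prod_unfold intro!: ennreal_leI)
    next
      case False
      then have "?X p = 0" by (auto split: split_indicator)
      then show ?thesis by (simp only:) simp
    qed
  next
    define V where "V = measure lborel (ball z0 1) * measure lborel {a'<..<b'}"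
    have Ww: "has_bochner_integral lborel ?W V"
      using has_bochner_integral_lborel_prod[of "indicator (ball z0 1)" "indicator {a'<..<b'}"] ab
      by (simp add: V_def integrable_indicator_ball)
    have W: "(\<integral>\<^sup>+x. ennreal (?W x) \<partial>lborel) = ennreal V"
      using Ww by (subst nn_integral_eq_integral) (auto simp: has_bochner_integral_iff)
    have Wpos: "0 < V"
      using content_ball_pos[of 1 z0] ab by (simp add: V_def)
    have h: "(\<integral>\<^sup>+t. ennreal (?h t powr q) \<partial>lborel) = \<infinity>"
    proof -
      have "(\<integral>\<^sup>+t. ennreal (?h t powr q) \<partial>lborel)
          = (\<integral>\<^sup>+t. ennreal (indicator {0<..<\<delta>} (- (1/2) + 1 * t) * (- (1/2) + 1 * t) powr (?e * q)) \<partial>lborel)"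
        using q(1) by (intro nn_integral_cong) (auto simp: powr_powr split: split_indicator)
      also have "\<dots> = (\<integral>\<^sup>+u. ennreal (indicator {0<..<\<delta>} u * u powr (?e * q)) \<partial>lborel)"
        using nn_integral_real_affine[of "\<lambda>u. ennreal (indicator {0<..<\<delta>} u * u powr (?e * q))" 1 "- (1/2)"] by simp
      also have "\<dots> = \<infinity>" using \<delta> by (intro nn_integral_powr_diverges q) auto
      finally show ?thesis .
    qed
    have "(\<integral>\<^sup>+p. ennreal (?X p powr q) \<partial>restrict_space lborel ?S)
        = (\<integral>\<^sup>+p. ennreal (?X p powr q) * indicator ?S p \<partial>lborel)"
      using S by (intro nn_integral_restrict_space) simp
    also have "\<dots> = (\<integral>\<^sup>+p. ennreal (?W (fst p)) * ennreal (?h (snd p) powr q) \<partial>lborel)"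
    proof (intro nn_integral_cong)
      fix p :: "'m space \<times> real"
      show "ennreal (?X p powr q) * indicator ?S p = ennreal (?W (fst p)) * ennreal (?h (snd p) powr q)"
      proof (cases "fst (fst p) \<in> ball z0 1 \<and> snd (fst p) \<in> {a'<..<b'} \<and> snd p \<in> {1/2<..<1/2 + \<delta>}")
        case True
        then have "p \<in> ?S" using near(2) \<delta> by (auto simp: case_prod_unfold)
        then show ?thesis using True by simp
      next
        case False
        then have "?W (fst p) = 0 \<or> ?h (snd p) = 0" by (auto split: split_indicator)
        then show ?thesis using q(1) by auto
      qed
    qed
    also have "\<dots> = (\<integral>\<^sup>+x. \<integral>\<^sup>+t. ennreal (?W x) * ennreal (?h t powr q) \<partial>lborel \<partial>lborel)"
      by (subst lborel_prod[symmetric], subst lborel.nn_integral_fst[symmetric]) (simp_all add: lborel_prod)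
    also have "\<dots> = (\<integral>\<^sup>+x. ennreal (?W x) * \<infinity> \<partial>lborel)"
      by (intro nn_integral_cong) (subst nn_integral_cmult, auto simp: h)
    also have "\<dots> = (\<integral>\<^sup>+x. ennreal (?W x) \<partial>lborel) * \<infinity>" by (intro nn_integral_multc) simp
    also have "\<dots> = \<infinity>" unfolding W using Wpos by (simp add: ennreal_mult_top ennreal_top_mult mult.commute)
    finally show "(\<integral>\<^sup>+p. ennreal (?X p powr q) \<partial>restrict_space lborel ?S) = \<infinity>" .
  qed
qed

theorem theorem1p5:
  fixes n :: nat and \<alpha> \<beta> :: real and k :: "'m::finite"
    and gT :: "real^'m \<Rightarrow> real" and gN :: "real \<Rightarrow> real"
  assumes "n = CARD('m) + 1" and "n \<ge> 3"
    and "\<alpha> \<in> {0<..<1}" and "\<beta> \<in> {0<..<1/2}"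
    and "tangential_profile gT" and "normal_profile \<beta> gN"
  shows
    "(\<forall>(p::real) (q::real) (q\<^sub>1::real) (p\<^sub>1::real).
        p > 2 * real n / (real n - 1) \<and> q > 1 \<and> \<beta> > real n / ((real n - 1) * p) \<and>
        2 * \<alpha> + real n * \<beta> < 2 / q + real n / p + 1 \<and>
        q\<^sub>1 \<in> {1..<1/\<alpha>} \<and> p\<^sub>1 \<in> {1..<1/\<beta>} \<longrightarrow>
        (\<exists>c :: real \<Rightarrow> real. mono c \<and>
          (\<forall>a::real. a > 0 \<longrightarrow>
             LqLp_norm q\<^sub>1 p\<^sub>1 (force \<alpha> a k gT gN) < \<infinity> \<and>
             set_borel_measurable lborel (half_space \<times> {0<..<1})
               (\<lambda>(x, t). pressure (force \<alpha> a k gT gN) x t) \<and>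
             LqLp_norm q p (pressure (force \<alpha> a k gT gN))
               \<le> ennreal (c (enn2real (LqLp_norm q\<^sub>1 p\<^sub>1 (force \<alpha> a k gT gN)))))))
     \<and>
     (\<forall>(a::real) (q::real) (a'::real) (b'::real).
        a > 0 \<and> q > 1 \<and> 1 + 2 / q < 2 * \<alpha> + \<beta> \<and> 0 \<le> a' \<and> a' < b' \<longrightarrow>
        Lnorm (restrict_space lborel
                 {((x', x\<^sub>n), t). norm x' > 2 \<and> x\<^sub>n \<in> {a'<..<b'} \<and> t \<in> {0<..<1}}) q
          (\<lambda>(x, t). ennreal \<bar>pressure (force \<alpha> a k gT gN) x t\<bar>) = \<infinity>)"
proof -
  have card: "CARD('m) \<ge> 2" and n: "real n = real CARD('m) + 1" using assms(1,2) by auto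
  have \<alpha>: "0 < \<alpha>" "\<alpha> < 1" and \<beta>: "0 < \<beta>" "\<beta> < 1" using assms(3,4) by auto
  note gT = assms(5) and gN = assms(6) \<beta>
  show ?thesis
  proof (intro conjI allI impI)
    fix p q q1 p1 :: real
    assume H: "p > 2 * real n / (real n - 1) \<and> q > 1 \<and> \<beta> > real n / ((real n - 1) * p) \<and>
        2 * \<alpha> + real n * \<beta> < 2 / q + real n / p + 1 \<and> q1 \<in> {1..<1/\<alpha>} \<and> p1 \<in> {1..<1/\<beta>}"
    let ?d = "real CARD('m)"
    have d: "?d \<ge> 2" using card by simp
    have lt: "2 * (?d + 1) / ?d < p" using H n by simp
    have "0 < 2 * (?d + 1) / ?d" using d by (intro divide_pos_pos) auto
    then have p0: "0 < p" using lt by linarith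
    have d0: "0 < ?d" using d by linarith
    have "2 * (?d + 1) < p * ?d" using lt unfolding pos_divide_less_eq[OF d0] .
    then have p: "0 < p" "?d * p > ?d + 1" using p0 d by (simp_all add: mult.commute)
    have q: "0 < q" using H by simp
    have q1: "0 < q1" "\<alpha> * q1 < 1" using H \<alpha> by (auto simp: less_divide_eq mult.commute)
    have p1: "0 < p1" "\<beta> * p1 < 1" using H \<beta> by (auto simp: less_divide_eq mult.commute)
    have eq: "(1 - \<alpha> - (1 + \<beta>) / 2) * q > -1"
    proof -
      have n1: "real n - 1 = ?d" and d0: "0 < ?d" using n d by simp_all
      \<comment> \<open>The first hypothesis on \<open>\<beta>\<close> turns \<open>n / p\<close> in the second one into at most \<open>(n - 1) * \<beta>\<close>, which cancels all but one of the \<open>n * \<beta>\<close>.\<close>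
      have "(real n / p) / ?d = real n / ((real n - 1) * p)" unfolding n1 by simp
      also have "\<dots> < \<beta>" using H by blast
      finally have "real n / p < ?d * \<beta>" unfolding pos_divide_less_eq[OF d0] by (simp only: mult.commute)
      then have "2 * \<alpha> + \<beta> < 2 / q + 1" using H n by (simp add: algebra_simps)
      then have "(2 * \<alpha> + \<beta> - 1) * q < 2 / q * q" using q by (intro mult_strict_right_mono) auto
      then show ?thesis using q by (simp add: field_simps)
    qed
    obtain C where C: "0 \<le> C" "\<And>a. 0 < a \<Longrightarrow> LqLp_norm q p (pressure (force \<alpha> a k gT gN)) \<le> ennreal (a * C)"
      by (rule pressure_norm_finite[OF card gT gN \<alpha> p q eq, of k]) blast
    obtain c where c: "0 < c" "\<And>a. 0 < a \<Longrightarrow> ennreal (a * c) \<le> LqLp_norm q1 p1 (force \<alpha> a k gT gN)"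
      by (rule force_norm_lower[OF gT gN p1(1) q1(1) \<alpha>(1), of k]) blast
    show "\<exists>c :: real \<Rightarrow> real. mono c \<and>
          (\<forall>a::real. a > 0 \<longrightarrow>
             LqLp_norm q1 p1 (force \<alpha> a k gT gN) < \<infinity> \<and>
             set_borel_measurable lborel (half_space \<times> {0<..<1})
               (\<lambda>(x, t). pressure (force \<alpha> a k gT gN) x t) \<and>
             LqLp_norm q p (pressure (force \<alpha> a k gT gN))
               \<le> ennreal (c (enn2real (LqLp_norm q1 p1 (force \<alpha> a k gT gN)))))"
    \<comment> \<open>By linearity the ratio of the bounds for the pressure and for the force is independent of \<open>a\<close>.\<close>
    proof (intro exI[of _ "\<lambda>r. C / c * r"] conjI allI impI)
      show "mono (\<lambda>r. C / c * r)" using C c by (intro monoI mult_left_mono) auto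
      fix a :: real assume a: "a > 0"
      show fin: "LqLp_norm q1 p1 (force \<alpha> a k gT gN) < \<infinity>"
        by (rule force_norm_finite[OF gT gN p1 q1 a])
      show "set_borel_measurable lborel (half_space \<times> {0<..<1}) (\<lambda>(x, t). pressure (force \<alpha> a k gT gN) x t)"
        by (rule pressure_measurable[OF card gT gN])
      have "a * c \<le> enn2real (LqLp_norm q1 p1 (force \<alpha> a k gT gN))"
        using enn2real_mono[OF c(2)[OF a]] fin a c by simp
      then have "C / c * (a * c) \<le> C / c * enn2real (LqLp_norm q1 p1 (force \<alpha> a k gT gN))"
        using C c by (intro mult_left_mono) auto
      then have "a * C \<le> C / c * enn2real (LqLp_norm q1 p1 (force \<alpha> a k gT gN))" using c by (simp add: mult.commute)
      then show "LqLp_norm q p (pressure (force \<alpha> a k gT gN)) \<le> ennreal (C / c * enn2real (LqLp_norm q1 p1 (force \<alpha> a k gT gN)))"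
        using C(2)[OF a] by (meson ennreal_leI order_trans)
    qed
  next
    fix a q a' b' :: real
    assume H: "a > 0 \<and> q > 1 \<and> 1 + 2 / q < 2 * \<alpha> + \<beta> \<and> 0 \<le> a' \<and> a' < b'"
    have "2 / q * q < (2 * \<alpha> + \<beta> - 1) * q" using H by (intro mult_strict_right_mono) auto
    then have "(1 - \<alpha> - (1 + \<beta>) / 2) * q \<le> -1" using H by (simp add: field_simps)
    then show "Lnorm (restrict_space lborel
                 {((x', x\<^sub>n), t). norm x' > 2 \<and> x\<^sub>n \<in> {a'<..<b'} \<and> t \<in> {0<..<1}}) q
          (\<lambda>(x, t). ennreal \<bar>pressure (force \<alpha> a k gT gN) x t\<bar>) = \<infinity>"
      using H by (intro pressure_locally_unbounded[OF card gT gN \<alpha>]) auto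
  qed
qed

end
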